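(* Let $d\ge 2$ and let $\mathcal N$ be a Poisson random set on $\mathbb R^d$ with intensity measure $\mu$ comparable to Lebesgue measure. Let $f$ be a weight function, i.e. a nondecreasing function $f:[1,\infty)\to[1,\infty)$. There exist constants $z_1,c_1,c_2$ and $c_3$ in $(0,\infty)$ such that if $f$ is $c_1$-nice then for all $z\ge z_1$ and for all $n\ge 1$, $$\mathbb P\big(F_n(f,\mathcal N)>nz\big)\le \exp\{-c_2\, f^*(c_3nz)\}.$$ In particular, there also exists a constant $c_4\in(0,\infty)$ such that $$0\le f(3)\le\liminf_{n\to\infty}\mathbb E\Big(\frac{F_n(f,\mathcal N)}{n}\Big)\le\limsup_{n\to\infty}\mathbb E\Big(\frac{F_n(f,\mathcal N)}{n}\Big)<c_4 .$$
   Context: Comparability of $\mu$ to Lebesgue measure $\lambda_d$: there is $c_\mu>0$ with $\frac1{c_\mu}\lambda_d(A)\le\mu(A)\le c_\mu\lambda_d(A)$ for every Lebesgue-measurable $A\subset\mathbb R^d$. For $v\in\mathcal N$, the Voronoi tile $C_v$ is the set of points of $\mathbb R^d$ at least as close to $v$ as to any other $v'\in\mathcal N$; $d_{\mathcal N}(v)$ is the number of $(d-1)$-dimensional faces of $C_v$. A polyomino $\mathcal P$ of size $n$ is a connected union of $n$ Voronoi tiles; $v\in\mathcal P$ in a sum means that $C_v$ is one of the tiles of $\mathcal P$. $\Pi_n$ is the set of polyominoes of size $n$ containing the origin, and $$F_n(f,\mathcal N)=\max_{\mathcal P\in\Pi_n}\sum_{v\in\mathcal P}f(d_{\mathcal N}(v)).$$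 For a strictly increasing function $g:[1,\infty)\to[1,\infty)$, its pseudo-inverse is $g^{-1}(u)=\sup\{u'\in[1,\infty): g(u')<u\}$ (with the convention $\sup\emptyset=1$). For a weight function $f$ define $$\hat f=(x\mapsto xf(x))^{-1},\qquad f^*=\hat f\circ (y\mapsto y\hat f(y))^{-1}.$$ For $c\in(0,\infty)$, $f$ is called $c$-nice if $\liminf_{y\to\infty}\hat f(y)/\log y\ge c$. *)

theory Defs
  imports "HOL-Probability.Probability"
begin

definition comparable_to_lebesgue :: "(real ^ 'd) measure \<Rightarrow> bool" where
  "comparable_to_lebesgue \<mu> \<longleftrightarrow>
     sets \<mu> = sets lebesgue \<and>
     (\<exists>c>0. \<forall>A\<in>sets lebesgue.
        ennreal (1 / c) * emeasure lebesgue A \<le> emeasure \<mu> A \<and>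
        emeasure \<mu> A \<le> ennreal c * emeasure lebesgue A)"

definition num_points :: "'a set \<Rightarrow> 'a set \<Rightarrow> ennreal" where
  "num_points S A = emeasure (count_space UNIV) (S \<inter> A)"

text \<open>
  A Poisson random set, as a random locally finite set: the counts of Borel sets are random
  variables, independent over disjoint sets, and the count of A is Poisson with parameter
  \<open>\<mu> A\<close>, the Poisson law of infinite parameter being the point mass at infinity.
  Measurability of the counts is part of \<open>indep_vars\<close>.
\<close>
definition poisson_random_set ::
    "'w measure \<Rightarrow> ('w \<Rightarrow> (real ^ 'd) set) \<Rightarrow> (real ^ 'd) measure \<Rightarrow> bool" where
  "poisson_random_set M N \<mu> \<longleftrightarrow>
     (\<forall>\<omega>\<in>space M. \<forall>B. bounded B \<longrightarrow> finite (N \<omega> \<inter> B)) \<and>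
     (\<forall>A\<in>sets borel. emeasure \<mu> A < \<infinity> \<longrightarrow>
        (\<forall>k::nat. measure M {\<omega> \<in> space M. num_points (N \<omega>) A = of_nat k} =
            measure \<mu> A ^ k / fact k * exp (- measure \<mu> A))) \<and>
     (\<forall>A\<in>sets borel. emeasure \<mu> A = \<infinity> \<longrightarrow>
        (AE \<omega> in M. num_points (N \<omega>) A = \<infinity>)) \<and>
     (\<forall>(I :: nat set) A. finite I \<longrightarrow> disjoint_family_on A I \<longrightarrow> (\<forall>i\<in>I. A i \<in> sets borel) \<longrightarrow>
        prob_space.indep_vars M (\<lambda>_. borel) (\<lambda>i \<omega>. num_points (N \<omega>) (A i)) I)"

definition voronoi_tile :: "(real ^ 'd) set \<Rightarrow> real ^ 'd \<Rightarrow> (real ^ 'd) set" where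
  "voronoi_tile S v = {x. \<forall>v'\<in>S. dist x v \<le> dist x v'}"

definition voronoi_degree :: "(real ^ 'd) set \<Rightarrow> real ^ 'd \<Rightarrow> nat" where
  "voronoi_degree S v =
     card {T. T face_of voronoi_tile S v \<and> aff_dim T = int CARD('d) - 1}"

text \<open>
  A polyomino is represented by the set P of the centres of its tiles. Distinct points of a
  locally finite set have distinct tiles, with disjoint nonempty interiors, so P and the union
  of the tiles determine each other.
\<close>
definition polyominoes :: "nat \<Rightarrow> (real ^ 'd) set \<Rightarrow> (real ^ 'd) set set" where
  "polyominoes n S =
     {P. P \<subseteq> S \<and> finite P \<and> card P = n \<and>
         connected (\<Union>v\<in>P. voronoi_tile S v) \<and> 0 \<in> (\<Union>v\<in>P. voronoi_tile S v)}"

text \<open>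
  The maximum is taken in \<^typ>\<open>ennreal\<close>, so that it makes sense for every S. Almost surely, for a
  Poisson random set, there are finitely many polyominoes (and at least one, for positive n) and
  all the degrees involved are finite; then this is the maximum of finitely many finite sums.
\<close>
definition greedy_weight :: "nat \<Rightarrow> (real \<Rightarrow> real) \<Rightarrow> (real ^ 'd) set \<Rightarrow> ennreal" where
  "greedy_weight n f S =
     (SUP P\<in>polyominoes n S. \<Sum>v\<in>P. ennreal (f (real (voronoi_degree S v))))"

text \<open>Functions on \<open>[1,\<infinity>)\<close> are functions on the reals of which only the values on
  \<^term>\<open>{1::real..}\<close> matter.\<close>
definition weight_function :: "(real \<Rightarrow> real) \<Rightarrow> bool" where
  "weight_function f \<longleftrightarrow> mono_on {1..} f \<and> (\<forall>x\<ge>1. 1 \<le> f x)"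

definition pseudo_inverse :: "(real \<Rightarrow> real) \<Rightarrow> real \<Rightarrow> real" where
  "pseudo_inverse g u =
     (if {u'. 1 \<le> u' \<and> g u' < u} = {} then 1 else Sup {u'. 1 \<le> u' \<and> g u' < u})"

definition f_hat :: "(real \<Rightarrow> real) \<Rightarrow> real \<Rightarrow> real" where
  "f_hat f = pseudo_inverse (\<lambda>x. x * f x)"

definition f_star :: "(real \<Rightarrow> real) \<Rightarrow> real \<Rightarrow> real" where
  "f_star f = f_hat f \<circ> pseudo_inverse (\<lambda>y. y * f_hat f y)"

definition nice :: "real \<Rightarrow> (real \<Rightarrow> real) \<Rightarrow> bool" where
  "nice c f \<longleftrightarrow> ereal c \<le> Liminf at_top (\<lambda>y. ereal (f_hat f y / ln y))"

end

theory Submission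
  imports Defs
begin

text \<open>
  Space is cut into cells so large that each is empty with small probability; the cell counts are
  independent with exponential moments. A site is bad at scale \<open>\<rho>\<close> if some block of \<open>\<rho>\<close>^d cells near
  it is empty or if its neighbourhood contains too many points. This has probability at most
  exp(-c \<open>\<rho>\<close>^d), depends on about \<open>\<rho>\<close>^d cells, and tiles centred at sites that are not bad have at
  most \<open>\<kappa>\<close> \<open>\<rho>\<close>^d faces. With overwhelming probability the tiles of a polyomino of size n meet
  fewer than m cells, where m is a small multiple of nz, since most cells of a larger connected set
  would have to be empty. These cells are covered by a walk of length 2m. The number of bad points
  along all such walks is controlled, scale by scale, by an exponential moment bound: walks are sampled
  every r steps, with r growing exponentially in \<open>\<rho>\<close>^d, which makes the entropy negligible with
  respect to the cost of a bad site, as in the theory of greedy lattice animals. Summing over the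
  scales below x, where x^2 f(x) is of order nz (that is, x is \<open>f_star\<close> at a multiple of nz), and
  using that no site is bad at the top scale, gives the deviation bound. Niceness of f is used to
  absorb the growth of f and the number of sites.
\<close>

section \<open>Weight functions and their pseudo-inverses\<close>

text \<open>The rate \<open>f_star\<close> comes from a balance. Bad sites at scale \<rho> interact
  over \<rho>^d cells, so a cost x in the exponent buys an excess of order x \<rho>^d bad points at
  that scale, not x. A bad site at the top scale T costs T^d, so T^d must be of order x, and the
  degrees in play are then at most of order x. Weighting the excess by the increments of f and
  summing over the scales gives about x * x * f(x), which has to stay of order nz: this is the
  origin of the square. Niceness enters twice: as the growth bound f(x) <= K exp(2x/c), it lets the
  rarity of bad sites outweigh the increments of f; as a lower bound for \<open>f_star\<close>, it
  makes x exceed a multiple of log(nz), which pays for the order of (nz)^d sites in the union bound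
  at scale T. The constants \<open>c1\<close> and \<open>c2\<close> depend only on the point
  process; \<open>c3\<close> and \<open>z1\<close> also depend on f, through K and the thresholds of
  niceness. Measurability of the greedy weight is not established, so each estimate exhibits a
  measurable exceptional event outside which the bound holds for all walks or all
  polyominoes.\<close>

lemma weight_function_ge_1: "weight_function f \<Longrightarrow> 1 \<le> x \<Longrightarrow> 1 \<le> f x"
  by (simp add: weight_function_def)

lemma weight_function_mono: "weight_function f \<Longrightarrow> 1 \<le> x \<Longrightarrow> x \<le> y \<Longrightarrow> f x \<le> f y"
  by (auto simp: weight_function_def mono_on_def)

lemma bdd_above_f_hat:
  assumes "weight_function f"
  shows "bdd_above {x. 1 \<le> x \<and> x * f x < y}"
proof (rule bdd_aboveI[of _ "max y 1"])
  fix x assume "x \<in> {x. 1 \<le> x \<and> x * f x < y}"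
  then have "1 \<le> x" "x * f x < y" by auto
  moreover have "x * 1 \<le> x * f x"
    using \<open>1 \<le> x\<close> weight_function_ge_1[OF assms \<open>1 \<le> x\<close>] by (intro mult_left_mono) auto
  ultimately show "x \<le> max y 1" by linarith
qed

lemma f_hat_ge:
  assumes "weight_function f" "1 \<le> x" "x * f x < y"
  shows "x \<le> f_hat f y"
  using assms bdd_above_f_hat[OF assms(1), of y]
  by (auto simp: f_hat_def pseudo_inverse_def intro!: cSup_upper)

lemma f_hat_le:
  assumes "\<And>x. 1 \<le> x \<Longrightarrow> x * f x < y \<Longrightarrow> x \<le> b" "1 \<le> b"
  shows "f_hat f y \<le> b"
  using assms by (auto simp: f_hat_def pseudo_inverse_def intro!: cSup_least)

lemma f_hat_ge_1:
  assumes "weight_function f"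
  shows "1 \<le> f_hat f y"
proof (cases "{x. 1 \<le> x \<and> x * f x < y} = {}")
  case False
  then obtain x where "1 \<le> x" "x * f x < y" by auto
  with f_hat_ge[OF assms this] show ?thesis by simp
qed (simp add: f_hat_def pseudo_inverse_def)

text \<open>Converse of \<open>f_hat_ge\<close>: t * f t is nondecreasing, so a point x with x * f x
  at least y bounds the whole set whose supremum is \<open>f_hat f y\<close>.\<close>

lemma less_f_hatD:
  assumes "weight_function f" "1 \<le> x" "x < f_hat f y"
  shows "x * f x < y"
proof (rule ccontr)
  assume *: "\<not> x * f x < y"
  have "f_hat f y \<le> x"
  proof (rule f_hat_le)
    fix x' assume x': "1 \<le> x'" "x' * f x' < y"
    show "x' \<le> x"
    proof (rule ccontr)
      assume "\<not> x' \<le> x"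
      then have "x * f x \<le> x' * f x'"
        using assms x' weight_function_mono[OF assms(1,2), of x'] weight_function_ge_1[OF assms(1,2)]
        by (intro mult_mono) auto
      with * x' show False by simp
    qed
  qed (use assms in auto)
  with assms show False by simp
qed

lemma f_hat_mono:
  assumes "weight_function f" "y \<le> y'"
  shows "f_hat f y \<le> f_hat f y'"
proof (rule f_hat_le)
  show "x \<le> f_hat f y'" if "1 \<le> x" "x * f x < y" for x
    using assms that by (intro f_hat_ge) auto
qed (rule f_hat_ge_1[OF assms(1)])

lemma f_hat_le_self:
  assumes "weight_function f" "1 \<le> y"
  shows "f_hat f y \<le> y"
proof (rule f_hat_le)
  fix x assume "1 \<le> x" "x * f x < y"
  moreover have "x * 1 \<le> x * f x"
    using \<open>1 \<le> x\<close> weight_function_ge_1[OF assms(1) \<open>1 \<le> x\<close>] by (intro mult_left_mono) auto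
  ultimately show "x \<le> y" by linarith
qed (use assms in auto)

text \<open>Halving x at least halves x * f x because f is nondecreasing; the contradiction
  hypothesis also ensures x / 2 >= 1. In \<open>nice_imp_f_star_ge\<close> this moves a bound from
  just above a threshold back to the threshold.\<close>

lemma f_hat_double:
  assumes "weight_function f"
  shows "f_hat f (2 * y) \<le> 2 * f_hat f y"
proof (rule ccontr)
  assume "\<not> f_hat f (2 * y) \<le> 2 * f_hat f y"
  then obtain x where x: "2 * f_hat f y < x" "x < f_hat f (2 * y)" using dense by (auto simp: not_le)
  then have x2: "1 \<le> x / 2" using f_hat_ge_1[OF assms, of y] by simp
  have "x * f x < 2 * y" using x x2 by (intro less_f_hatD assms) auto
  moreover have "x / 2 * f (x / 2) \<le> x / 2 * f x"
    using x2 weight_function_mono[OF assms x2, of x] by (intro mult_left_mono) auto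
  ultimately have "x / 2 \<le> f_hat f y" by (intro f_hat_ge[OF assms x2]) auto
  with x show False by simp
qed

section \<open>The iterated inverse \<open>f_star\<close>\<close>

lemma f_star_alt: "f_star f u = f_hat f (pseudo_inverse (\<lambda>y. y * f_hat f y) u)"
  by (simp add: f_star_def)

lemma bdd_above_f_star:
  assumes "weight_function f"
  shows "bdd_above {y. 1 \<le> y \<and> y * f_hat f y < u}"
proof (rule bdd_aboveI[of _ "max u 1"])
  fix x assume "x \<in> {y. 1 \<le> y \<and> y * f_hat f y < u}"
  then have "1 \<le> x" "x * f_hat f x < u" by auto
  moreover have "x * 1 \<le> x * f_hat f x"
    using \<open>1 \<le> x\<close> f_hat_ge_1[OF assms] by (intro mult_left_mono) auto
  ultimately show "x \<le> max u 1" by linarith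
qed

text \<open>The witness y is the value of the inner pseudo-inverse in \<open>f_star\<close>. The
  inequalities are stated only at arguments other than y, so that no continuity of
  \<open>f_hat\<close> has to be proved.\<close>

lemma f_star_sandwich:
  assumes "weight_function f" "1 < u"
  obtains y where "1 \<le> y" "f_star f u = f_hat f y"
    "\<And>y'. 1 \<le> y' \<Longrightarrow> y' < y \<Longrightarrow> y' * f_hat f y' < u"
    "\<And>y'. y < y' \<Longrightarrow> u \<le> y' * f_hat f y'"
proof -
  define A where "A = {y. 1 \<le> y \<and> y * f_hat f y < u}"
  have "f_hat f 1 = 1"
    using f_hat_le_self[OF assms(1), of 1] f_hat_ge_1[OF assms(1), of 1] by simp
  then have A1: "1 \<in> A" unfolding A_def using assms(2) by simp
  then have ne: "A \<noteq> {}" by blast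
  have bdd: "bdd_above A" unfolding A_def by (rule bdd_above_f_star[OF assms(1)])
  have "pseudo_inverse (\<lambda>y. y * f_hat f y) u = Sup A"
    using ne unfolding pseudo_inverse_def A_def by (rule if_not_P)
  then have 1: "f_star f u = f_hat f (Sup A)" by (simp only: f_star_alt)
  have 2: "1 \<le> Sup A" using A1 bdd by (rule cSup_upper)
  have 3: "y' * f_hat f y' < u" if "1 \<le> y'" "y' < Sup A" for y'
  proof -
    obtain y where y: "y \<in> A" "y' < y" using \<open>y' < Sup A\<close> less_cSup_iff[OF ne bdd] by blast
    have "y' * f_hat f y' \<le> y * f_hat f y"
      using y that f_hat_ge_1[OF assms(1), of y'] f_hat_mono[OF assms(1), of y' y]
      by (intro mult_mono) auto
    with y show ?thesis unfolding A_def by simp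
  qed
  have 4: "u \<le> y' * f_hat f y'" if "Sup A < y'" for y'
  proof (rule ccontr)
    assume "\<not> u \<le> y' * f_hat f y'"
    then have "y' \<in> A" using that 2 unfolding A_def by simp
    then have "y' \<le> Sup A" using bdd by (rule cSup_upper)
    with that show False by simp
  qed
  show thesis by (rule that[OF 2 1 3 4])
qed

text \<open>This is the sense in which \<open>f_star f\<close> inverts x^2 f(x). For the inner value
  y one has x * f x < y; at an intermediate y', both x * f x <= y' and x <=
  \<open>f_hat f y'\<close> hold while y' * \<open>f_hat f y'\<close> < u, and the two bounds are
  multiplied.\<close>

lemma less_f_starD:
  assumes f: "weight_function f" and u: "1 < u" and x: "1 \<le> x" "x < f_star f u"
  shows "x\<^sup>2 * f x \<le> u"
proof -
  obtain y where y: "1 \<le> y" "f_star f u = f_hat f y"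
    "\<And>y'. 1 \<le> y' \<Longrightarrow> y' < y \<Longrightarrow> y' * f_hat f y' < u"
    using f_star_sandwich[OF f u] by metis
  have lt: "x * f x < y" using less_f_hatD[OF f x(1), of y] x y by simp
  define y' where "y' = max 1 ((x * f x + y) / 2)"
  have fx: "1 \<le> f x" using f x by (simp add: weight_function_ge_1)
  have xfx: "1 \<le> x * f x" using mult_mono[of 1 x 1 "f x"] fx x by simp
  then have y': "1 \<le> y'" "y' < y" "x * f x < y'" using lt by (auto simp: y'_def)
  have "x \<le> f_hat f y'" using f x y' by (intro f_hat_ge)
  have "x\<^sup>2 * f x = (x * f x) * x" by (simp add: power2_eq_square)
  also have "\<dots> \<le> y' * f_hat f y'"
    using \<open>x \<le> f_hat f y'\<close> y' x xfx by (intro mult_mono) auto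
  also have "\<dots> < u" using y y' by simp
  finally show ?thesis by simp
qed

lemma f_star_le_sqrt:
  assumes f: "weight_function f" and u: "1 < u"
  shows "f_star f u \<le> sqrt u"
proof (rule ccontr)
  assume "\<not> ?thesis"
  then obtain x where x: "sqrt u < x" "x < f_star f u" using dense by (auto simp: not_le)
  have "1 < sqrt u" using u by simp
  then have "1 \<le> x" using x by linarith
  have "x\<^sup>2 * 1 \<le> x\<^sup>2 * f x"
    using weight_function_ge_1[OF f \<open>1 \<le> x\<close>] by (intro mult_left_mono) auto
  also have "\<dots> \<le> u" by (rule less_f_starD) (use f u x \<open>1 \<le> x\<close> in auto)
  finally have "x \<le> sqrt u" by (simp add: real_le_rsqrt)
  with x show False by simp
qed

section \<open>Niceness as a growth condition\<close>

lemma niceD: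
  assumes "nice c f" "0 < c"
  obtains Y where "1 \<le> Y" "\<And>y. Y \<le> y \<Longrightarrow> c / 2 * ln y \<le> f_hat f y"
proof -
  have "ereal (c / 2) < ereal c" using assms by simp
  also have "\<dots> \<le> Liminf at_top (\<lambda>y. ereal (f_hat f y / ln y))"
    using assms(1) unfolding nice_def .
  finally have "ereal (c / 2) < Liminf at_top (\<lambda>y. ereal (f_hat f y / ln y))" .
  then have "\<forall>\<^sub>F y in at_top. ereal (c / 2) < ereal (f_hat f y / ln y)"
    by (rule less_LiminfD)
  then obtain Y where Y: "\<And>y. Y \<le> y \<Longrightarrow> c / 2 < f_hat f y / ln y"
    by (auto simp: eventually_at_top_linorder)
  show thesis
  proof (rule that[of "max Y 2"])
    fix y assume "max Y 2 \<le> y"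
    then have "c / 2 < f_hat f y / ln y" "0 < ln y" using Y by auto
    then show "c / 2 * ln y \<le> f_hat f y" by (simp add: field_simps)
  qed auto
qed

text \<open>Since \<open>f_hat f (x * f x)\<close> is at most x, a logarithmic lower bound for
  \<open>f_hat\<close> at x * f x is an exponential upper bound for f x. Taking K = Y covers the
  arguments with x * f x below the threshold of niceness.\<close>

lemma nice_imp_exp_bound:
  assumes f: "weight_function f" and "nice c f" "0 < c"
  obtains K where "1 \<le> K" "\<And>x. 1 \<le> x \<Longrightarrow> f x \<le> K * exp (2 * x / c)"
proof -
  obtain Y where Y: "1 \<le> Y" "\<And>y. Y \<le> y \<Longrightarrow> c / 2 * ln y \<le> f_hat f y"
    using niceD assms by blast
  show thesis
  proof (rule that[of Y])
    fix x :: real assume x: "1 \<le> x"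
    have fx: "1 \<le> f x" using f x by (simp add: weight_function_ge_1)
    have "1 * f x \<le> x * f x" using x fx by (intro mult_right_mono) auto
    show "f x \<le> Y * exp (2 * x / c)"
    proof (cases "x * f x < Y")
      case True
      have "Y * 1 \<le> Y * exp (2 * x / c)" using Y x assms by (intro mult_left_mono) auto
      then show ?thesis using True \<open>1 * f x \<le> x * f x\<close> by simp
    next
      case False
      have "f_hat f (x * f x) \<le> x"
      proof (rule ccontr)
        assume "\<not> f_hat f (x * f x) \<le> x"
        then have "x * f x < x * f x" by (intro less_f_hatD[OF f x]) simp
        then show False by simp
      qed
      then have "c / 2 * ln (x * f x) \<le> x" using Y(2)[of "x * f x"] False by simp
      then have "ln (x * f x) \<le> 2 * x / c" using assms by (simp add: field_simps)
      then have "x * f x \<le> exp (2 * x / c)"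
        using x fx by (subst ln_le_cancel_iff[symmetric]) auto
      also have "\<dots> = 1 * \<dots>" by simp
      also have "\<dots> \<le> Y * exp (2 * x / c)" using Y by (intro mult_right_mono) auto
      finally show ?thesis using \<open>1 * f x \<le> x * f x\<close> by simp
    qed
  qed (use Y in auto)
qed

text \<open>The inner value y is at least sqrt(u / 16): just above it, u <= 2y *
  \<open>f_hat f (2 * y)\<close> <= 4y * \<open>f_star f u\<close>, and \<open>f_star f u\<close> <=
  sqrt u. The square root halves the constant of \<open>niceD\<close>, and 16 is the square of the
  lost factor 4.\<close>

lemma nice_imp_f_star_ge:
  assumes f: "weight_function f" and "nice c f" "0 < c"
  obtains U where "1 < U" "\<And>u. U \<le> u \<Longrightarrow> c / 4 * ln (u / 16) \<le> f_star f u"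
proof -
  obtain Y where Y: "1 \<le> Y" "\<And>y. Y \<le> y \<Longrightarrow> c / 2 * ln y \<le> f_hat f y"
    using niceD assms by blast
  show thesis
  proof (rule that[of "max 2 (16 * Y\<^sup>2)"])
    fix u assume u: "max 2 (16 * Y\<^sup>2) \<le> u"
    then have "1 < u" by simp
    obtain y where y: "1 \<le> y" "f_star f u = f_hat f y" "\<And>y'. y < y' \<Longrightarrow> u \<le> y' * f_hat f y'"
      using f_star_sandwich[OF f \<open>1 < u\<close>] by metis
    have "u \<le> (2 * y) * f_hat f (2 * y)" using y by simp
    also have "\<dots> \<le> (2 * y) * (2 * f_hat f y)" using y by (intro mult_left_mono f_hat_double f) auto
    also have "\<dots> \<le> (2 * y) * (2 * sqrt u)"
      using y f_star_le_sqrt[OF f \<open>1 < u\<close>] by (intro mult_left_mono) auto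
    finally have "sqrt u * sqrt u \<le> (4 * y) * sqrt u" using \<open>1 < u\<close> by (simp add: mult.assoc)
    then have "sqrt u \<le> 4 * y" by (rule mult_right_le_imp_le) (use \<open>1 < u\<close> in simp)
    then have "sqrt u / 4 \<le> y" by simp
    moreover have "sqrt (16 * Y\<^sup>2) \<le> sqrt u" using u by (subst real_sqrt_le_iff) simp
    then have "Y \<le> sqrt u / 4" using Y by (simp add: real_sqrt_mult)
    ultimately have "c / 2 * ln y \<le> f_star f u" using Y y by simp
    moreover have "sqrt u / 4 = sqrt (u / 16)" by (simp add: real_sqrt_divide)
    then have "ln (u / 16) / 2 \<le> ln y"
      using \<open>sqrt u / 4 \<le> y\<close> \<open>1 < u\<close> by (subst ln_sqrt[symmetric]) (auto intro!: ln_mono)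
    then have "c / 2 * (ln (u / 16) / 2) \<le> c / 2 * ln y" using assms by (intro mult_left_mono) auto
    ultimately show "c / 4 * ln (u / 16) \<le> f_star f u" by simp
  qed auto
qed

section \<open>Voronoi tiles\<close>

definition locally_finite_set :: "'a::metric_space set \<Rightarrow> bool" where
  "locally_finite_set S \<longleftrightarrow> (\<forall>B. bounded B \<longrightarrow> finite (S \<inter> B))"

lemma dist_le_iff_halfspace:
  fixes v v' x :: "'a::euclidean_space"
  shows "dist x v \<le> dist x v' \<longleftrightarrow> (2 *\<^sub>R (v' - v)) \<bullet> x \<le> v' \<bullet> v' - v \<bullet> v"
  unfolding dist_norm norm_le
  by (simp add: algebra_simps inner_commute)

lemma convex_dist_le: "convex {x::'a::euclidean_space. dist x v \<le> dist x v'}"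
  unfolding dist_le_iff_halfspace by (rule convex_halfspace_le)

lemma voronoi_tile_Inter: "voronoi_tile S v = (\<Inter>v'\<in>S. {x. dist x v \<le> dist x v'})"
  by (auto simp: voronoi_tile_def)

lemma convex_voronoi_tile: "convex (voronoi_tile S v)"
  unfolding voronoi_tile_Inter by (intro convex_INT convex_dist_le)

lemma closed_voronoi_tile: "closed (voronoi_tile S v)"
  unfolding voronoi_tile_Inter by (intro closed_INT ballI closed_Collect_le continuous_intros)

lemma center_in_voronoi_tile: "v \<in> voronoi_tile S v"
  by (simp add: voronoi_tile_def)

text \<open>A segment from v to a point outside the ball would cross the sphere. To bound a tile it
  is thus enough to inspect the points of one sphere.\<close>

lemma convex_subset_ball:
  fixes C :: "'a::euclidean_space set"
  assumes "convex C" "v \<in> C" "0 < R" "\<And>x. x \<in> C \<Longrightarrow> dist x v \<noteq> R"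
  shows "C \<subseteq> ball v R"
proof
  fix y assume y: "y \<in> C"
  show "y \<in> ball v R"
  proof (rule ccontr)
    assume "y \<notin> ball v R"
    then have R: "R \<le> dist y v" by (simp add: dist_commute)
    define t where "t = R / dist y v"
    have t: "0 \<le> t" "t \<le> 1" using R \<open>0 < R\<close> by (auto simp: t_def divide_le_eq_1)
    have "(1 - t) *\<^sub>R v + t *\<^sub>R y \<in> C" using convexD_alt[OF assms(1) assms(2) y t] .
    moreover have "(1 - t) *\<^sub>R v + t *\<^sub>R y - v = t *\<^sub>R (y - v)" by (simp add: algebra_simps)
    then have "dist ((1 - t) *\<^sub>R v + t *\<^sub>R y) v = t * dist y v"
      using t by (simp add: dist_norm)
    moreover have "t * dist y v = R" using R \<open>0 < R\<close> by (auto simp: t_def)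
    ultimately show False using assms(4) by metis
  qed
qed

lemma voronoi_tile_subset_ball:
  assumes "0 < R" "\<And>x. dist x v = R \<Longrightarrow> \<exists>v'\<in>S. dist x v' < R"
  shows "voronoi_tile S v \<subseteq> ball v R"
proof (rule convex_subset_ball[OF convex_voronoi_tile center_in_voronoi_tile assms(1)])
  fix x assume "x \<in> voronoi_tile S v"
  then show "dist x v \<noteq> R" using assms(2)[of x] by (force simp: voronoi_tile_def)
qed

text \<open>Points within R + 1/2 of v are never closer to a site farther than 2R + 1 from v than to
  v. So within that radius the finite intersection agrees with the tile, hence it misses the sphere
  of radius R + 1/2 and, being convex, stays inside it. The margin 1/2 separates this sphere from
  the ball containing the tile. The site v is removed because its half-space would be
  degenerate.\<close>

lemma voronoi_tile_eq_finite:
  assumes "0 < R" and sub: "voronoi_tile S v \<subseteq> ball v R"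
  shows "voronoi_tile S v = (\<Inter>v'\<in>(S \<inter> cball v (2 * R + 1)) - {v}. {x. dist x v \<le> dist x v'})"
    (is "_ = ?Q")
proof
  show "voronoi_tile S v \<subseteq> ?Q" by (auto simp: voronoi_tile_def)
  have near: "x \<in> voronoi_tile S v" if "x \<in> ?Q" "dist x v \<le> R + 1/2" for x
    unfolding voronoi_tile_def
  proof (intro CollectI ballI)
    fix v' assume "v' \<in> S"
    show "dist x v \<le> dist x v'"
    proof (cases "dist v v' \<le> 2 * R + 1 \<and> v' \<noteq> v")
      case False
      have "dist v v' \<le> dist v x + dist x v'" by (rule dist_triangle)
      then show ?thesis using False that(2) by (auto simp: dist_commute)
    qed (use that \<open>v' \<in> S\<close> in auto)
  qed
  have bnd: "?Q \<subseteq> ball v (R + 1/2)"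
  proof (rule convex_subset_ball)
    show "convex ?Q" by (intro convex_INT convex_dist_le)
    fix x assume x: "x \<in> ?Q"
    show "dist x v \<noteq> R + 1/2"
    proof
      assume "dist x v = R + 1/2"
      then have "x \<in> ball v R" using near[OF x] sub by auto
      then show False using \<open>dist x v = R + 1/2\<close> by (simp add: dist_commute)
    qed
  qed (use \<open>0 < R\<close> in auto)
  show "?Q \<subseteq> voronoi_tile S v"
  proof
    fix x assume x: "x \<in> ?Q"
    then have "x \<in> ball v (R + 1/2)" using bnd by (rule rev_subsetD)
    then show "x \<in> voronoi_tile S v" using near[OF x] by (simp add: dist_commute)
  qed
qed

lemma interior_voronoi_tile:
  assumes "locally_finite_set S"
  shows "v \<in> interior (voronoi_tile S v)"
proof -
  have "finite (S \<inter> cball v 1)" using assms by (simp add: locally_finite_set_def)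
  then obtain d where d: "0 < d" "\<And>x. x \<in> S \<inter> cball v 1 \<Longrightarrow> x \<noteq> v \<Longrightarrow> d \<le> dist v x"
    using finite_set_avoid[of "S \<inter> cball v 1" v] by blast
  define e where "e = min d 1 / 2"
  have e: "2 * e \<le> 1" "2 * e \<le> d" by (auto simp: e_def)
  have "x \<in> voronoi_tile S v" if "dist v x < e" for x
    unfolding voronoi_tile_def
  proof (intro CollectI ballI)
    fix v' assume v': "v' \<in> S"
    have tri: "dist v v' \<le> dist v x + dist x v'" by (rule dist_triangle)
    show "dist x v \<le> dist x v'"
    proof (cases "v' = v \<or> dist v v' > 1")
      case True
      then show ?thesis using tri that e(1) dist_commute[of x v] by (elim disjE) (simp, linarith)
    next
      case False
      then have "d \<le> dist v v'" using d v' by auto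
      then show ?thesis using tri that e(2) dist_commute[of x v] by linarith
    qed
  qed
  then have "ball v e \<subseteq> voronoi_tile S v" by auto
  moreover have "0 < e" using d by (simp add: e_def)
  ultimately show ?thesis by (auto simp: mem_interior)
qed

section \<open>Facets of Voronoi tiles\<close>

lemma voronoi_degree_eq_facets:
  fixes S :: "(real ^ 'd) set"
  assumes "locally_finite_set S"
  shows "voronoi_degree S v = card {C. C facet_of voronoi_tile S v}"
proof -
  have "interior (voronoi_tile S v) \<noteq> {}" using interior_voronoi_tile[OF assms] by blast
  then have *: "aff_dim (voronoi_tile S v) = int CARD('d)"
    by (simp add: aff_dim_nonempty_interior)
  have "(T face_of voronoi_tile S v \<and> aff_dim T = int CARD('d) - 1) \<longleftrightarrow> T facet_of voronoi_tile S v" for T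
    unfolding facet_of_def * by auto
  then show ?thesis by (simp add: voronoi_degree_def)
qed

text \<open>A minimal subfamily with the same intersection is irredundant, and
  \<open>facet_of_polyhedron_explicit\<close> then attaches each facet to the bounding hyperplane of
  one of its members.\<close>

lemma card_facets_Inter_halfspaces:
  fixes T :: "'a::euclidean_space set"
  assumes "finite \<H>" "T = \<Inter>\<H>" "interior T \<noteq> {}"
    and half: "\<And>h. h \<in> \<H> \<Longrightarrow> \<exists>a b. a \<noteq> 0 \<and> h = {x. a \<bullet> x \<le> b}"
  shows "finite {C. C facet_of T}" "card {C. C facet_of T} \<le> card \<H>"
proof -
  obtain a b where ab: "\<And>h. h \<in> \<H> \<Longrightarrow> a h \<noteq> 0 \<and> h = {x. a h \<bullet> x \<le> b h}"
    using half by metis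
  have hull: "affine hull T = UNIV" using assms(3) by (rule affine_hull_nonempty_interior)
  let ?\<F> = "{F. F \<subseteq> \<H> \<and> T = \<Inter>F}"
  have "finite ?\<F>" using assms(1) by simp
  moreover have "?\<F> \<noteq> {}" using assms(2) by blast
  ultimately obtain F where F: "F \<in> ?\<F>" "\<forall>F'\<in>?\<F>. F' \<subseteq> F \<longrightarrow> F = F'"
    using finite_has_minimal[of ?\<F>] by (elim meta_impE) blast+
  have fin: "finite F" using F(1) assms(1) finite_subset by auto
  have facet: "C facet_of T \<longleftrightarrow> (\<exists>h. h \<in> F \<and> C = T \<inter> {x. a h \<bullet> x = b h})" for C
  proof (rule facet_of_polyhedron_explicit[OF fin])
    show "T = affine hull T \<inter> \<Inter>F" using F hull by simp
    show "h \<in> F \<Longrightarrow> a h \<noteq> 0 \<and> h = {x. a h \<bullet> x \<le> b h}" for h using F ab by blast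
    fix F' assume "F' \<subset> F"
    then have "T \<noteq> \<Inter>F'" using F by blast
    moreover have "T \<subseteq> \<Inter>F'" using F \<open>F' \<subset> F\<close> by blast
    ultimately show "T \<subset> affine hull T \<inter> \<Inter>F'" using hull by auto
  qed
  have eq: "{C. C facet_of T} = (\<lambda>h. T \<inter> {x. a h \<bullet> x = b h}) ` F" using facet by blast
  show "finite {C. C facet_of T}" unfolding eq using fin by simp
  have "card {C. C facet_of T} \<le> card F" unfolding eq using fin by (rule card_image_le)
  also have "\<dots> \<le> card \<H>" using F assms(1) by (intro card_mono) auto
  finally show "card {C. C facet_of T} \<le> card \<H>" .
qed

lemma bounded_line_exits:
  fixes T :: "'a::euclidean_space set"
  assumes "bounded T" "x \<in> interior T" "u \<noteq> 0"
  obtains t where "0 < t" "x + t *\<^sub>R u \<in> frontier T"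
proof -
  obtain d where "0 < d" "x + d *\<^sub>R u \<in> frontier T"
    using ray_to_frontier[OF assms] by metis
  then show thesis using that by blast
qed

text \<open>A line through an interior point and parallel to the first of two facet hyperplanes
  could leave the polytope on both sides only through the second one.\<close>
lemma card_facets_ge_3:
  fixes T :: "'a::euclidean_space set"
  assumes "polyhedron T" "bounded T" and int: "interior T \<noteq> {}" and dim: "2 \<le> DIM('a)"
    and fin: "finite {C. C facet_of T}"
  shows "3 \<le> card {C. C facet_of T}"
proof (rule ccontr)
  assume "\<not> ?thesis"
  then have "card {C. C facet_of T} \<le> 2" by simp
  then obtain C1 C2 where C: "{C. C facet_of T} \<subseteq> {C1, C2}"
  proof (cases "card {C. C facet_of T} = 2")
    case True
    then show thesis using that unfolding card_2_iff by blast
  next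
    case False
    then have "card {C. C facet_of T} \<le> Suc 0" using \<open>card {C. C facet_of T} \<le> 2\<close> by linarith
    then have "\<forall>C\<in>{C. C facet_of T}. \<forall>C'\<in>{C. C facet_of T}. C = C'"
      using card_le_Suc0_iff_eq[OF fin] by blast
    then have "{C. C facet_of T} \<subseteq> {SOME C. C facet_of T, SOME C. C facet_of T}"
      by (metis (mono_tags, lifting) insertCI mem_Collect_eq someI_ex subsetI)
    then show thesis by (rule that)
  qed
  \<comment> \<open>If C is not a facet, some half-space containing T serves as a placeholder, which
    boundedness provides. The cases of zero, one and two facets are then treated at once.\<close>
  have hyp: "\<exists>a b. a \<noteq> 0 \<and> (\<forall>x\<in>T. a \<bullet> x \<le> b) \<and> (C facet_of T \<longrightarrow> (\<forall>x\<in>C. a \<bullet> x = b))" for C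
  proof (cases "C facet_of T")
    case True
    then have "C face_of T" "C \<noteq> T" "C \<noteq> {}" by (auto simp: facet_of_def)
    then have "C exposed_face_of T" using exposed_face_of_polyhedron[OF assms(1)] by blast
    then obtain a b where "a \<noteq> 0" "T \<subseteq> {x. a \<bullet> x \<le> b}" "C = T \<inter> {x. a \<bullet> x = b}"
      using \<open>C \<noteq> {}\<close> \<open>C \<noteq> T\<close> unfolding exposed_face_of by blast
    then show ?thesis by (intro exI[of _ a] exI[of _ b]) auto
  next
    case False
    obtain B where B: "\<And>x. x \<in> T \<Longrightarrow> norm x \<le> B" using assms(2) by (auto simp: bounded_iff)
    obtain e :: 'a where e: "e \<in> Basis" using nonempty_Basis by blast
    have "e \<bullet> x \<le> B" if "x \<in> T" for x
      using B[OF that] Basis_le_norm[OF e, of x] by (simp add: inner_commute)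
    then show ?thesis using False e nonzero_Basis by blast
  qed
  obtain a1 b1 where 1: "a1 \<noteq> 0" "\<forall>x\<in>T. a1 \<bullet> x \<le> b1" "C1 facet_of T \<longrightarrow> (\<forall>x\<in>C1. a1 \<bullet> x = b1)"
    using hyp by blast
  obtain a2 b2 where 2: "a2 \<noteq> 0" "\<forall>x\<in>T. a2 \<bullet> x \<le> b2" "C2 facet_of T \<longrightarrow> (\<forall>x\<in>C2. a2 \<bullet> x = b2)"
    using hyp by blast
  obtain x where x: "x \<in> interior T" using int by blast
  have strict: "a \<bullet> x < b" if "a \<noteq> 0" "\<forall>x\<in>T. a \<bullet> x \<le> b" for a b
  proof -
    have "T \<subseteq> {x. a \<bullet> x \<le> b}" using that by blast
    then have "interior T \<subseteq> interior {x. a \<bullet> x \<le> b}" by (rule interior_mono)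
    then show ?thesis using x interior_halfspace_le[OF that(1)] by auto
  qed
  obtain u where u: "u \<noteq> 0" "orthogonal a1 u"
  proof -
    have "dim {a1} \<le> 1" using dim_le_card[of "{a1}" "{a1}"] by (simp add: span_superset)
    then obtain u where "u \<noteq> 0" "\<And>y. y \<in> span {a1} \<Longrightarrow> orthogonal u y"
      using dim orthogonal_to_subspace_exists[of "{a1}"] by auto
    then show thesis using that by (metis orthogonal_commute span_base singletonI)
  qed
  have exit: "a2 \<bullet> w > 0" if "w \<noteq> 0" "a1 \<bullet> w = 0" for w
  proof -
    obtain t where t: "0 < t" "x + t *\<^sub>R w \<in> frontier T"
      by (rule bounded_line_exits[OF assms(2) x \<open>w \<noteq> 0\<close>])
    have "rel_interior T = interior T" using int by (rule rel_interior_nonempty_interior)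
    then have "frontier T = \<Union>{F. F facet_of T}"
      using rel_boundary_of_polyhedron[OF assms(1)] closure_closed[OF polyhedron_imp_closed[OF assms(1)]]
      by (simp add: frontier_def)
    then obtain C where C': "C facet_of T" "x + t *\<^sub>R w \<in> C" using t by blast
    moreover have "C \<noteq> C1"
    proof
      assume "C = C1"
      then have "a1 \<bullet> (x + t *\<^sub>R w) = b1" using C' 1(3) by blast
      then show False using strict[OF 1(1,2)] that by (simp add: inner_add_right)
    qed
    ultimately have "C = C2" using C by blast
    then have "a2 \<bullet> (x + t *\<^sub>R w) = b2" using C' 2(3) by blast
    then have "0 < t * (a2 \<bullet> w)" using strict[OF 2(1,2)] by (simp add: inner_add_right)
    then show ?thesis using t by (simp add: zero_less_mult_iff)
  qed
  have "a1 \<bullet> u = 0" using u by (simp add: orthogonal_def)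
  then show False using exit[of u] exit[of "- u"] u by auto
qed

lemma voronoi_degree_bounds:
  fixes S :: "(real ^ 'd) set"
  assumes lf: "locally_finite_set S" and R: "0 < R" and sub: "voronoi_tile S v \<subseteq> ball v R"
    and d: "2 \<le> CARD('d)"
  shows "3 \<le> voronoi_degree S v" "voronoi_degree S v \<le> card (S \<inter> cball v (2 * R + 1))"
proof -
  let ?A = "(S \<inter> cball v (2 * R + 1)) - {v}" and ?h = "\<lambda>v'. {x. dist x v \<le> dist x v'}"
  let ?T = "voronoi_tile S v"
  have finS: "finite (S \<inter> cball v (2 * R + 1))" using lf by (simp add: locally_finite_set_def)
  then have fin: "finite (?h ` ?A)" by simp
  have eq: "?T = \<Inter>(?h ` ?A)" by (rule voronoi_tile_eq_finite[OF R sub])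
  have int: "interior ?T \<noteq> {}" using interior_voronoi_tile[OF lf] by blast
  have half: "\<exists>a b. a \<noteq> 0 \<and> h = {x. a \<bullet> x \<le> b}" if h: "h \<in> ?h ` ?A" for h
  proof -
    obtain v' where v': "v' \<in> ?A" "h = ?h v'" using h by blast
    have "h = {x. (2 *\<^sub>R (v' - v)) \<bullet> x \<le> v' \<bullet> v' - v \<bullet> v}"
      unfolding v'(2) dist_le_iff_halfspace ..
    moreover have "2 *\<^sub>R (v' - v) \<noteq> 0" using v'(1) by simp
    ultimately show ?thesis by blast
  qed
  note facets = card_facets_Inter_halfspaces[OF fin eq int half]
  have "polyhedron ?T" unfolding polyhedron_def
    by (intro exI[of _ "?h ` ?A"] conjI ballI fin eq half)
  moreover have "bounded ?T" using sub bounded_subset by blast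
  ultimately show "3 \<le> voronoi_degree S v"
    unfolding voronoi_degree_eq_facets[OF lf] using facets(1) int d
    by (intro card_facets_ge_3) auto
  have "voronoi_degree S v \<le> card (?h ` ?A)"
    unfolding voronoi_degree_eq_facets[OF lf] by (rule facets(2))
  also have "\<dots> \<le> card ?A" using finS by (intro card_image_le) auto
  also have "\<dots> \<le> card (S \<inter> cball v (2 * R + 1))" using finS by (intro card_mono) auto
  finally show "voronoi_degree S v \<le> card (S \<inter> cball v (2 * R + 1))" .
qed

section \<open>Existence of polyominoes of every size\<close>

lemma ex_voronoi_tile:
  fixes S :: "(real ^ 'd) set"
  assumes "locally_finite_set S" "S \<noteq> {}"
  obtains v where "v \<in> S" "x \<in> voronoi_tile S v"
proof -
  obtain s where s: "s \<in> S" using assms by blast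
  let ?A = "S \<inter> cball x (dist x s)"
  have "finite ?A" "?A \<noteq> {}" using assms s by (auto simp: locally_finite_set_def)
  then obtain v where v: "v \<in> ?A" "\<And>w. w \<in> ?A \<Longrightarrow> dist x v \<le> dist x w"
    using arg_min_if_finite[of ?A "dist x"] by (meson not_le)
  have "dist x v \<le> dist x w" if "w \<in> S" for w
    using v that by (cases "w \<in> ?A") auto
  then show thesis using that[of v] v by (auto simp: voronoi_tile_def)
qed

text \<open>Near a frontier point x of the union U, every point y outside U lies in the tile of a
  site outside P. Such a site is within \<open>dist x s + 2\<close> of x, where 2 accounts for going
  from x to y and back. Only finitely many tiles are involved, so their union is closed and contains
  x too.\<close>

lemma ex_touching_voronoi_tile:
  fixes S :: "(real ^ 'd) set"
  assumes lf: "locally_finite_set S" and P: "finite P" "P \<subseteq> S" "P \<noteq> {}"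
    and bdd: "\<And>v. v \<in> P \<Longrightarrow> bounded (voronoi_tile S v)"
  obtains v where "v \<in> S - P" "voronoi_tile S v \<inter> (\<Union>v\<in>P. voronoi_tile S v) \<noteq> {}"
proof -
  define U where "U = (\<Union>v\<in>P. voronoi_tile S v)"
  obtain s where s: "s \<in> P" using P by blast
  have "closed U" unfolding U_def using P(1) by (intro closed_UN ballI closed_voronoi_tile)
  have "bounded U" unfolding U_def using P bdd by (intro bounded_UN) auto
  then have "U \<noteq> UNIV" using not_bounded_UNIV by auto
  moreover have "U \<noteq> {}" unfolding U_def using s center_in_voronoi_tile[of s S] by blast
  ultimately have "frontier U \<noteq> {}" by (simp add: frontier_eq_empty)
  then obtain x where x: "x \<in> frontier U" by blast
  then have "x \<in> U" using \<open>closed U\<close> frontier_subset_closed by blast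
  let ?A = "S \<inter> cball x (dist x s + 2)"
  let ?W = "\<Union>v\<in>?A - P. voronoi_tile S v"
  have fin: "finite ?A" using lf by (simp add: locally_finite_set_def)
  have "closed ?W" using fin by (intro closed_UN ballI closed_voronoi_tile finite_Diff)
  have "ball x 1 \<inter> - U \<subseteq> ?W"
  proof
    fix y assume y: "y \<in> ball x 1 \<inter> - U"
    have "S \<noteq> {}" using s P by blast
    then obtain v where v: "v \<in> S" "y \<in> voronoi_tile S v" using ex_voronoi_tile[OF lf] by blast
    have "v \<notin> P" using y v by (auto simp: U_def)
    have "dist y v \<le> dist y s" using v s P by (auto simp: voronoi_tile_def)
    moreover have "dist y s \<le> dist y x + dist x s" "dist x v \<le> dist x y + dist y v"
      by (rule dist_triangle)+
    ultimately have "dist x v \<le> dist x s + 2" using y by (simp add: dist_commute)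
    then show "y \<in> ?W" using v \<open>v \<notin> P\<close> by auto
  qed
  moreover have "x \<in> closure (ball x 1 \<inter> - U)"
  proof -
    have "x \<in> closure (- U)" using x by (simp add: frontier_closures)
    then have "x \<in> ball x 1 \<inter> closure (- U)" by simp
    also have "\<dots> \<subseteq> closure (ball x 1 \<inter> - U)" by (rule open_Int_closure_subset) simp
    finally show ?thesis .
  qed
  ultimately have "x \<in> ?W" using \<open>closed ?W\<close> closure_minimal by blast
  then show thesis using that \<open>x \<in> U\<close> unfolding U_def by blast
qed

lemma ex_polyomino:
  fixes S :: "(real ^ 'd) set"
  assumes lf: "locally_finite_set S" and "S \<noteq> {}"
    and bdd: "\<And>v. v \<in> S \<Longrightarrow> bounded (voronoi_tile S v)" and "1 \<le> n"
  shows "\<exists>P. P \<in> polyominoes n S"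
  using \<open>1 \<le> n\<close>
proof (induction n rule: nat_induct_at_least)
  case base
  obtain v where "v \<in> S" "0 \<in> voronoi_tile S v" using ex_voronoi_tile[OF lf \<open>S \<noteq> {}\<close>] by blast
  then have "{v} \<in> polyominoes 1 S"
    by (simp add: polyominoes_def convex_connected convex_voronoi_tile)
  then show ?case by blast
next
  case (Suc n)
  then obtain P where P: "P \<subseteq> S" "finite P" "card P = n" "connected (\<Union>v\<in>P. voronoi_tile S v)"
    "0 \<in> (\<Union>v\<in>P. voronoi_tile S v)" by (auto simp: polyominoes_def)
  then have "P \<noteq> {}" by auto
  then obtain v where v: "v \<in> S - P" "voronoi_tile S v \<inter> (\<Union>v\<in>P. voronoi_tile S v) \<noteq> {}"
    using ex_touching_voronoi_tile[OF lf] P bdd by (metis subsetD)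
  have "connected (voronoi_tile S v \<union> (\<Union>v\<in>P. voronoi_tile S v))"
    using convex_connected[OF convex_voronoi_tile] P(4) v(2) by (rule connected_Un)
  then have "insert v P \<in> polyominoes (Suc n) S" using P v by (auto simp: polyominoes_def)
  then show ?case by blast
qed

section \<open>Boxes of the integer lattice\<close>

definition idx :: "real \<Rightarrow> real ^ 'd \<Rightarrow> 'd \<Rightarrow> int" where
  "idx s x = (\<lambda>i. \<lfloor>x $ i / s\<rfloor>)"

definition cell :: "real \<Rightarrow> ('d \<Rightarrow> int) \<Rightarrow> (real ^ 'd) set" where
  "cell s b = {x. idx s x = b}"

definition cell_count :: "real \<Rightarrow> (real ^ 'd) set \<Rightarrow> ('d \<Rightarrow> int) \<Rightarrow> nat" where
  "cell_count s S b = card (S \<inter> cell s b)"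

definition cube :: "('d \<Rightarrow> int) \<Rightarrow> nat \<Rightarrow> ('d \<Rightarrow> int) set" where
  "cube b r = {b'. \<forall>i. \<bar>b' i - b i\<bar> \<le> int r}"

text \<open>The cubes of side \<rho> of the tiling anchored at b, numbered by k. With floor
  division, the block of a given cell is found by computing k, also for negative offsets.\<close>

definition block :: "nat \<Rightarrow> ('d \<Rightarrow> int) \<Rightarrow> ('d \<Rightarrow> int) \<Rightarrow> ('d \<Rightarrow> int) set" where
  "block \<rho> b k = {b'. \<forall>i. (b' i - b i) div int \<rho> = k i}"

lemma cube_eq_PiE: "cube b r = PiE UNIV (\<lambda>i. {b i - int r..b i + int r})"
  by (auto simp: cube_def PiE_UNIV_domain Pi_iff abs_diff_le_iff)

lemma finite_cube [simp]: "finite (cube (b :: 'd::finite \<Rightarrow> int) r)"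
  unfolding cube_eq_PiE by (intro finite_PiE) auto

lemma card_cube: "card (cube (b :: 'd::finite \<Rightarrow> int) r) = (2 * r + 1) ^ CARD('d)"
  unfolding cube_eq_PiE by (subst card_PiE) (auto simp: nat_add_distrib nat_mult_distrib)

lemma cube_commute: "b' \<in> cube b r \<longleftrightarrow> b \<in> cube b' r"
  by (auto simp: cube_def abs_minus_commute)

lemma center_in_cube [simp]: "b \<in> cube b r"
  by (simp add: cube_def)

lemma cube_mono: "r \<le> r' \<Longrightarrow> cube b r \<subseteq> cube b r'"
  unfolding cube_def by (auto intro: order_trans[of _ "int r" "int r'"])

lemma block_eq_PiE:
  assumes "0 < \<rho>"
  shows "block \<rho> b k = PiE UNIV (\<lambda>i. {b i + int \<rho> * k i..<b i + int \<rho> * k i + int \<rho>})"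
proof -
  have "(b' i - b i) div int \<rho> = k i \<longleftrightarrow> b' i \<in> {b i + int \<rho> * k i..<b i + int \<rho> * k i + int \<rho>}" for b' i
  proof
    assume "(b' i - b i) div int \<rho> = k i"
    then have "int \<rho> * k i + (b' i - b i) mod int \<rho> = b' i - b i"
      by (metis mult_div_mod_eq)
    moreover have "0 \<le> (b' i - b i) mod int \<rho>" "(b' i - b i) mod int \<rho> < int \<rho>" using assms by auto
    ultimately show "b' i \<in> {b i + int \<rho> * k i..<b i + int \<rho> * k i + int \<rho>}" by simp
  next
    assume "b' i \<in> {b i + int \<rho> * k i..<b i + int \<rho> * k i + int \<rho>}"
    then show "(b' i - b i) div int \<rho> = k i"
      by (intro int_div_pos_eq[where r = "b' i - b i - int \<rho> * k i"]) auto
  qed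
  then show ?thesis by (auto simp: block_def PiE_UNIV_domain)
qed

lemma card_block: "0 < \<rho> \<Longrightarrow> card (block \<rho> b k :: ('d::finite \<Rightarrow> int) set) = \<rho> ^ CARD('d)"
  by (simp add: block_eq_PiE card_PiE)

lemma finite_block: "0 < \<rho> \<Longrightarrow> finite (block \<rho> b k :: ('d::finite \<Rightarrow> int) set)"
  by (simp add: block_eq_PiE finite_PiE)

lemma block_subset_cube:
  assumes "0 < \<rho>" "k \<in> cube (\<lambda>_. 0) r"
  shows "block \<rho> b k \<subseteq> cube b ((r + 1) * \<rho>)"
proof
  fix b' assume b': "b' \<in> block \<rho> b k"
  have "\<bar>b' i - b i\<bar> \<le> int ((r + 1) * \<rho>)" for i
  proof -
    have 1: "b i + int \<rho> * k i \<le> b' i" "b' i < b i + int \<rho> * k i + int \<rho>"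
      using b' assms by (auto simp: block_eq_PiE PiE_UNIV_domain)
    have "\<bar>k i\<bar> \<le> int r" using assms by (auto simp: cube_def)
    then have "\<bar>int \<rho> * k i\<bar> \<le> int \<rho> * int r" by (simp add: abs_mult mult_left_mono)
    then have "- (int \<rho> * int r) \<le> int \<rho> * k i" "int \<rho> * k i \<le> int \<rho> * int r" by linarith+
    moreover have "int ((r + 1) * \<rho>) = int \<rho> * int r + int \<rho>" by (simp add: algebra_simps)
    ultimately show ?thesis using 1 by linarith
  qed
  then show "b' \<in> cube b ((r + 1) * \<rho>)" by (simp add: cube_def)
qed

section \<open>Walks\<close>

text \<open>Steps go to sup-norm neighbours, and standing still is allowed because
  \<open>cube a 1\<close> contains a; sampled walks are therefore walks again.\<close>

definition walk :: "('d \<Rightarrow> int) list \<Rightarrow> bool" where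
  "walk w \<longleftrightarrow> w \<noteq> [] \<and> hd w = (\<lambda>_. 0) \<and> successively (\<lambda>a b. b \<in> cube a 1) w"

text \<open>An occurrence of a is replaced by the excursion a, b, a, whence two further entries for
  one new cell.\<close>

lemma walk_detour:
  assumes "walk w" "a \<in> set w" "b \<in> cube a 1"
  obtains w' where "walk w'" "set w' = insert b (set w)" "length w' = length w + 2"
proof -
  obtain w1 w2 where w: "w = w1 @ a # w2" using split_list[OF assms(2)] by blast
  have "a \<in> cube b 1" using assms(3) cube_commute by blast
  then have "walk (w1 @ a # b # a # w2)"
    using assms(1,3) by (auto simp: walk_def w successively_append_iff hd_append)
  moreover have "set (w1 @ a # b # a # w2) = insert b (set w)" by (auto simp: w)
  ultimately show thesis using that by (simp add: w)
qed

text \<open>The hypothesis \<open>conn\<close> expresses connectedness of F: an edge leaves every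
  proper subset that contains the origin. One detour per new cell gives the length 2m - 1. Stopping
  at a prescribed m makes sense for infinite F as well.\<close>

lemma walk_covering:
  fixes F :: "('d \<Rightarrow> int) set"
  assumes F: "(\<lambda>_. 0) \<in> F"
    and conn: "\<And>A. A \<subset> F \<Longrightarrow> (\<lambda>_. 0) \<in> A \<Longrightarrow> \<exists>a\<in>A. \<exists>b\<in>F - A. b \<in> cube a 1"
    and "1 \<le> m" "infinite F \<or> m \<le> card F"
  shows "\<exists>w. walk w \<and> set w \<subseteq> F \<and> card (set w) = m \<and> length w \<le> 2 * m - 1"
  using assms(3,4)
proof (induction m rule: nat_induct_at_least)
  case base
  show ?case using F by (intro exI[of _ "[\<lambda>_. 0]"]) (auto simp: walk_def)
next
  case (Suc n)
  then obtain w where w: "walk w" "set w \<subseteq> F" "card (set w) = n" "length w \<le> 2 * n - 1" by auto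
  have "set w \<noteq> F" using w Suc by auto
  moreover have "(\<lambda>_. 0) \<in> set w" using w(1) unfolding walk_def by (metis list.set_sel(1))
  ultimately obtain a b where ab: "a \<in> set w" "b \<in> F - set w" "b \<in> cube a 1"
    using conn[of "set w"] w(2) by blast
  obtain w' where w': "walk w'" "set w' = insert b (set w)" "length w' = length w + 2"
    using walk_detour[OF w(1) ab(1,3)] .
  show ?case using w w' ab Suc by (intro exI[of _ w']) auto
qed

lemma walk_dist:
  assumes "walk w" "i \<le> j" "j < length w"
  shows "\<bar>(w ! j) k - (w ! i) k\<bar> \<le> int (j - i)"
  using assms(2,3)
proof (induction j rule: dec_induct)
  case (step j)
  have "w ! Suc j \<in> cube (w ! j) 1"
    using assms(1) step by (auto simp: walk_def successively_conv_nth)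
  then have "\<bar>(w ! Suc j) k - (w ! j) k\<bar> \<le> 1" by (auto simp: cube_def)
  moreover have "\<bar>(w ! j) k - (w ! i) k\<bar> \<le> int (j - i)" using step by auto
  ultimately show ?case using step by linarith
qed auto

lemma walk_subset_cube:
  assumes "walk w" "length w \<le> Suc l"
  shows "set w \<subseteq> cube (\<lambda>_. 0) l"
proof
  fix b assume "b \<in> set w"
  then obtain j where j: "j < length w" "b = w ! j" by (metis in_set_conv_nth)
  have "w ! 0 = (\<lambda>_. 0)" using assms(1) by (auto simp: walk_def hd_conv_nth)
  then have "\<bar>b k\<bar> \<le> int l" for k using walk_dist[OF assms(1) le0 j(1), of k] j assms(2) by auto
  then show "b \<in> cube (\<lambda>_. 0) l" by (simp add: cube_def)
qed

section \<open>Coarse paths and the regions that they cover\<close>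

definition coarse_paths :: "nat \<Rightarrow> ('d \<Rightarrow> int) list set" where
  "coarse_paths L = {w. walk w \<and> length w = Suc L}"

lemma card_coarse_paths:
  "finite (coarse_paths L :: ('d::finite \<Rightarrow> int) list set) \<and>
   card (coarse_paths L :: ('d \<Rightarrow> int) list set) \<le> (3 ^ CARD('d)) ^ L"
proof (induction L)
  case 0
  have "(coarse_paths 0 :: ('d \<Rightarrow> int) list set) \<subseteq> {[\<lambda>_. 0]}"
    by (auto simp: coarse_paths_def walk_def length_Suc_conv)
  note sub = this
  have "finite (coarse_paths 0 :: ('d \<Rightarrow> int) list set)" by (rule finite_subset[OF sub]) simp
  moreover have "card (coarse_paths 0 :: ('d \<Rightarrow> int) list set) \<le> 1"
    using card_mono[OF _ sub] by simp
  ultimately show ?case by simp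
next
  case (Suc L)
  let ?A = "SIGMA w : coarse_paths L. cube (last w :: 'd \<Rightarrow> int) 1"
  have fin: "finite ?A" using Suc by auto
  have "(coarse_paths (Suc L) :: ('d \<Rightarrow> int) list set) \<subseteq> (\<lambda>(w, b). w @ [b]) ` ?A"
  proof
    fix w :: "('d \<Rightarrow> int) list" assume w: "w \<in> coarse_paths (Suc L)"
    then have len: "length w = Suc (Suc L)" and "walk w" by (auto simp: coarse_paths_def)
    have weq: "w = butlast w @ [last w]" using len by (cases w rule: rev_cases) auto
    have bl: "butlast w \<noteq> []" using len by (cases w rule: rev_cases) auto
    have "walk (butlast w @ [last w])" using \<open>walk w\<close> unfolding weq[symmetric] .
    then have "walk (butlast w)" "last w \<in> cube (last (butlast w)) 1"
      using bl by (auto simp: walk_def successively_append_iff)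
    then have "(butlast w, last w) \<in> ?A" using len by (auto simp: coarse_paths_def)
    then show "w \<in> (\<lambda>(w, b). w @ [b]) ` ?A"
      by (intro image_eqI[of _ _ "(butlast w, last w)"]) (simp_all add: weq[symmetric])
  qed
  note sub = this
  have "card (coarse_paths (Suc L) :: ('d \<Rightarrow> int) list set) \<le> card ((\<lambda>(w, b). w @ [b]) ` ?A)"
    using fin sub by (intro card_mono) auto
  also have "\<dots> \<le> card ?A" using fin by (rule card_image_le)
  also have "\<dots> = card (coarse_paths L :: ('d \<Rightarrow> int) list set) * 3 ^ CARD('d)"
    using Suc by (subst card_SigmaI) (auto simp: card_cube numeral_eq_Suc)
  also have "\<dots> \<le> (3 ^ CARD('d)) ^ L * 3 ^ CARD('d)" using Suc by (intro mult_right_mono) auto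
  finally show ?case using finite_subset[OF sub finite_imageI[OF fin]] by (simp add: mult.commute)
qed

text \<open>The radius 2r allows r for the steps made since the last sampled position and r for
  rounding that position to the lattice of spacing r.\<close>

definition coarse_region :: "nat \<Rightarrow> ('d \<Rightarrow> int) list \<Rightarrow> ('d \<Rightarrow> int) set" where
  "coarse_region r us = (\<Union>u\<in>set us. cube (\<lambda>i. int r * u i) (2 * r))"

lemma finite_coarse_region [simp]: "finite (coarse_region r (us :: ('d::finite \<Rightarrow> int) list))"
  by (simp add: coarse_region_def)

lemma card_coarse_region:
  fixes us :: "('d::finite \<Rightarrow> int) list"
  assumes "us \<in> coarse_paths L" "1 \<le> r"
  shows "card (coarse_region r us) \<le> Suc L * (5 * r) ^ CARD('d)"
proof -
  have "card (coarse_region r us) \<le> (\<Sum>u\<in>set us. card (cube (\<lambda>i. int r * u i) (2 * r)))"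
    unfolding coarse_region_def by (intro card_UN_le) auto
  also have "\<dots> = card (set us) * (4 * r + 1) ^ CARD('d)" by (simp add: card_cube)
  also have "\<dots> \<le> Suc L * (5 * r) ^ CARD('d)"
    using assms card_length[of us] by (intro mult_mono power_mono) (auto simp: coarse_paths_def)
  finally show ?thesis .
qed

text \<open>Sampling a walk every \<open>r\<close> steps gives a path on the lattice of spacing \<open>r\<close>.\<close>
lemma walk_coarsening:
  assumes w: "walk w" and len: "length w \<le> Suc l" and r: "1 \<le> r"
  obtains us where "us \<in> coarse_paths (l div r)" "set w \<subseteq> coarse_region r us"
proof -
  define n where "n = length w - 1"
  have n: "length w = Suc n" "n \<le> l" using w len by (auto simp: n_def walk_def)
  \<comment> \<open>Sampling times are capped at the last index n, so that a short walk also yields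
    a path with exactly \<open>l div r\<close> steps.\<close>
  define t where "t i = min (i * r) n" for i
  define u where "u i = (\<lambda>k. (w ! t i) k div int r)" for i
  define us where "us = map u [0..<Suc (l div r)]"
  have w0: "w ! 0 = (\<lambda>_. 0)" using w by (auto simp: walk_def hd_conv_nth)
  have t: "t i < length w" for i by (auto simp: t_def n)
  have adj: "u (Suc i) \<in> cube (u i) 1" for i
  proof -
    have "t i \<le> t (Suc i)" "t (Suc i) - t i \<le> r" by (auto simp: t_def)
    then have *: "\<bar>(w ! t (Suc i)) k - (w ! t i) k\<bar> \<le> int r" for k
      using walk_dist[OF w \<open>t i \<le> t (Suc i)\<close> t, of k] by linarith
    have "\<bar>x div int r - y div int r\<bar> \<le> 1" if "\<bar>x - y\<bar> \<le> int r" for x y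
    proof -
      have "x div int r \<le> (y + int r) div int r" "y div int r \<le> (x + int r) div int r"
        by (rule zdiv_mono1; use that r in linarith)+
      then show ?thesis using r by simp
    qed
    then show ?thesis using * by (auto simp: cube_def u_def)
  qed
  have "walk us"
  proof -
    have "hd us = u 0" by (simp add: us_def upt_conv_Cons del: upt_Suc)
    also have "u 0 = (\<lambda>_. 0)" by (simp add: u_def t_def w0)
    finally show ?thesis using adj
      by (auto simp: walk_def us_def successively_conv_nth simp del: upt_Suc)
  qed
  then have "us \<in> coarse_paths (l div r)" by (simp add: coarse_paths_def us_def)
  moreover have "set w \<subseteq> coarse_region r us"
  proof
    fix b assume "b \<in> set w"
    then obtain j where j: "j < length w" "b = w ! j" by (metis in_set_conv_nth)
    let ?i = "j div r"
    have "?i \<le> l div r" using j n by (intro div_le_mono) auto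
    then have mem: "u ?i \<in> set us" by (auto simp: us_def simp del: upt_Suc)
    have "?i * r \<le> j" by (simp add: div_times_less_eq_dividend)
    then have ti: "t ?i = ?i * r" unfolding t_def using j n by (intro min_absorb1) linarith
    have "j - ?i * r = j mod r" by (simp add: minus_div_mult_eq_mod)
    then have "j - ?i * r < r" using r by simp
    have "b \<in> cube (\<lambda>k. int r * u ?i k) (2 * r)"
      unfolding cube_def
    proof (intro CollectI allI)
      fix k
      have 1: "\<bar>b k - (w ! t ?i) k\<bar> \<le> int r"
      proof -
        have "\<bar>b k - (w ! t ?i) k\<bar> \<le> int (j - ?i * r)"
          using walk_dist[OF w, of "t ?i" j k] ti \<open>?i * r \<le> j\<close> j by simp
        also have "\<dots> \<le> int r" using \<open>j - ?i * r < r\<close> by linarith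
        finally show ?thesis .
      qed
      have "(w ! t ?i) k = int r * u ?i k + (w ! t ?i) k mod int r" by (simp add: u_def)
      moreover have "0 \<le> (w ! t ?i) k mod int r" "(w ! t ?i) k mod int r < int r" using r by auto
      ultimately show "\<bar>b k - int r * u ?i k\<bar> \<le> int (2 * r)" using 1 by linarith
    qed
    then show "b \<in> coarse_region r us" using mem by (auto simp: coarse_region_def)
  qed
  ultimately show thesis by (rule that)
qed

section \<open>Cells and tiles\<close>

lemma idx_diff_le:
  assumes "1 \<le> s" "\<bar>x $ i - y $ i\<bar> \<le> real n * s"
  shows "\<bar>idx s x i - idx s y i\<bar> \<le> int n"
proof -
  have "\<bar>x $ i / s - y $ i / s\<bar> = \<bar>x $ i - y $ i\<bar> / s"
    using assms by (simp flip: diff_divide_distrib)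
  then have *: "\<bar>x $ i / s - y $ i / s\<bar> \<le> real n" using assms by (simp add: field_simps)
  then have "x $ i / s \<le> y $ i / s + real n" "y $ i / s \<le> x $ i / s + real n" by linarith+
  then have "\<lfloor>x $ i / s\<rfloor> \<le> \<lfloor>y $ i / s + of_int (int n)\<rfloor>" "\<lfloor>y $ i / s\<rfloor> \<le> \<lfloor>x $ i / s + of_int (int n)\<rfloor>"
    by (simp_all only: floor_mono of_int_of_nat_eq)
  then show ?thesis by (simp add: idx_def)
qed

lemma idx_in_cube:
  assumes "1 \<le> s" "dist x y \<le> real n * s"
  shows "idx s x \<in> cube (idx s y) n"
proof -
  have "\<bar>x $ i - y $ i\<bar> \<le> real n * s" for i
    using component_le_norm_cart[of "x - y" i] assms(2) by (simp add: dist_norm)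
  then show ?thesis unfolding cube_def by (intro CollectI allI idx_diff_le assms(1))
qed

text \<open>Cells are half-open, so coordinates differ by less than \<rho> * s; the factor
  \<open>CARD('d)\<close> comes from the l1 norm. Strictness is what later removes the points of a
  sphere from a tile.\<close>

lemma dist_less_of_block:
  fixes x y :: "real ^ 'd"
  assumes "1 \<le> s" "0 < \<rho>" "idx s x \<in> block \<rho> b k" "idx s y \<in> block \<rho> b k"
  shows "dist x y < real CARD('d) * real \<rho> * s"
proof -
  have *: "\<bar>x $ i - y $ i\<bar> < real \<rho> * s" for i
  proof -
    define c where "c = b i + int \<rho> * k i"
    have c: "c \<le> idx s x i" "idx s x i < c + int \<rho>" "c \<le> idx s y i" "idx s y i < c + int \<rho>"
      using assms by (auto simp: block_eq_PiE PiE_UNIV_domain c_def)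
    then have "real_of_int c \<le> x $ i / s" "x $ i / s < real_of_int (c + int \<rho>)"
      "real_of_int c \<le> y $ i / s" "y $ i / s < real_of_int (c + int \<rho>)"
      by (auto simp: idx_def le_floor_iff floor_less_iff)
    then have "\<bar>x $ i / s - y $ i / s\<bar> < real \<rho>" by simp
    moreover have "\<bar>x $ i / s - y $ i / s\<bar> = \<bar>x $ i - y $ i\<bar> / s"
      using assms by (simp flip: diff_divide_distrib)
    ultimately show ?thesis using assms by (simp add: field_simps)
  qed
  have "dist x y \<le> (\<Sum>i\<in>UNIV. \<bar>(x - y) $ i\<bar>)" unfolding dist_norm by (rule norm_le_l1_cart)
  also have "\<dots> < (\<Sum>i\<in>(UNIV :: 'd set). real \<rho> * s)" using * by (intro sum_strict_mono) auto
  finally show ?thesis by (simp add: mult.assoc)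
qed

lemma bounded_cell:
  fixes b :: "'d::finite \<Rightarrow> int"
  assumes "1 \<le> s"
  shows "bounded (cell s b)"
proof (cases "cell s b = {}")
  case False
  then obtain x where x: "x \<in> cell s b" by blast
  have "dist x y < real CARD('d) * real 1 * s" if "y \<in> cell s b" for y
    using assms x that by (intro dist_less_of_block[where b = b and k = "\<lambda>_. 0"]) (auto simp: block_def cell_def)
  then show ?thesis unfolding bounded_def by (meson less_imp_le)
qed simp

lemma cell_count_pos_iff:
  assumes "locally_finite_set S" "1 \<le> s"
  shows "cell_count s S b = 0 \<longleftrightarrow> S \<inter> cell s b = {}"
  using assms bounded_cell[OF assms(2), of b] by (simp add: cell_count_def locally_finite_set_def)

text \<open>Points at distance less than 1 <= s have adjacent indices. If no edge left A, membership
  of the index in A would be locally constant on the connected set U.\<close>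

lemma idx_connected:
  fixes U :: "(real ^ 'd) set"
  assumes s: "1 \<le> s" and U: "connected U" and A: "A \<subset> idx s ` U" "A \<noteq> {}"
  shows "\<exists>a\<in>A. \<exists>b\<in>idx s ` U - A. b \<in> cube a 1"
proof (rule ccontr)
  assume neg: "\<not> ?thesis"
  obtain x y where xy: "x \<in> U" "idx s x \<in> A" "y \<in> U" "idx s y \<notin> A" using A by blast
  have "(idx s x \<in> A) = (idx s y \<in> A)"
  proof (rule connected_equivalence_relation[OF U, where R = "\<lambda>x y. (idx s x \<in> A) = (idx s y \<in> A)"])
    fix a assume a: "a \<in> U"
    have "(idx s a \<in> A) = (idx s z \<in> A)" if "z \<in> U \<inter> ball a 1" for z
    proof -
      have "dist a z \<le> real 1 * s" using that s by auto
      then have "idx s z \<in> cube (idx s a) 1" "idx s a \<in> cube (idx s z) 1"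
        using idx_in_cube[OF s, of z a 1] idx_in_cube[OF s, of a z 1] by (auto simp: dist_commute)
      then show ?thesis using neg that a by blast
    qed
    then show "\<exists>T. openin (top_of_set U) T \<and> a \<in> T \<and> (\<forall>x\<in>T. (idx s a \<in> A) = (idx s x \<in> A))"
      using a by (intro exI[of _ "U \<inter> ball a 1"]) (auto intro: openin_open_Int)
  qed (use xy in auto)
  then show False using xy by simp
qed

text \<open>With d = \<open>CARD('d)\<close> and R = d * \<rho> * s, the sphere of radius R about a
  point of cell b only meets blocks with offsets at most d. The ball of radius 2R + 1, which
  contains every site that can contribute a face, only meets cells within (2d + 2) * \<rho> of
  b.\<close>

definition bad_site :: "nat \<Rightarrow> nat \<Rightarrow> (('d \<Rightarrow> int) \<Rightarrow> nat) \<Rightarrow> ('d \<Rightarrow> int) \<Rightarrow> bool" where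
  "bad_site \<kappa> \<rho> X b \<longleftrightarrow>
     (\<exists>k\<in>cube (\<lambda>_. 0) (CARD('d) + 1). \<forall>b'\<in>block \<rho> b k. X b' = 0) \<or>
     \<kappa> * \<rho> ^ CARD('d) \<le> (\<Sum>b'\<in>cube b ((2 * CARD('d) + 2) * \<rho>). X b')"

text \<open>Each x on the sphere shares a block with some site, and blocks have diameter less than
  the radius, so this site is closer to x than v is.\<close>

lemma not_bad_site_tile_subset:
  fixes S :: "(real ^ 'd) set"
  assumes lf: "locally_finite_set S" and s: "1 \<le> s" and \<rho>: "1 \<le> \<rho>"
    and nb: "\<not> bad_site \<kappa> \<rho> (cell_count s S) (idx s v)"
  shows "voronoi_tile S v \<subseteq> ball v (real CARD('d) * real \<rho> * s)" (is "_ \<subseteq> ball v ?R")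
proof (rule voronoi_tile_subset_ball)
  show "0 < ?R" using s \<rho> by simp
  fix x assume x: "dist x v = ?R"
  define k where "k = (\<lambda>i. (idx s x i - idx s v i) div int \<rho>)"
  have "idx s x \<in> cube (idx s v) (CARD('d) * \<rho>)" using x by (intro idx_in_cube s) simp
  then have le: "\<bar>idx s x i - idx s v i\<bar> \<le> int CARD('d) * int \<rho>" for i by (simp add: cube_def)
  have "\<bar>k i\<bar> \<le> int (CARD('d) + 1)" for i
  proof -
    have "(- int CARD('d) * int \<rho>) div int \<rho> \<le> k i" "k i \<le> (int CARD('d) * int \<rho>) div int \<rho>"
      unfolding k_def by (rule zdiv_mono1; use le[of i] \<rho> in linarith)+
    moreover have "(- int CARD('d) * int \<rho>) div int \<rho> = - int CARD('d)"
      using \<rho> by (intro nonzero_mult_div_cancel_right) simp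
    moreover have "(int CARD('d) * int \<rho>) div int \<rho> = int CARD('d)"
      using \<rho> by (intro nonzero_mult_div_cancel_right) simp
    ultimately show ?thesis by (simp add: abs_le_iff)
  qed
  then have "k \<in> cube (\<lambda>_. 0) (CARD('d) + 1)" by (simp add: cube_def)
  then obtain b' where b': "b' \<in> block \<rho> (idx s v) k" "cell_count s S b' \<noteq> 0"
    using nb by (auto simp: bad_site_def)
  then obtain v' where v': "v' \<in> S" "idx s v' = b'"
    using cell_count_pos_iff[OF lf s, of b'] by (auto simp: cell_def)
  have "idx s x \<in> block \<rho> (idx s v) k" by (simp add: block_def k_def)
  then have "dist x v' < ?R" using v' b' s \<rho> by (intro dist_less_of_block) auto
  then show "\<exists>v'\<in>S. dist x v' < ?R" using v' by blast
qed

lemma not_bad_site_degree: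
  fixes S :: "(real ^ 'd) set"
  assumes lf: "locally_finite_set S" and s: "1 \<le> s" and \<rho>: "1 \<le> \<rho>" and v: "v \<in> S"
    and d: "2 \<le> CARD('d)"
    and nb: "\<not> bad_site \<kappa> \<rho> (cell_count s S) (idx s v)"
  shows "3 \<le> voronoi_degree S v" "voronoi_degree S v \<le> \<kappa> * \<rho> ^ CARD('d)"
proof -
  let ?R = "real CARD('d) * real \<rho> * s"
  have R: "0 < ?R" using s \<rho> by simp
  note bounds = voronoi_degree_bounds[OF lf R not_bad_site_tile_subset[OF lf s \<rho> nb] d]
  show "3 \<le> voronoi_degree S v" by (rule bounds(1))
  let ?C = "cube (idx s v) ((2 * CARD('d) + 2) * \<rho>)"
  have "S \<inter> cball v (2 * ?R + 1) \<subseteq> (\<Union>b'\<in>?C. S \<inter> cell s b')"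
  proof
    fix x assume x: "x \<in> S \<inter> cball v (2 * ?R + 1)"
    have "2 * ?R + 1 \<le> 2 * ?R + real \<rho> * s" using mult_mono[of 1 "real \<rho>" 1 s] s \<rho> by simp
    also have "\<dots> \<le> real ((2 * CARD('d) + 2) * \<rho>) * s" using s \<rho> by (simp add: algebra_simps)
    finally have "idx s x \<in> ?C" using x by (intro idx_in_cube s) (auto simp: dist_commute)
    then show "x \<in> (\<Union>b'\<in>?C. S \<inter> cell s b')" using x by (auto simp: cell_def)
  qed
  moreover have "finite (S \<inter> cell s b')" for b' :: "'d \<Rightarrow> int"
    using lf bounded_cell[OF s, of b'] by (simp add: locally_finite_set_def)
  then have "finite (\<Union>b'\<in>?C. S \<inter> cell s b')" by (intro finite_UN_I finite_cube)
  ultimately have "card (S \<inter> cball v (2 * ?R + 1)) \<le> card (\<Union>b'\<in>?C. S \<inter> cell s b')"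
    by (rule card_mono[rotated])
  also have "\<dots> \<le> (\<Sum>b'\<in>?C. cell_count s S b')" unfolding cell_count_def by (intro card_UN_le) auto
  also have "\<dots> \<le> \<kappa> * \<rho> ^ CARD('d)" using nb by (auto simp: bad_site_def)
  finally show "voronoi_degree S v \<le> \<kappa> * \<rho> ^ CARD('d)" using bounds(2) by simp
qed

text \<open>A point of a nonempty cell is within the diameter of the cell from the centre of any tile
  that contains it.\<close>
lemma card_nonempty_cells:
  fixes S :: "(real ^ 'd) set"
  assumes lf: "locally_finite_set S" and s: "1 \<le> s" and P: "finite P"
    and A: "A \<subseteq> idx s ` (\<Union>v\<in>P. voronoi_tile S v)"
  shows "card {b \<in> A. cell_count s S b \<noteq> 0} \<le> card P * (2 * CARD('d) + 1) ^ CARD('d)"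
proof -
  have "{b \<in> A. cell_count s S b \<noteq> 0} \<subseteq> (\<Union>v\<in>P. cube (idx s v) CARD('d))"
  proof
    fix b assume b: "b \<in> {b \<in> A. cell_count s S b \<noteq> 0}"
    then obtain x v where xv: "b = idx s x" "v \<in> P" "x \<in> voronoi_tile S v" using A by blast
    obtain v' where v': "v' \<in> S" "idx s v' = b"
      using b cell_count_pos_iff[OF lf s, of b] by (auto simp: cell_def)
    have "dist x v \<le> dist x v'" using xv v' by (auto simp: voronoi_tile_def)
    also have "\<dots> < real CARD('d) * real 1 * s"
      using s v' xv by (intro dist_less_of_block[where b = b and k = "\<lambda>_. 0"]) (auto simp: block_def)
    finally have "b \<in> cube (idx s v) CARD('d)" unfolding xv by (intro idx_in_cube s) simp
    then show "b \<in> (\<Union>v\<in>P. cube (idx s v) CARD('d))" using xv by blast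
  qed
  then have "card {b \<in> A. cell_count s S b \<noteq> 0} \<le> card (\<Union>v\<in>P. cube (idx s v) CARD('d))"
    using P by (intro card_mono) auto
  also have "\<dots> \<le> (\<Sum>v\<in>P. card (cube (idx s v) CARD('d)))" by (rule card_UN_le[OF P])
  finally show ?thesis by (simp add: card_cube)
qed

section \<open>Independent cell counts\<close>

definition local_on :: "'i set \<Rightarrow> (('i \<Rightarrow> nat) \<Rightarrow> 'b) \<Rightarrow> bool" where
  "local_on K h \<longleftrightarrow> (\<forall>x x'. (\<forall>i\<in>K. x i = x' i) \<longrightarrow> h x = h x')"

lemma local_on_restrict: "local_on K h \<Longrightarrow> h (restrict x K) = h x"
  by (auto simp: local_on_def)

lemma local_on_compose: "local_on K h \<Longrightarrow> local_on K (\<lambda>x. \<phi> (h x))"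
  unfolding local_on_def by metis

text \<open>The properties of Poisson cell counts on which the estimates along walks rest. The lower
  bound on \<tau> lets the rarity of empty cells beat the entropy of walks in
  \<open>void_tail\<close>, with exp(- m) to spare.\<close>

locale site_process = prob_space M for M :: "'w measure" +
  fixes X :: "('d::finite \<Rightarrow> int) \<Rightarrow> 'w \<Rightarrow> nat" and \<tau> \<Lambda> :: real
  assumes indep_X: "\<And>B. finite B \<Longrightarrow> indep_vars (\<lambda>_. count_space UNIV) X B"
    and void_le: "\<And>b. prob {\<omega> \<in> space M. X b \<omega> = 0} \<le> exp (- \<tau>)"
    and exp_moment_le: "\<And>b. (\<integral>\<^sup>+ \<omega>. ennreal (exp (real (X b \<omega>))) \<partial>M) \<le> ennreal (exp \<Lambda>)"
    and \<tau>_ge: "2 * (2 * real CARD('d) * ln 3 + 2 * 5 ^ CARD('d) + 1) \<le> \<tau>"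
    and \<Lambda>_nonneg: "0 \<le> \<Lambda>"
begin

lemma \<tau>_ge_1: "1 \<le> \<tau>"
proof -
  define A where "A = 2 * real CARD('d) * ln 3 + 2 * 5 ^ CARD('d)"
  have "0 \<le> A" by (simp add: A_def)
  moreover have "2 * (A + 1) \<le> \<tau>" using \<tau>_ge by (simp only: A_def)
  ultimately show ?thesis by simp
qed

lemma measurable_X [measurable]: "X b \<in> measurable M (count_space UNIV)"
  using indep_X[of "{b}"] by (simp add: indep_vars_def)

lemma measurable_local:
  assumes "finite K" "local_on K h" "range h \<subseteq> space N"
  shows "(\<lambda>\<omega>. h (\<lambda>b. X b \<omega>)) \<in> measurable M N"
proof -
  have "(\<lambda>\<omega>. \<lambda>b\<in>K. X b \<omega>) \<in> measurable M (PiM K (\<lambda>_. count_space UNIV))" by measurable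
  moreover have "h \<in> measurable (PiM K (\<lambda>_. count_space UNIV)) N"
    using assms by (subst count_space_PiM_finite) auto
  ultimately have "(\<lambda>\<omega>. h (\<lambda>b\<in>K. X b \<omega>)) \<in> measurable M N" by (rule measurable_compose)
  then show ?thesis by (simp add: local_on_restrict[OF assms(2)])
qed

lemma nn_integral_prod_local:
  assumes C: "finite C" and K: "\<And>b. b \<in> C \<Longrightarrow> finite (K b)" "disjoint_family_on K C"
    and h: "\<And>b. b \<in> C \<Longrightarrow> local_on (K b) (h b)"
  shows "(\<integral>\<^sup>+ \<omega>. (\<Prod>b\<in>C. h b (\<lambda>b'. X b' \<omega>)) \<partial>M) = (\<Prod>b\<in>C. \<integral>\<^sup>+ \<omega>. h b (\<lambda>b'. X b' \<omega>) \<partial>M)"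
proof (rule indep_vars_nn_integral[OF C])
  have "indep_vars (\<lambda>b. PiM (K b) (\<lambda>_. count_space UNIV)) (\<lambda>b \<omega>. restrict (\<lambda>i. X i \<omega>) (K b)) C"
    by (rule indep_vars_restrict[OF indep_X[of "\<Union>b\<in>C. K b"]]) (use C K in auto)
  then have "indep_vars (\<lambda>_. borel) (\<lambda>b \<omega>. h b (restrict (\<lambda>i. X i \<omega>) (K b))) C"
    by (rule indep_vars_compose2) (subst count_space_PiM_finite, use K in auto)
  then show "indep_vars (\<lambda>_. borel) (\<lambda>b \<omega>. h b (\<lambda>b'. X b' \<omega>)) C"
    by (rule indep_vars_cong[THEN iffD1, rotated -1]) (auto simp: local_on_restrict[OF h])
qed simp

lemma prob_block_void:
  assumes "finite B"
  shows "prob {\<omega> \<in> space M. \<forall>b\<in>B. X b \<omega> = 0} \<le> exp (- \<tau> * real (card B))"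
proof -
  let ?h = "\<lambda>b x. indicator {0} (x b) :: ennreal"
  have E: "{\<omega> \<in> space M. \<forall>b\<in>B. X b \<omega> = 0} \<in> sets M" using assms by measurable
  have "ennreal (prob {\<omega> \<in> space M. \<forall>b\<in>B. X b \<omega> = 0})
      = (\<integral>\<^sup>+ \<omega>. indicator {\<omega> \<in> space M. \<forall>b\<in>B. X b \<omega> = 0} \<omega> \<partial>M)"
    using E by (simp add: emeasure_eq_measure)
  also have "\<dots> = (\<integral>\<^sup>+ \<omega>. (\<Prod>b\<in>B. ?h b (\<lambda>b'. X b' \<omega>)) \<partial>M)"
  proof (rule nn_integral_cong)
    fix \<omega> assume "\<omega> \<in> space M"
    show "indicator {\<omega> \<in> space M. \<forall>b\<in>B. X b \<omega> = 0} \<omega> = (\<Prod>b\<in>B. ?h b (\<lambda>b'. X b' \<omega>))"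
    proof (cases "\<forall>b\<in>B. X b \<omega> = 0")
      case False
      then obtain b where "b \<in> B" "X b \<omega> \<noteq> 0" by blast
      then have "(\<Prod>b\<in>B. ?h b (\<lambda>b'. X b' \<omega>)) = 0"
        using assms by (intro prod_zero bexI[of _ b]) auto
      then show ?thesis using False by auto
    qed (use \<open>\<omega> \<in> space M\<close> in auto)
  qed
  also have "\<dots> = (\<Prod>b\<in>B. \<integral>\<^sup>+ \<omega>. ?h b (\<lambda>b'. X b' \<omega>) \<partial>M)"
    by (rule nn_integral_prod_local[where K = "\<lambda>b. {b}"])
      (use assms in \<open>auto simp: disjoint_family_on_def local_on_def\<close>)
  also have "\<dots> \<le> (\<Prod>b\<in>B. ennreal (exp (- \<tau>)))"
  proof (rule prod_mono_ennreal)
    fix b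
    have "(\<integral>\<^sup>+ \<omega>. indicator {0} (X b \<omega>) \<partial>M) = (\<integral>\<^sup>+ \<omega>. indicator {\<omega> \<in> space M. X b \<omega> = 0} \<omega> \<partial>M)"
      by (intro nn_integral_cong) (auto simp: indicator_def)
    also have "\<dots> = ennreal (prob {\<omega> \<in> space M. X b \<omega> = 0})"
      by (subst nn_integral_indicator) (auto simp: emeasure_eq_measure)
    also have "\<dots> \<le> ennreal (exp (- \<tau>))" by (intro ennreal_leI void_le)
    finally show "(\<integral>\<^sup>+ \<omega>. ?h b (\<lambda>b'. X b' \<omega>) \<partial>M) \<le> ennreal (exp (- \<tau>))" .
  qed
  also have "\<dots> = ennreal (exp (- \<tau> * real (card B)))"
    by (simp add: ennreal_power mult.commute flip: exp_of_nat_mult)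
  finally show ?thesis by simp
qed

lemma nn_integral_exp_sum_X:
  assumes "finite B"
  shows "(\<integral>\<^sup>+ \<omega>. ennreal (exp (\<Sum>b\<in>B. real (X b \<omega>))) \<partial>M) \<le> ennreal (exp (\<Lambda> * real (card B)))"
proof -
  let ?h = "\<lambda>b x. ennreal (exp (real (x b)))"
  have "(\<integral>\<^sup>+ \<omega>. ennreal (exp (\<Sum>b\<in>B. real (X b \<omega>))) \<partial>M) = (\<integral>\<^sup>+ \<omega>. (\<Prod>b\<in>B. ?h b (\<lambda>b'. X b' \<omega>)) \<partial>M)"
    using assms by (simp add: exp_sum prod_ennreal)
  also have "\<dots> = (\<Prod>b\<in>B. \<integral>\<^sup>+ \<omega>. ?h b (\<lambda>b'. X b' \<omega>) \<partial>M)"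
    by (rule nn_integral_prod_local[where K = "\<lambda>b. {b}"])
      (use assms in \<open>auto simp: disjoint_family_on_def local_on_def\<close>)
  also have "\<dots> \<le> (\<Prod>b\<in>B. ennreal (exp \<Lambda>))"
    by (intro prod_mono_ennreal exp_moment_le)
  also have "\<dots> = ennreal (exp (\<Lambda> * real (card B)))"
    by (simp add: ennreal_power mult.commute flip: exp_of_nat_mult)
  finally show ?thesis .
qed

text \<open>Splitting \<open>B\<close> into residue classes modulo \<open>2 * R + 1\<close> makes the terms of each class
  independent; convexity of the exponential recombines the classes.\<close>
lemma nn_integral_exp_sum_local:
  fixes g :: "('d \<Rightarrow> int) \<Rightarrow> (('d \<Rightarrow> int) \<Rightarrow> nat) \<Rightarrow> real" and R :: nat
  defines "q \<equiv> real ((2 * R + 1) ^ CARD('d))"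
  assumes g: "\<And>b. local_on (cube b R) (g b)"
    and moment: "\<And>b. (\<integral>\<^sup>+ \<omega>. ennreal (exp (q * s * g b (\<lambda>b'. X b' \<omega>))) \<partial>M) \<le> ennreal (exp \<epsilon>)"
    and "0 \<le> \<epsilon>" and B: "finite B"
  shows "(\<integral>\<^sup>+ \<omega>. ennreal (exp (s * (\<Sum>b\<in>B. g b (\<lambda>b'. X b' \<omega>)))) \<partial>M) \<le> ennreal (exp (\<epsilon> * real (card B)))"
proof -
  define h where "h = int (2 * R + 1)"
  define Cl where "Cl = PiE (UNIV :: 'd set) (\<lambda>_. {0..<h})"
  define res where "res b = (\<lambda>i. b i mod h)" for b :: "'d \<Rightarrow> int"
  define Bc where "Bc c = {b \<in> B. res b = c}" for c
  have h: "0 < h" by (simp add: h_def)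
  have fin: "finite Cl" unfolding Cl_def by (intro finite_PiE) auto
  have "card Cl = nat h ^ CARD('d)" unfolding Cl_def by (subst card_PiE) auto
  then have q: "q = real (card Cl)" unfolding q_def h_def by (simp only: nat_int)
  have ne: "Cl \<noteq> {}" using h by (auto simp: Cl_def PiE_eq_empty_iff)
  have q0: "0 < q" using q fin ne by (simp add: card_gt_0_iff)
  have res: "res ` B \<subseteq> Cl" using h by (auto simp: Cl_def res_def PiE_UNIV_domain)
  have finBc: "finite (Bc c)" for c using B by (simp add: Bc_def)
  let ?S = "\<lambda>c \<omega>. \<Sum>b\<in>Bc c. g b (\<lambda>b'. X b' \<omega>)"
  have pointwise: "exp (s * (\<Sum>b\<in>B. g b (\<lambda>b'. X b' \<omega>))) \<le> (\<Sum>c\<in>Cl. 1 / q * exp (q * s * ?S c \<omega>))" for \<omega>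
  proof -
    have "(\<Sum>b\<in>B. g b (\<lambda>b'. X b' \<omega>)) = (\<Sum>c\<in>Cl. ?S c \<omega>)"
      unfolding Bc_def by (rule sum.group[OF B fin res, symmetric])
    then have "s * (\<Sum>b\<in>B. g b (\<lambda>b'. X b' \<omega>)) = (\<Sum>c\<in>Cl. (1 / q) *\<^sub>R (q * s * ?S c \<omega>))"
      using q0 by (simp add: sum_distrib_left)
    also have "exp \<dots> \<le> (\<Sum>c\<in>Cl. 1 / q * exp (q * s * ?S c \<omega>))"
      using q q0 by (intro convex_on_sum[OF fin ne exp_convex, of "\<lambda>_. 1 / q"]) auto
    finally show ?thesis .
  qed
  have int_class: "(\<integral>\<^sup>+ \<omega>. ennreal (exp (q * s * ?S c \<omega>)) \<partial>M) \<le> ennreal (exp (\<epsilon> * real (card B)))" for c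
  proof -
    let ?h = "\<lambda>b x. ennreal (exp (q * s * g b x))"
    have "(\<integral>\<^sup>+ \<omega>. ennreal (exp (q * s * ?S c \<omega>)) \<partial>M) = (\<integral>\<^sup>+ \<omega>. (\<Prod>b\<in>Bc c. ?h b (\<lambda>b'. X b' \<omega>)) \<partial>M)"
      using finBc by (simp add: exp_sum prod_ennreal sum_distrib_left)
    also have "\<dots> = (\<Prod>b\<in>Bc c. \<integral>\<^sup>+ \<omega>. ?h b (\<lambda>b'. X b' \<omega>) \<partial>M)"
    proof (rule nn_integral_prod_local[where K = "\<lambda>b. cube b R"])
      show "local_on (cube b R) (?h b)" for b by (rule local_on_compose[OF g])
      show "disjoint_family_on (\<lambda>b. cube b R) (Bc c)"
        unfolding disjoint_family_on_def
      proof (intro ballI impI)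
        fix b b' assume b: "b \<in> Bc c" "b' \<in> Bc c" "b \<noteq> b'"
        then obtain i where i: "b i \<noteq> b' i" by blast
        have "b i mod h = b' i mod h" using b by (auto simp: Bc_def res_def fun_eq_iff)
        then have "h dvd b i - b' i" by (simp add: mod_eq_dvd_iff)
        then have "h \<le> \<bar>b i - b' i\<bar>" using i by (intro zdvd_imp_le) auto
        then have far: "2 * int R < \<bar>b i - b' i\<bar>" by (simp add: h_def)
        show "cube b R \<inter> cube b' R = {}"
        proof (rule ccontr)
          assume "cube b R \<inter> cube b' R \<noteq> {}"
          then obtain a where "\<bar>a i - b i\<bar> \<le> int R" "\<bar>a i - b' i\<bar> \<le> int R" by (auto simp: cube_def)
          then show False using far by linarith
        qed
      qed
    qed (use finBc in auto)
    also have "\<dots> \<le> (\<Prod>b\<in>Bc c. ennreal (exp \<epsilon>))" by (intro prod_mono_ennreal moment)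
    also have "\<dots> = ennreal (exp (\<epsilon> * real (card (Bc c))))"
      by (simp add: ennreal_power mult.commute flip: exp_of_nat_mult)
    also have "\<dots> \<le> ennreal (exp (\<epsilon> * real (card B)))"
      using \<open>0 \<le> \<epsilon>\<close> B by (intro ennreal_leI) (auto simp: Bc_def intro!: mult_left_mono card_mono)
    finally show ?thesis .
  qed
  have meas: "(\<lambda>\<omega>. exp (q * s * ?S c \<omega>)) \<in> borel_measurable M" for c
  proof -
    have "(\<lambda>\<omega>. g b (\<lambda>b'. X b' \<omega>)) \<in> borel_measurable M" for b
      by (rule measurable_local[OF _ g]) auto
    then show ?thesis by measurable
  qed
  have "(\<integral>\<^sup>+ \<omega>. ennreal (exp (s * (\<Sum>b\<in>B. g b (\<lambda>b'. X b' \<omega>)))) \<partial>M)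
      \<le> (\<integral>\<^sup>+ \<omega>. (\<Sum>c\<in>Cl. ennreal (1 / q) * ennreal (exp (q * s * ?S c \<omega>))) \<partial>M)"
    using pointwise q0
    by (intro nn_integral_mono) (simp add: sum_ennreal ennreal_leI flip: ennreal_mult)
  also have "\<dots> = (\<Sum>c\<in>Cl. ennreal (1 / q) * (\<integral>\<^sup>+ \<omega>. ennreal (exp (q * s * ?S c \<omega>)) \<partial>M))"
    using meas by (subst nn_integral_sum) (auto simp: nn_integral_cmult)
  also have "\<dots> \<le> (\<Sum>c\<in>Cl. ennreal (1 / q) * ennreal (exp (\<epsilon> * real (card B))))"
    by (intro sum_mono mult_left_mono int_class) auto
  also have "\<dots> = ennreal (\<Sum>c\<in>Cl. 1 / q * exp (\<epsilon> * real (card B)))"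
    using q0 by (subst sum_ennreal[symmetric]) (simp_all flip: ennreal_mult)
  also have "(\<Sum>c\<in>Cl. 1 / q * exp (\<epsilon> * real (card B))) = exp (\<epsilon> * real (card B))"
    using q q0 by simp
  finally show ?thesis .
qed

text \<open>Chernoff's inequality on each coarse region and a union bound over coarse paths. The
  terms of the exponent are the entropy of the paths, the log-moments of the cells of a region and
  the gain from the threshold t. Since g is nonnegative, a walk may be replaced by a region covering
  it, which leaves finitely many sums. The factor q in \<open>moment\<close> is the price of the
  dependence between nearby sites.\<close>

lemma walk_tail:
  fixes g :: "('d \<Rightarrow> int) \<Rightarrow> (('d \<Rightarrow> int) \<Rightarrow> nat) \<Rightarrow> real" and R :: nat
  defines "q \<equiv> real ((2 * R + 1) ^ CARD('d))"
  assumes g: "\<And>b. local_on (cube b R) (g b)" and g0: "\<And>b x. 0 \<le> g b x"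
    and moment: "\<And>b. (\<integral>\<^sup>+ \<omega>. ennreal (exp (q * s * g b (\<lambda>b'. X b' \<omega>))) \<partial>M) \<le> ennreal (exp \<epsilon>)"
    and "0 \<le> \<epsilon>" and s: "0 < s" and r: "1 \<le> r"
  shows "\<exists>E\<in>events. prob E \<le> exp (real (l div r) * (real CARD('d) * ln 3)
            + \<epsilon> * (real (Suc (l div r)) * (5 * real r) ^ CARD('d)) - s * t) \<and>
      (\<forall>\<omega>\<in>space M - E. \<forall>w. walk w \<longrightarrow> length w \<le> Suc l \<longrightarrow> (\<Sum>b\<in>set w. g b (\<lambda>b'. X b' \<omega>)) < t)"
proof -
  define L where "L = l div r"
  define A where "A us = {\<omega> \<in> space M. t \<le> (\<Sum>b\<in>coarse_region r us. g b (\<lambda>b'. X b' \<omega>))}" for us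
  define E where "E = (\<Union>us\<in>coarse_paths L. A us)"
  have gm: "(\<lambda>\<omega>. g b (\<lambda>b'. X b' \<omega>)) \<in> borel_measurable M" for b
    by (rule measurable_local[OF _ g]) auto
  have A: "A us \<in> events" for us unfolding A_def using gm by measurable
  have fin: "finite (coarse_paths L :: ('d \<Rightarrow> int) list set)"
    and card: "card (coarse_paths L :: ('d \<Rightarrow> int) list set) \<le> (3 ^ CARD('d)) ^ L"
    using card_coarse_paths by blast+
  let ?e = "\<epsilon> * (real (Suc L) * (5 * real r) ^ CARD('d)) - s * t"
  have prob_A: "prob (A us) \<le> exp ?e" if us: "us \<in> coarse_paths L" for us
  proof -
    let ?B = "coarse_region r us" and ?S = "\<lambda>\<omega>. \<Sum>b\<in>coarse_region r us. g b (\<lambda>b'. X b' \<omega>)"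
    have "(\<lambda>\<omega>. ?S \<omega> * indicator (space M) \<omega>) \<in> borel_measurable M" using gm by measurable
    then have "emeasure M (A us) \<le> ennreal (exp (- s * t)) * (\<integral>\<^sup>+ \<omega>. ennreal (exp (s * ?S \<omega>)) * indicator (space M) \<omega> \<partial>M)"
      unfolding A_def by (intro Chernoff_ineq_nn_integral_ge s) auto
    also have "(\<integral>\<^sup>+ \<omega>. ennreal (exp (s * ?S \<omega>)) * indicator (space M) \<omega> \<partial>M) = (\<integral>\<^sup>+ \<omega>. ennreal (exp (s * ?S \<omega>)) \<partial>M)"
      by (intro nn_integral_cong) auto
    also have "\<dots> \<le> ennreal (exp (\<epsilon> * real (card ?B)))"
      using g moment \<open>0 \<le> \<epsilon>\<close> unfolding q_def by (intro nn_integral_exp_sum_local) auto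
    also have "ennreal (exp (- s * t)) * \<dots> = ennreal (exp (\<epsilon> * real (card ?B) - s * t))"
      by (simp add: exp_add exp_diff exp_minus field_simps flip: ennreal_mult)
    also have "\<dots> \<le> ennreal (exp ?e)"
    proof -
      have "real (card ?B) \<le> real (Suc L * (5 * r) ^ CARD('d))"
        using card_coarse_region[OF us r] by (simp only: of_nat_le_iff)
      then have "real (card ?B) \<le> real (Suc L) * (5 * real r) ^ CARD('d)"
        by (simp only: of_nat_mult of_nat_power of_nat_numeral)
      then have "\<epsilon> * real (card ?B) - s * t \<le> ?e"
        using \<open>0 \<le> \<epsilon>\<close> by (intro diff_right_mono mult_left_mono)
      then show ?thesis by (intro ennreal_leI) (simp only: exp_le_cancel_iff)
    qed
    finally have "ennreal (prob (A us)) \<le> ennreal (exp ?e)" by (simp add: emeasure_eq_measure mult_left_mono)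
    then show ?thesis by simp
  qed
  have "prob E \<le> (\<Sum>us\<in>coarse_paths L. prob (A us))"
    unfolding E_def using fin A by (intro finite_measure_subadditive_finite) auto
  also have "\<dots> \<le> real (card (coarse_paths L :: ('d \<Rightarrow> int) list set)) * exp ?e"
    using prob_A by (rule sum_bounded_above)
  also have "\<dots> \<le> (3 ^ CARD('d)) ^ L * exp ?e"
    using card by (intro mult_right_mono) (simp_all flip: of_nat_le_iff[where ?'a = real])
  also have "(3 ^ CARD('d)) ^ L = exp (real L * (real CARD('d) * ln 3))"
    by (simp add: exp_of_nat_mult)
  also have "\<dots> * exp ?e = exp (real L * (real CARD('d) * ln 3) + ?e)" by (simp add: exp_add)
  finally have "prob E \<le> exp (real L * (real CARD('d) * ln 3) + ?e)" .
  moreover have "E \<in> events" unfolding E_def using fin A by auto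
  moreover have "(\<Sum>b\<in>set w. g b (\<lambda>b'. X b' \<omega>)) < t"
    if \<omega>: "\<omega> \<in> space M - E" and w: "walk w" "length w \<le> Suc l" for \<omega> w
  proof -
    obtain us where us: "us \<in> coarse_paths L" "set w \<subseteq> coarse_region r us"
      using walk_coarsening[OF w r] unfolding L_def .
    have "(\<Sum>b\<in>set w. g b (\<lambda>b'. X b' \<omega>)) \<le> (\<Sum>b\<in>coarse_region r us. g b (\<lambda>b'. X b' \<omega>))"
      using us g0 by (intro sum_mono2) auto
    also have "\<dots> < t" using \<omega> us by (auto simp: E_def A_def not_le)
    finally show ?thesis .
  qed
  ultimately show ?thesis unfolding L_def by (intro bexI[of _ E]) (auto simp: add_diff_eq)
qed

section \<open>Tail estimates along walks\<close>

text \<open>Badness at scale \<rho> is determined by the counts within distance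
  \<open>Q * \<rho>\<close>.\<close>

definition Q :: nat where "Q = 2 * CARD('d) + 2"

text \<open>The number of blocks inspected by \<open>bad_site\<close>, plus one for
  crowding.\<close>

definition C0 :: real where "C0 = real ((2 * CARD('d) + 3) ^ CARD('d)) + 1"

text \<open>Sum of the coefficients of the two terms produced by the splitting in
  \<open>bad_moment\<close>.\<close>

definition C1 :: real where "C1 = exp \<Lambda> + C0"

text \<open>Cost of one coarse step: its entropy, and the log-moments of the (5r)^d cells around one
  vertex for the spacing r used in \<open>bad_tail\<close>.\<close>

definition C2 :: real where "C2 = real CARD('d) * ln 3 + C1 * 5 ^ CARD('d)"

text \<open>A bad site depends on at most (3Q)^d * \<rho>^d cells; the factor 2 undoes the 1/2 in
  the exponent of \<open>bad_moment\<close>.\<close>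

definition C3 :: real where "C3 = 2 * real ((3 * Q) ^ CARD('d))"

lemma constants_ge_1: "1 \<le> C0" "1 \<le> C1" "1 \<le> C2" "1 \<le> C3"
proof -
  show C0: "1 \<le> C0" by (simp add: C0_def)
  show C1: "1 \<le> C1" using C0 by (simp add: C1_def add_increasing)
  have "1 * 1 \<le> C1 * 5 ^ CARD('d)" using C1 by (intro mult_mono) auto
  then show "1 \<le> C2" by (simp add: C2_def add_increasing)
  have "1 \<le> (3 * Q) ^ CARD('d)" by (simp add: Q_def)
  then have "real 1 \<le> real ((3 * Q) ^ CARD('d))" by (simp only: of_nat_le_iff)
  then show "1 \<le> C3" unfolding C3_def by linarith
qed

lemma card_cube_Q:
  assumes "1 \<le> \<rho>"
  shows "real (card (cube (b :: 'd \<Rightarrow> int) (Q * \<rho>))) \<le> real ((3 * Q) ^ CARD('d)) * real (\<rho> ^ CARD('d))"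
proof -
  have "1 \<le> Q * \<rho>" using assms by (simp add: Q_def)
  then have "2 * (Q * \<rho>) + 1 \<le> 3 * Q * \<rho>" by (simp add: mult.assoc)
  then have "(2 * (Q * \<rho>) + 1) ^ CARD('d) \<le> (3 * Q * \<rho>) ^ CARD('d)" by (rule power_mono) simp
  then have "card (cube (b :: 'd \<Rightarrow> int) (Q * \<rho>)) \<le> (3 * Q) ^ CARD('d) * \<rho> ^ CARD('d)"
    by (simp add: card_cube power_mult_distrib)
  then show ?thesis by (simp only: of_nat_mult[symmetric] of_nat_le_iff)
qed

lemma void_events [measurable]: "{\<omega> \<in> space M. \<forall>b\<in>B. X b \<omega> = 0} \<in> events"
proof -
  have "{\<omega> \<in> space M. \<forall>b\<in>B. X b \<omega> = 0} = space M \<inter> (\<Inter>b\<in>B. {\<omega> \<in> space M. X b \<omega> = 0})" by auto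
  also have "\<dots> \<in> events" by (cases "B = {}") (auto intro!: sets.Int sets.countable_INT')
  finally show ?thesis .
qed

text \<open>Single cells are independent, so R = 0, and no sampling is required, so r = 1. With s =
  \<tau>, the moment of the indicator of an empty cell is at most 1 + exp \<tau> * exp (- \<tau>) =
  2 < e. Entropy and moments of 2m steps together are at most \<tau> * m / 2 - m.\<close>

lemma void_tail:
  assumes "1 \<le> m"
  shows "\<exists>E\<in>events. prob E \<le> exp (- real m) \<and>
    (\<forall>\<omega>\<in>space M - E. \<forall>w. walk w \<longrightarrow> length w \<le> 2 * m \<longrightarrow> real (card {b \<in> set w. X b \<omega> = 0}) < real m / 2)"
proof -
  let ?g = "\<lambda>(b :: 'd \<Rightarrow> int) (x :: ('d \<Rightarrow> int) \<Rightarrow> nat). if x b = 0 then 1 else 0 :: real"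
  have q1: "real ((2 * 0 + 1) ^ CARD('d)) * \<tau> = \<tau>" by simp
  have moment: "(\<integral>\<^sup>+ \<omega>. ennreal (exp (real ((2 * 0 + 1) ^ CARD('d)) * \<tau> * ?g b (\<lambda>b'. X b' \<omega>))) \<partial>M) \<le> ennreal (exp 1)" for b
  proof -
    let ?V = "{\<omega> \<in> space M. X b \<omega> = 0}"
    have "(\<integral>\<^sup>+ \<omega>. ennreal (exp (real ((2 * 0 + 1) ^ CARD('d)) * \<tau> * ?g b (\<lambda>b'. X b' \<omega>))) \<partial>M)
        \<le> (\<integral>\<^sup>+ \<omega>. 1 + ennreal (exp \<tau>) * indicator ?V \<omega> \<partial>M)"
      unfolding q1 by (intro nn_integral_mono) (auto simp: indicator_def)
    also have "\<dots> = 1 + ennreal (exp \<tau>) * ennreal (prob ?V)"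
      by (subst nn_integral_add) (auto simp: nn_integral_cmult emeasure_eq_measure prob_space)
    also have "\<dots> \<le> 1 + ennreal (exp \<tau>) * ennreal (exp (- \<tau>))"
      by (intro add_left_mono mult_left_mono ennreal_leI void_le) auto
    also have "\<dots> = ennreal 2" by (simp flip: ennreal_mult exp_add add: ennreal_plus[symmetric] del: ennreal_plus)
    also have "\<dots> \<le> ennreal (exp 1)" using exp_ge_add_one_self[of 1] by (intro ennreal_leI) simp
    finally show ?thesis .
  qed
  have local: "local_on (cube b 0) (?g b)" for b
    by (auto simp: local_on_def cube_def)
  have "\<exists>E\<in>events. prob E \<le> exp (real ((2 * m - 1) div 1) * (real CARD('d) * ln 3)
            + 1 * (real (Suc ((2 * m - 1) div 1)) * (5 * real 1) ^ CARD('d)) - \<tau> * (real m / 2)) \<and>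
      (\<forall>\<omega>\<in>space M - E. \<forall>w. walk w \<longrightarrow> length w \<le> Suc (2 * m - 1) \<longrightarrow>
        (\<Sum>b\<in>set w. ?g b (\<lambda>b'. X b' \<omega>)) < real m / 2)"
    using local moment \<tau>_ge_1 by (intro walk_tail[where R = 0]) auto
  then obtain E where E: "E \<in> events" "prob E \<le> exp (real (2 * m - 1) * (real CARD('d) * ln 3)
            + real (Suc (2 * m - 1)) * 5 ^ CARD('d) - \<tau> * (real m / 2))"
      "\<And>\<omega> w. \<omega> \<in> space M - E \<Longrightarrow> walk w \<Longrightarrow> length w \<le> Suc (2 * m - 1) \<Longrightarrow>
        (\<Sum>b\<in>set w. ?g b (\<lambda>b'. X b' \<omega>)) < real m / 2"
    by auto
  have sm: "Suc (2 * m - 1) = 2 * m" using assms by simp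
  have "prob E \<le> exp (- real m)"
  proof (rule order_trans[OF E(2)])
    have "real (2 * m - 1) * (real CARD('d) * ln 3) \<le> real (2 * m) * (real CARD('d) * ln 3)"
      by (intro mult_right_mono) auto
    moreover have "2 * (2 * real CARD('d) * ln 3 + 2 * 5 ^ CARD('d) + 1) * (real m / 2) \<le> \<tau> * (real m / 2)"
      using \<tau>_ge by (intro mult_right_mono) auto
    moreover have "2 * (2 * real CARD('d) * ln 3 + 2 * 5 ^ CARD('d) + 1) * (real m / 2)
      = real (2 * m) * (real CARD('d) * ln 3) + real (2 * m) * 5 ^ CARD('d) + real m"
      by (simp add: field_simps)
    ultimately have "real (2 * m - 1) * (real CARD('d) * ln 3) + real (2 * m) * 5 ^ CARD('d) - \<tau> * (real m / 2) \<le> - real m"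
      by linarith
    then show "exp (real (2 * m - 1) * (real CARD('d) * ln 3)
            + real (Suc (2 * m - 1)) * 5 ^ CARD('d) - \<tau> * (real m / 2)) \<le> exp (- real m)"
      unfolding sm by (simp only: exp_le_cancel_iff)
  qed
  moreover have "real (card {b \<in> set w. X b \<omega> = 0}) < real m / 2"
    if "\<omega> \<in> space M - E" "walk w" "length w \<le> 2 * m" for \<omega> w
  proof -
    have "(\<Sum>b\<in>set w. ?g b (\<lambda>b'. X b' \<omega>)) < real m / 2" using E(3) that sm by simp
    then show ?thesis by (simp add: sum.If_cases Int_def)
  qed
  ultimately show ?thesis using E(1) by blast
qed

text \<open>The threshold for crowding: \<Lambda> for each of the (3Q)^d cells per unit of \<rho>^d,
  and 1 more, which is the rate left over in Chernoff's bound.\<close>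

context
  fixes \<kappa> :: nat
  assumes \<kappa>: "\<Lambda> * real ((3 * Q) ^ CARD('d)) + 1 \<le> real \<kappa>"
begin

lemma local_bad_site:
  fixes b :: "'d \<Rightarrow> int"
  assumes "1 \<le> \<rho>"
  shows "local_on (cube b (Q * \<rho>)) (\<lambda>x. bad_site \<kappa> \<rho> x b)"
  unfolding local_on_def
proof (intro allI impI)
  fix x x' :: "('d \<Rightarrow> int) \<Rightarrow> nat"
  assume eq: "\<forall>i\<in>cube b (Q * \<rho>). x i = x' i"
  have "block \<rho> b k \<subseteq> cube b (Q * \<rho>)" if "k \<in> cube (\<lambda>_. 0) (CARD('d) + 1)" for k
  proof -
    have "block \<rho> b k \<subseteq> cube b ((CARD('d) + 1 + 1) * \<rho>)"
      using assms that by (intro block_subset_cube) auto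
    also have "\<dots> \<subseteq> cube b (Q * \<rho>)" by (intro cube_mono mult_right_mono) (auto simp: Q_def)
    finally show ?thesis .
  qed
  then have "(\<forall>b'\<in>block \<rho> b k. x b' = 0) \<longleftrightarrow> (\<forall>b'\<in>block \<rho> b k. x' b' = 0)"
    if "k \<in> cube (\<lambda>_. 0) (CARD('d) + 1)" for k
    using that eq by (metis subsetD)
  moreover have "(\<Sum>b'\<in>cube b (Q * \<rho>). x b') = (\<Sum>b'\<in>cube b (Q * \<rho>). x' b')"
    using eq by (intro sum.cong) auto
  ultimately show "bad_site \<kappa> \<rho> x b = bad_site \<kappa> \<rho> x' b"
    unfolding bad_site_def Q_def by auto
qed

lemma events_bad_site: "1 \<le> \<rho> \<Longrightarrow> {\<omega> \<in> space M. bad_site \<kappa> \<rho> (\<lambda>b'. X b' \<omega>) b} \<in> events"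
  using measurable_local[OF finite_cube local_bad_site, where N = "count_space UNIV"] by simp

text \<open>An empty block costs \<tau> * \<rho>^d with \<tau> >= 1; crowding is estimated by
  Chernoff's inequality with parameter 1.\<close>

lemma prob_bad_site:
  assumes \<rho>: "1 \<le> \<rho>"
  shows "prob {\<omega> \<in> space M. bad_site \<kappa> \<rho> (\<lambda>b'. X b' \<omega>) b} \<le> C0 * exp (- real (\<rho> ^ CARD('d)))"
proof -
  let ?lam = "real (\<rho> ^ CARD('d))"
  let ?K = "cube (\<lambda>_::'d. 0::int) (CARD('d) + 1)"
  let ?V = "\<lambda>k. {\<omega> \<in> space M. \<forall>b'\<in>block \<rho> b k. X b' \<omega> = 0}"
  let ?C = "cube b (Q * \<rho>)"
  let ?W = "{\<omega> \<in> space M. real \<kappa> * ?lam \<le> (\<Sum>b'\<in>?C. real (X b' \<omega>))}"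
  have "{\<omega> \<in> space M. bad_site \<kappa> \<rho> (\<lambda>b'. X b' \<omega>) b} \<subseteq> (\<Union>k\<in>?K. ?V k) \<union> ?W"
  proof
    fix \<omega> assume "\<omega> \<in> {\<omega> \<in> space M. bad_site \<kappa> \<rho> (\<lambda>b'. X b' \<omega>) b}"
    then have \<omega>: "\<omega> \<in> space M" "bad_site \<kappa> \<rho> (\<lambda>b'. X b' \<omega>) b" by auto
    have "real (\<kappa> * \<rho> ^ CARD('d)) \<le> real (\<Sum>b'\<in>?C. X b' \<omega>)" if "\<kappa> * \<rho> ^ CARD('d) \<le> (\<Sum>b'\<in>?C. X b' \<omega>)"
      using that by (simp only: of_nat_le_iff)
    then show "\<omega> \<in> (\<Union>k\<in>?K. ?V k) \<union> ?W"
      using \<omega> unfolding bad_site_def Q_def[symmetric] by auto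
  qed
  then have "prob {\<omega> \<in> space M. bad_site \<kappa> \<rho> (\<lambda>b'. X b' \<omega>) b} \<le> prob ((\<Union>k\<in>?K. ?V k) \<union> ?W)"
    by (intro finite_measure_mono) auto
  also have "\<dots> \<le> prob (\<Union>k\<in>?K. ?V k) + prob ?W" by (intro measure_Un_le) auto
  also have "prob (\<Union>k\<in>?K. ?V k) \<le> (\<Sum>k\<in>?K. prob (?V k))"
    by (intro finite_measure_subadditive_finite) auto
  also have "\<dots> \<le> real (card ?K) * exp (- ?lam)"
  proof (rule sum_bounded_above)
    fix k
    have "prob (?V k) \<le> exp (- \<tau> * real (card (block \<rho> b k)))"
      using \<rho> by (intro prob_block_void finite_block) auto
    also have "\<dots> = exp (- (\<tau> * ?lam))" using \<rho> by (simp add: card_block)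
    also have "\<dots> \<le> exp (- ?lam)" using mult_right_mono[OF \<tau>_ge_1, of ?lam] by simp
    finally show "prob (?V k) \<le> exp (- ?lam)" .
  qed
  also have "real (card ?K) = C0 - 1" by (simp add: card_cube C0_def numeral_eq_Suc)
  also have "prob ?W \<le> exp (- ?lam)"
  proof -
    have "emeasure M ?W \<le> ennreal (exp (- 1 * (real \<kappa> * ?lam)))
      * (\<integral>\<^sup>+ \<omega>. ennreal (exp (1 * (\<Sum>b'\<in>?C. real (X b' \<omega>)))) * indicator (space M) \<omega> \<partial>M)"
      by (intro Chernoff_ineq_nn_integral_ge) auto
    also have "(\<integral>\<^sup>+ \<omega>. ennreal (exp (1 * (\<Sum>b'\<in>?C. real (X b' \<omega>)))) * indicator (space M) \<omega> \<partial>M)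
        = (\<integral>\<^sup>+ \<omega>. ennreal (exp (\<Sum>b'\<in>?C. real (X b' \<omega>))) \<partial>M)"
      by (intro nn_integral_cong) auto
    also have "\<dots> \<le> ennreal (exp (\<Lambda> * real (card ?C)))" by (rule nn_integral_exp_sum_X) simp
    also have "ennreal (exp (- 1 * (real \<kappa> * ?lam))) * \<dots> = ennreal (exp (\<Lambda> * real (card ?C) - real \<kappa> * ?lam))"
      by (simp add: exp_diff exp_minus field_simps flip: ennreal_mult)
    also have "\<dots> \<le> ennreal (exp (- ?lam))"
    proof -
      have "\<Lambda> * real (card ?C) \<le> \<Lambda> * (real ((3 * Q) ^ CARD('d)) * ?lam)"
        using \<Lambda>_nonneg card_cube_Q[OF \<rho>, of b] by (intro mult_left_mono)
      also have "\<dots> = (\<Lambda> * real ((3 * Q) ^ CARD('d)) + 1) * ?lam - ?lam" by (simp only: algebra_simps)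
      also have "\<dots> \<le> real \<kappa> * ?lam - ?lam" by (intro diff_right_mono mult_right_mono \<kappa>) simp
      finally show ?thesis by (intro ennreal_leI) simp
    qed
    finally show ?thesis by (simp add: emeasure_eq_measure mult_left_mono)
  qed
  finally show ?thesis by (simp add: algebra_simps)
qed

text \<open>Badness of a cell and its count are dependent; the inequality \<open>amgm\<close>
  decouples them. With \<eta> the square root of exp(- \<rho>^d), the exponential moment gets the
  factor \<eta>, and the probability of badness, of order \<eta>^2, gets the factor 1 / \<eta>: both
  terms are of order \<eta>.\<close>

lemma bad_moment:
  assumes \<rho>: "1 \<le> \<rho>"
  shows "(\<integral>\<^sup>+ \<omega>. ennreal (exp (1/2 * (if bad_site \<kappa> \<rho> (\<lambda>b'. X b' \<omega>) b then real (X b \<omega>) else 0))) \<partial>M)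
    \<le> ennreal (exp (C1 * exp (- real (\<rho> ^ CARD('d)) / 2)))"
proof -
  let ?lam = "real (\<rho> ^ CARD('d))"
  define \<eta> where "\<eta> = exp (- ?lam / 2)"
  let ?B = "{\<omega> \<in> space M. bad_site \<kappa> \<rho> (\<lambda>b'. X b' \<omega>) b}"
  have \<eta>: "0 < \<eta>" "exp (- ?lam) = \<eta> * \<eta>" by (simp_all add: \<eta>_def flip: exp_add)
  have [measurable]: "?B \<in> events" by (rule events_bad_site[OF \<rho>])
  have amgm: "exp (1/2 * y) \<le> \<eta> * exp y + 1 / \<eta>" for y :: real
  proof -
    have "0 \<le> (\<eta> * exp (1/2 * y) - 1)\<^sup>2" by simp
    also have "\<dots> = \<eta> * (\<eta> * exp y - 2 * exp (1/2 * y) + 1 / \<eta>)"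
      using \<eta> by (simp add: power2_eq_square algebra_simps flip: exp_add)
    finally have "0 \<le> \<eta> * exp y - 2 * exp (1/2 * y) + 1 / \<eta>" using \<eta> by (simp add: zero_le_mult_iff)
    then show ?thesis using exp_gt_zero[of "1/2 * y"] by linarith
  qed
  have "(\<integral>\<^sup>+ \<omega>. ennreal (exp (1/2 * (if bad_site \<kappa> \<rho> (\<lambda>b'. X b' \<omega>) b then real (X b \<omega>) else 0))) \<partial>M)
    \<le> (\<integral>\<^sup>+ \<omega>. 1 + (ennreal \<eta> * ennreal (exp (real (X b \<omega>))) + ennreal (1 / \<eta>) * indicator ?B \<omega>) \<partial>M)"
  proof (rule nn_integral_mono)
    fix \<omega> assume \<omega>: "\<omega> \<in> space M"
    show "ennreal (exp (1/2 * (if bad_site \<kappa> \<rho> (\<lambda>b'. X b' \<omega>) b then real (X b \<omega>) else 0)))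
      \<le> 1 + (ennreal \<eta> * ennreal (exp (real (X b \<omega>))) + ennreal (1 / \<eta>) * indicator ?B \<omega>)"
    proof (cases "\<omega> \<in> ?B")
      case True
      then have "ennreal (exp (1/2 * (if bad_site \<kappa> \<rho> (\<lambda>b'. X b' \<omega>) b then real (X b \<omega>) else 0)))
        \<le> ennreal (\<eta> * exp (real (X b \<omega>)) + 1 / \<eta>)" using amgm by (intro ennreal_leI) auto
      also have "\<dots> = ennreal \<eta> * ennreal (exp (real (X b \<omega>))) + ennreal (1 / \<eta>) * indicator ?B \<omega>"
        using True \<eta> by (simp add: ennreal_mult)
      also have "\<dots> \<le> 1 + \<dots>" by (simp add: add_increasing)
      finally show ?thesis .
    qed (use \<omega> in auto)
  qed
  also have "\<dots> = 1 + (ennreal \<eta> * (\<integral>\<^sup>+ \<omega>. ennreal (exp (real (X b \<omega>))) \<partial>M) + ennreal (1 / \<eta>) * ennreal (prob ?B))"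
    by (simp add: nn_integral_add nn_integral_cmult emeasure_eq_measure prob_space)
  also have "\<dots> \<le> 1 + (ennreal \<eta> * ennreal (exp \<Lambda>) + ennreal (1 / \<eta>) * ennreal (C0 * exp (- ?lam)))"
    by (intro add_left_mono add_mono mult_left_mono exp_moment_le ennreal_leI prob_bad_site \<rho>) auto
  also have "\<dots> = ennreal (1 + C1 * \<eta>)"
    using \<eta> constants_ge_1 by (simp add: C1_def field_simps flip: ennreal_mult ennreal_plus ennreal_1)
  also have "\<dots> \<le> ennreal (exp (C1 * \<eta>))" by (intro ennreal_leI exp_ge_add_one_self)
  finally show ?thesis by (simp add: \<eta>_def)
qed

text \<open>The spacing \<open>r\<close> of the coarse paths is chosen so that a cube of side \<open>r\<close> contains a bounded
  expected number of bad sites.\<close>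
lemma bad_tail:
  assumes \<rho>: "1 \<le> \<rho>" and m: "1 \<le> m" and x: "0 \<le> x"
  defines "lam \<equiv> real (\<rho> ^ CARD('d))"
  shows "\<exists>E\<in>events. prob E \<le> exp (C2 - x) \<and>
    (\<forall>\<omega>\<in>space M - E. \<forall>w. walk w \<longrightarrow> length w \<le> 2 * m \<longrightarrow>
       (\<Sum>b\<in>set w. if bad_site \<kappa> \<rho> (\<lambda>b'. X b' \<omega>) b then real (X b \<omega>) else 0)
         < C3 * lam * (4 * C2 * real m * exp (- lam / (2 * real CARD('d))) + x))"
proof -
  \<comment> \<open>y^d = exp(lam / 2) cancels the log-moment C1 * exp(- lam / 2) of a single cell;
    r is y rounded down, whence y <= 2r.\<close>
  define y where "y = exp (lam / (2 * real CARD('d)))"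
  define r where "r = nat \<lfloor>y\<rfloor>"
  define q where "q = real ((2 * (Q * \<rho>) + 1) ^ CARD('d))"
  \<comment> \<open>The first summand pays C2 for each of the at most 4m / y coarse steps, and x is
    the remaining gain. A path has one vertex more than steps, which leaves the C2 in the bound for
    E.\<close>
  define t where "t = C3 * lam * (4 * C2 * real m * (1 / y) + x)"
  define L where "L = (2 * m - 1) div r"
  let ?g = "\<lambda>(b :: 'd \<Rightarrow> int) (x :: ('d \<Rightarrow> int) \<Rightarrow> nat). if bad_site \<kappa> \<rho> x b then real (x b) else 0"
  have y: "1 \<le> y" by (simp add: y_def lam_def)
  have r1: "1 \<le> \<lfloor>y\<rfloor>" using y by simp
  then have "real r = real_of_int \<lfloor>y\<rfloor>" by (simp add: r_def)
  with r1 have r: "1 \<le> r" "real r \<le> y" "y \<le> 2 * real r" by linarith+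
  have q: "0 < q" unfolding q_def by (subst of_nat_0_less_iff) simp
  have qle: "2 * q \<le> C3 * lam"
    using card_cube_Q[OF \<rho>, of "\<lambda>_. 0"] unfolding card_cube q_def C3_def lam_def by linarith
  \<comment> \<open>The parameter 1 / (2 * q) is such that, after the loss of the factor q to
    dependence, exactly the exponent 1/2 of \<open>bad_moment\<close> remains.\<close>
  have q2: "real ((2 * (Q * \<rho>) + 1) ^ CARD('d)) * (1 / (2 * q)) = 1/2"
    using q unfolding q_def[symmetric] by simp
  have moment: "(\<integral>\<^sup>+ \<omega>. ennreal (exp (real ((2 * (Q * \<rho>) + 1) ^ CARD('d)) * (1 / (2 * q)) * ?g b (\<lambda>b'. X b' \<omega>))) \<partial>M)
      \<le> ennreal (exp (C1 * exp (- lam / 2)))" for b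
    unfolding q2 lam_def by (rule bad_moment[OF \<rho>])
  have local: "local_on (cube b (Q * \<rho>)) (?g b)" for b
  proof -
    have "b \<in> cube b (Q * \<rho>)" by simp
    then show ?thesis using local_bad_site[OF \<rho>, of b] unfolding local_on_def by metis
  qed
  have "\<exists>E\<in>events. prob E \<le> exp (real L * (real CARD('d) * ln 3)
            + C1 * exp (- lam / 2) * (real (Suc L) * (5 * real r) ^ CARD('d)) - 1 / (2 * q) * t) \<and>
      (\<forall>\<omega>\<in>space M - E. \<forall>w. walk w \<longrightarrow> length w \<le> Suc (2 * m - 1) \<longrightarrow> (\<Sum>b\<in>set w. ?g b (\<lambda>b'. X b' \<omega>)) < t)"
    unfolding L_def using local moment q r constants_ge_1 by (intro walk_tail[where R = "Q * \<rho>"]) auto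
  then obtain E where E: "E \<in> events" "prob E \<le> exp (real L * (real CARD('d) * ln 3)
            + C1 * exp (- lam / 2) * (real (Suc L) * (5 * real r) ^ CARD('d)) - 1 / (2 * q) * t)"
      "\<And>\<omega> w. \<omega> \<in> space M - E \<Longrightarrow> walk w \<Longrightarrow> length w \<le> Suc (2 * m - 1) \<Longrightarrow> (\<Sum>b\<in>set w. ?g b (\<lambda>b'. X b' \<omega>)) < t"
    by blast
  have sm: "Suc (2 * m - 1) = 2 * m" using m by simp
  have yd: "y ^ CARD('d) = exp (lam / 2)"
    unfolding y_def exp_of_nat_mult[symmetric] by simp
  have "(5 * real r) ^ CARD('d) \<le> (5 * y) ^ CARD('d)" using r by (intro power_mono) auto
  also have "\<dots> = 5 ^ CARD('d) * exp (lam / 2)" by (simp add: power_mult_distrib yd)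
  finally have "C1 * exp (- lam / 2) * (real (Suc L) * (5 * real r) ^ CARD('d))
      \<le> C1 * exp (- lam / 2) * (real (Suc L) * (5 ^ CARD('d) * exp (lam / 2)))"
    using constants_ge_1 by (intro mult_left_mono) auto
  also have "\<dots> = real (Suc L) * (C1 * 5 ^ CARD('d)) * (exp (- lam / 2) * exp (lam / 2))"
    by (simp only: mult_ac)
  also have "exp (- lam / 2) * exp (lam / 2) = 1" by (simp flip: exp_add)
  finally have 1: "C1 * exp (- lam / 2) * (real (Suc L) * (5 * real r) ^ CARD('d))
      \<le> real (Suc L) * (C1 * 5 ^ CARD('d))" by simp
  have 2: "real L * (real CARD('d) * ln 3) \<le> real (Suc L) * (real CARD('d) * ln 3)"
    by (intro mult_right_mono) auto
  have 3: "real (Suc L) * (real CARD('d) * ln 3) + real (Suc L) * (C1 * 5 ^ CARD('d)) = C2 * real L + C2"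
    by (simp add: C2_def algebra_simps)
  have "L * r \<le> 2 * m" unfolding L_def using div_times_less_eq_dividend[of "2 * m - 1" r] by linarith
  then have "real (L * r) \<le> real (2 * m)" by (simp only: of_nat_le_iff)
  then have "real L * real r \<le> 2 * real m" by simp
  moreover have "real L * y \<le> real L * (2 * real r)" using r by (intro mult_left_mono) auto
  ultimately have "real L * y \<le> 4 * real m" by linarith
  then have "real L \<le> 4 * real m * (1 / y)" using y by (simp add: field_simps)
  then have 4: "C2 * real L \<le> C2 * (4 * real m * (1 / y))" using constants_ge_1 by (intro mult_left_mono) auto
  have "2 * q * (4 * C2 * real m * (1 / y) + x) \<le> t"
    unfolding t_def using qle x y constants_ge_1 by (intro mult_right_mono) auto
  then have 5: "4 * C2 * real m * (1 / y) + x \<le> 1 / (2 * q) * t" using q by (simp add: field_simps)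
  have 6: "C2 * (4 * real m * (1 / y)) = 4 * C2 * real m * (1 / y)" by simp
  have "real L * (real CARD('d) * ln 3)
        + C1 * exp (- lam / 2) * (real (Suc L) * (5 * real r) ^ CARD('d)) - 1 / (2 * q) * t \<le> C2 - x"
    using 1 2 3 4 5 6 by linarith
  then have pE: "prob E \<le> exp (C2 - x)" by (intro order_trans[OF E(2)]) (simp only: exp_le_cancel_iff)
  have y1: "exp (- lam / (2 * real CARD('d))) = 1 / y" by (simp add: y_def exp_minus field_simps)
  show ?thesis
  proof (intro bexI[OF _ E(1)] conjI ballI allI impI pE)
    fix \<omega> and w :: "('d \<Rightarrow> int) list"
    assume "\<omega> \<in> space M - E" "walk w" "length w \<le> 2 * m"
    then show "(\<Sum>b\<in>set w. if bad_site \<kappa> \<rho> (\<lambda>b'. X b' \<omega>) b then real (X b \<omega>) else 0)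
         < C3 * lam * (4 * C2 * real m * exp (- lam / (2 * real CARD('d))) + x)"
      unfolding y1 using E(3)[of \<omega> w] by (simp only: sm t_def)
  qed
qed

end

text \<open>A deterministic condition on the counts, which separates geometry from probability.
  Below scale T only the number of points in bad cells is limited, with slack x; at scale T no cell
  within reach of a walk may be bad.\<close>

definition good :: "nat \<Rightarrow> nat \<Rightarrow> nat \<Rightarrow> real \<Rightarrow> (('d \<Rightarrow> int) \<Rightarrow> nat) \<Rightarrow> bool" where
  "good \<kappa> m T x X' \<longleftrightarrow>
     (\<forall>w. walk w \<longrightarrow> length w \<le> 2 * m \<longrightarrow> real (card {b \<in> set w. X' b = 0}) < real m / 2) \<and>
     (\<forall>\<rho>\<in>{1..<T}. \<forall>w. walk w \<longrightarrow> length w \<le> 2 * m \<longrightarrow>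
        (\<Sum>b\<in>set w. if bad_site \<kappa> \<rho> X' b then real (X' b) else 0)
          < C3 * real (\<rho> ^ CARD('d)) *
              (4 * C2 * real m * exp (- real (\<rho> ^ CARD('d)) / (2 * real CARD('d))) + x)) \<and>
     (\<forall>b\<in>cube (\<lambda>_. 0) (2 * m). \<not> bad_site \<kappa> T X' b)"

lemma prob_good:
  assumes \<kappa>: "\<Lambda> * real ((3 * Q) ^ CARD('d)) + 1 \<le> real \<kappa>" and m: "1 \<le> m" and T: "1 \<le> T" and x: "0 \<le> x"
  shows "\<exists>E\<in>events. prob E \<le> exp (- real m) + real T * exp (C2 - x)
      + C0 * (5 * real m) ^ CARD('d) * exp (- real (T ^ CARD('d))) \<and>
    (\<forall>\<omega>\<in>space M - E. good \<kappa> m T x (\<lambda>b. X b \<omega>))"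
proof -
  obtain E1 where E1: "E1 \<in> events" "prob E1 \<le> exp (- real m)"
    "\<And>\<omega> w. \<omega> \<in> space M - E1 \<Longrightarrow> walk w \<Longrightarrow> length w \<le> 2 * m \<Longrightarrow> real (card {b \<in> set w. X b \<omega> = 0}) < real m / 2"
    using void_tail[OF m] by blast
  let ?P = "\<lambda>\<rho> E. E \<in> events \<and> prob E \<le> exp (C2 - x) \<and>
    (\<forall>\<omega>\<in>space M - E. \<forall>w. walk w \<longrightarrow> length w \<le> 2 * m \<longrightarrow>
       (\<Sum>b\<in>set w. if bad_site \<kappa> \<rho> (\<lambda>b'. X b' \<omega>) b then real (X b \<omega>) else 0)
         < C3 * real (\<rho> ^ CARD('d)) *
             (4 * C2 * real m * exp (- real (\<rho> ^ CARD('d)) / (2 * real CARD('d))) + x))"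
  have "\<forall>\<rho>\<in>{1..<T}. \<exists>E. ?P \<rho> E"
  proof
    fix \<rho> assume "\<rho> \<in> {1..<T}"
    then have "1 \<le> \<rho>" by simp
    from bad_tail[OF \<kappa> this m x] show "\<exists>E. ?P \<rho> E" unfolding Bex_def .
  qed
  from bchoice[OF this] obtain E2 where "\<forall>\<rho>\<in>{1..<T}. ?P \<rho> (E2 \<rho>)" ..
  then have E2: "?P \<rho> (E2 \<rho>)" if "\<rho> \<in> {1..<T}" for \<rho> using that by (rule bspec)
  define E3 where "E3 = (\<Union>b\<in>cube (\<lambda>_. 0) (2 * m). {\<omega> \<in> space M. bad_site \<kappa> T (\<lambda>b'. X b' \<omega>) b})"
  have ev3: "E3 \<in> events" unfolding E3_def using events_bad_site[OF \<kappa> T] by (intro sets.finite_UN) auto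
  have "prob E3 \<le> (\<Sum>b\<in>cube (\<lambda>_. 0) (2 * m). prob {\<omega> \<in> space M. bad_site \<kappa> T (\<lambda>b'. X b' \<omega>) b})"
    unfolding E3_def using events_bad_site[OF \<kappa> T] by (intro finite_measure_subadditive_finite) auto
  also have "\<dots> \<le> real (card (cube (\<lambda>_ :: 'd. 0) (2 * m))) * (C0 * exp (- real (T ^ CARD('d))))"
    by (intro sum_bounded_above prob_bad_site[OF \<kappa> T])
  also have "\<dots> \<le> (5 * real m) ^ CARD('d) * (C0 * exp (- real (T ^ CARD('d))))"
  proof -
    have "2 * (2 * m) + 1 \<le> 5 * m" using m by simp
    then have "(2 * (2 * m) + 1) ^ CARD('d) \<le> (5 * m) ^ CARD('d)" by (rule power_mono) simp
    then have "real (card (cube (\<lambda>_ :: 'd. 0) (2 * m))) \<le> real ((5 * m) ^ CARD('d))"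
      unfolding card_cube by (simp only: of_nat_le_iff)
    also have "\<dots> = (5 * real m) ^ CARD('d)" by simp
    finally show ?thesis using constants_ge_1 by (intro mult_right_mono) auto
  qed
  finally have p3: "prob E3 \<le> C0 * (5 * real m) ^ CARD('d) * exp (- real (T ^ CARD('d)))" by (simp only: mult_ac)
  have ev2: "(\<Union>\<rho>\<in>{1..<T}. E2 \<rho>) \<in> events" using E2 by (intro sets.finite_UN) auto
  have "prob (\<Union>\<rho>\<in>{1..<T}. E2 \<rho>) \<le> (\<Sum>\<rho>\<in>{1..<T}. prob (E2 \<rho>))"
    using E2 by (intro finite_measure_subadditive_finite) auto
  also have "\<dots> \<le> real (card {1..<T}) * exp (C2 - x)" using E2 by (intro sum_bounded_above) auto
  also have "\<dots> \<le> real T * exp (C2 - x)" by (intro mult_right_mono) auto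
  finally have p2: "prob (\<Union>\<rho>\<in>{1..<T}. E2 \<rho>) \<le> real T * exp (C2 - x)" .
  let ?E = "E1 \<union> (\<Union>\<rho>\<in>{1..<T}. E2 \<rho>) \<union> E3"
  have "prob ?E \<le> prob (E1 \<union> (\<Union>\<rho>\<in>{1..<T}. E2 \<rho>)) + prob E3"
    using E1 ev2 ev3 by (intro measure_Un_le) auto
  moreover have "prob (E1 \<union> (\<Union>\<rho>\<in>{1..<T}. E2 \<rho>)) \<le> prob E1 + prob (\<Union>\<rho>\<in>{1..<T}. E2 \<rho>)"
    using E1 ev2 by (intro measure_Un_le) auto
  ultimately have "prob ?E \<le> exp (- real m) + real T * exp (C2 - x)
      + C0 * (5 * real m) ^ CARD('d) * exp (- real (T ^ CARD('d)))" using E1(2) p2 p3 by linarith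
  moreover have "?E \<in> events" using E1 ev2 ev3 by blast
  moreover have "good \<kappa> m T x (\<lambda>b. X b \<omega>)" if "\<omega> \<in> space M - ?E" for \<omega>
    unfolding good_def
  proof (intro conjI ballI allI impI)
    show "real (card {b \<in> set w. X b \<omega> = 0}) < real m / 2" if "walk w" "length w \<le> 2 * m" for w
      using E1(3) that \<open>\<omega> \<in> space M - ?E\<close> by blast
    show "(\<Sum>b\<in>set w. if bad_site \<kappa> \<rho> (\<lambda>b. X b \<omega>) b then real (X b \<omega>) else 0)
         < C3 * real (\<rho> ^ CARD('d)) *
             (4 * C2 * real m * exp (- real (\<rho> ^ CARD('d)) / (2 * real CARD('d))) + x)"
      if "\<rho> \<in> {1..<T}" "walk w" "length w \<le> 2 * m" for \<rho> w
      using E2[OF that(1)] that \<open>\<omega> \<in> space M - ?E\<close> by blast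
    show "\<not> bad_site \<kappa> T (\<lambda>b. X b \<omega>) b" if "b \<in> cube (\<lambda>_. 0) (2 * m)" for b
      using that \<open>\<omega> \<in> space M - ?E\<close> by (auto simp: E3_def)
  qed
  ultimately show ?thesis by blast
qed

text \<open>A site bad at all scales has probability at most C0 * exp(- \<rho>) for every \<rho>.
  Hence almost surely all tiles are bounded, which the lower bound on the mean uses to build
  polyominoes.\<close>

lemma AE_not_bad_site:
  assumes \<kappa>: "\<Lambda> * real ((3 * Q) ^ CARD('d)) + 1 \<le> real \<kappa>"
  shows "AE \<omega> in M. \<forall>b. \<exists>\<rho>\<ge>1. \<not> bad_site \<kappa> \<rho> (\<lambda>b'. X b' \<omega>) b"
proof -
  have "AE \<omega> in M. \<exists>\<rho>\<ge>1. \<not> bad_site \<kappa> \<rho> (\<lambda>b'. X b' \<omega>) b" for b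
  proof (rule AE_I')
    let ?N = "\<lambda>\<rho>. {\<omega> \<in> space M. bad_site \<kappa> (Suc \<rho>) (\<lambda>b'. X b' \<omega>) b}"
    have N: "?N \<rho> \<in> events" for \<rho> by (rule events_bad_site[OF \<kappa>]) simp
    have le: "prob (\<Inter>\<rho>. ?N \<rho>) \<le> C0 * exp (- real \<rho>)" for \<rho>
    proof -
      have "prob (\<Inter>\<rho>. ?N \<rho>) \<le> prob (?N \<rho>)" using N by (intro finite_measure_mono) auto
      also have "\<dots> \<le> C0 * exp (- real (Suc \<rho> ^ CARD('d)))" by (rule prob_bad_site[OF \<kappa>]) simp
      also have "\<dots> \<le> C0 * exp (- real \<rho>)"
      proof -
        have "Suc \<rho> \<le> Suc \<rho> ^ CARD('d)" by (rule self_le_power) auto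
        then have "real \<rho> \<le> real (Suc \<rho> ^ CARD('d))" by (subst of_nat_le_iff) linarith
        then show ?thesis using constants_ge_1 by (intro mult_left_mono) auto
      qed
      finally show ?thesis .
    qed
    have "(\<lambda>\<rho>. C0 * exp (- real \<rho>)) \<longlonglongrightarrow> C0 * 0"
      by (intro tendsto_intros filterlim_compose[OF exp_at_bot] filterlim_uminus_at_bot_at_top[THEN filterlim_compose] filterlim_real_sequentially)
    then have "prob (\<Inter>\<rho>. ?N \<rho>) \<le> C0 * 0" using le by (intro LIMSEQ_le_const) auto
    then have "prob (\<Inter>\<rho>. ?N \<rho>) = 0" by (simp add: measure_le_0_iff)
    moreover have "(\<Inter>\<rho>. ?N \<rho>) \<in> events" using N by (intro sets.countable_INT') auto
    ultimately show "(\<Inter>\<rho>. ?N \<rho>) \<in> null_sets M" by (auto simp: null_sets_def emeasure_eq_measure)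
    show "{\<omega> \<in> space M. \<not> (\<exists>\<rho>\<ge>1. \<not> bad_site \<kappa> \<rho> (\<lambda>b'. X b' \<omega>) b)} \<subseteq> (\<Inter>\<rho>. ?N \<rho>)" by auto
  qed
  then show ?thesis by (simp add: AE_all_countable)
qed

text \<open>If the cells met by a polyomino of \<open>n\<close> tiles numbered at least \<open>m\<close>, then \<open>m\<close> of them would
  form a walk most of whose sites are empty.\<close>
lemma good_polyomino_walk:
  fixes S :: "(real ^ 'd) set"
  assumes lf: "locally_finite_set S" and s: "1 \<le> s" and m: "1 \<le> m"
    and good: "good \<kappa> m T x (cell_count s S)"
    and P: "P \<in> polyominoes n S" and n: "2 * real (n * (2 * CARD('d) + 1) ^ CARD('d)) \<le> real m"
  shows "\<exists>w. walk w \<and> length w \<le> 2 * m \<and> idx s ` P \<subseteq> set w"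
proof -
  define U where "U = (\<Union>v\<in>P. voronoi_tile S v)"
  define F where "F = idx s ` U"
  have P': "finite P" "card P = n" "connected U" "0 \<in> U" using P by (auto simp: polyominoes_def U_def)
  have "idx s (0 :: real ^ 'd) = (\<lambda>_. 0)" by (simp add: idx_def)
  then have F0: "(\<lambda>_. 0) \<in> F" using imageI[OF P'(4), of "idx s"] unfolding F_def by simp
  have conn: "\<exists>a\<in>A. \<exists>b\<in>F - A. b \<in> cube a 1" if "A \<subset> F" "(\<lambda>_. 0) \<in> A" for A
    using idx_connected[OF s P'(3), of A] that unfolding F_def by blast
  have small: "finite F \<and> card F < m"
  proof (rule ccontr)
    assume "\<not> (finite F \<and> card F < m)"
    then have "infinite F \<or> m \<le> card F" by auto
    then obtain w where w: "walk w" "set w \<subseteq> F" "card (set w) = m" "length w \<le> 2 * m - 1"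
      using walk_covering[OF F0 conn m] by blast
    have "card (set w) = card ({b \<in> set w. cell_count s S b = 0} \<union> {b \<in> set w. cell_count s S b \<noteq> 0})"
      by (intro arg_cong[where f = card]) auto
    also have "\<dots> = card {b \<in> set w. cell_count s S b = 0} + card {b \<in> set w. cell_count s S b \<noteq> 0}"
      by (intro card_Un_disjoint) auto
    also have "card {b \<in> set w. cell_count s S b \<noteq> 0} \<le> n * (2 * CARD('d) + 1) ^ CARD('d)"
      using card_nonempty_cells[OF lf s P'(1), of "set w"] w(2) P'(2) by (simp add: F_def U_def)
    finally have "m \<le> card {b \<in> set w. cell_count s S b = 0} + n * (2 * CARD('d) + 1) ^ CARD('d)"
      unfolding w(3) by simp
    then have "real m \<le> real (card {b \<in> set w. cell_count s S b = 0} + n * (2 * CARD('d) + 1) ^ CARD('d))"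
      by (simp only: of_nat_le_iff)
    then have "real m \<le> real (card {b \<in> set w. cell_count s S b = 0}) + real (n * (2 * CARD('d) + 1) ^ CARD('d))"
      by (simp only: of_nat_add)
    moreover have "real (card {b \<in> set w. cell_count s S b = 0}) < real m / 2"
      using good w by (auto simp: good_def)
    ultimately show False using n by linarith
  qed
  have "F \<noteq> {}" using F0 by blast
  then have cF: "1 \<le> card F" using small by (simp add: Suc_le_eq card_gt_0_iff)
  then obtain w where w: "walk w" "set w \<subseteq> F" "card (set w) = card F" "length w \<le> 2 * card F - 1"
    using walk_covering[OF F0 conn cF disjI2[OF order_refl]] by blast
  have "set w = F" using w small by (intro card_subset_eq) auto
  moreover have "idx s ` P \<subseteq> F" unfolding F_def U_def using center_in_voronoi_tile by blast
  moreover have "length w \<le> 2 * m" using w small by linarith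
  ultimately show ?thesis using w(1) by blast
qed

text \<open>Summation by layers. If \<rho>' is the least scale at which the cell of v is not bad,
  the weight of v is at most f(\<kappa> * \<rho>'^d), which telescopes into increments over the
  scales below \<rho>', where the cell is bad. Exchanging the sums leaves, at each scale, the number
  of centres in bad cells, and this is at most the sum of counts along a walk through their
  cells.\<close>

lemma good_sum_le:
  fixes S :: "(real ^ 'd) set"
  assumes lf: "locally_finite_set S" and s: "1 \<le> s" and d: "2 \<le> CARD('d)" and m: "1 \<le> m" and T: "1 \<le> T"
    and \<kappa>: "1 \<le> \<kappa>" and f: "weight_function f"
    and good: "good \<kappa> m T x (cell_count s S)"
    and P: "P \<in> polyominoes n S" and n: "2 * real (n * (2 * CARD('d) + 1) ^ CARD('d)) \<le> real m"
  shows "(\<Sum>v\<in>P. f (real (voronoi_degree S v))) \<le> real n * f (real \<kappa>)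
    + (\<Sum>\<rho>\<in>{1..<T}. (f (real (\<kappa> * Suc \<rho> ^ CARD('d))) - f (real (\<kappa> * \<rho> ^ CARD('d)))) *
        (C3 * real (\<rho> ^ CARD('d)) *
              (4 * C2 * real m * exp (- real (\<rho> ^ CARD('d)) / (2 * real CARD('d))) + x)))"
proof -
  let ?X = "cell_count s S"
  define h where "h \<rho> = f (real (\<kappa> * \<rho> ^ CARD('d)))" for \<rho>
  obtain w where w: "walk w" "length w \<le> 2 * m" "idx s ` P \<subseteq> set w"
    using good_polyomino_walk[OF lf s m good P n] by blast
  have P': "finite P" "card P = n" "P \<subseteq> S" using P by (auto simp: polyominoes_def)
  have h_mono: "h \<rho> \<le> h (Suc \<rho>)" if "1 \<le> \<rho>" for \<rho>
  proof -
    have "1 * 1 \<le> \<kappa> * \<rho> ^ CARD('d)" using \<kappa> that by (intro mult_mono) auto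
    then have "real 1 \<le> real (\<kappa> * \<rho> ^ CARD('d))" by (simp only: of_nat_le_iff)
    moreover have "\<kappa> * \<rho> ^ CARD('d) \<le> \<kappa> * Suc \<rho> ^ CARD('d)" by (intro mult_left_mono power_mono) auto
    then have "real (\<kappa> * \<rho> ^ CARD('d)) \<le> real (\<kappa> * Suc \<rho> ^ CARD('d))" by (simp only: of_nat_le_iff)
    ultimately show ?thesis unfolding h_def by (intro weight_function_mono[OF f]) auto
  qed
  have pointwise: "f (real (voronoi_degree S v)) \<le> h 1 + (\<Sum>\<rho>\<in>{1..<T}. if bad_site \<kappa> \<rho> ?X (idx s v) then h (Suc \<rho>) - h \<rho> else 0)"
    if v: "v \<in> P" for v
  proof -
    define b where "b = idx s v"
    have "b \<in> set w" using w(3) v by (auto simp: b_def)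
    moreover have "set w \<subseteq> cube (\<lambda>_. 0) (2 * m)" using walk_subset_cube[OF w(1)] w(2) by simp
    ultimately have nbT: "\<not> bad_site \<kappa> T ?X b" using good unfolding good_def by blast
    define \<rho>' where "\<rho>' = (LEAST \<rho>. 1 \<le> \<rho> \<and> \<not> bad_site \<kappa> \<rho> ?X b)"
    have \<rho>': "1 \<le> \<rho>'" "\<not> bad_site \<kappa> \<rho>' ?X b"
      using LeastI[of "\<lambda>\<rho>. 1 \<le> \<rho> \<and> \<not> bad_site \<kappa> \<rho> ?X b" T] nbT T by (auto simp: \<rho>'_def)
    have "\<rho>' \<le> T" unfolding \<rho>'_def using nbT T by (intro Least_le) auto
    have bad: "bad_site \<kappa> \<rho> ?X b" if "1 \<le> \<rho>" "\<rho> < \<rho>'" for \<rho>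
      using not_less_Least[of \<rho> "\<lambda>\<rho>. 1 \<le> \<rho> \<and> \<not> bad_site \<kappa> \<rho> ?X b"] that by (auto simp: \<rho>'_def)
    have "v \<in> S" using v P' by blast
    note deg = not_bad_site_degree[OF lf s \<rho>'(1) \<open>v \<in> S\<close> d \<rho>'(2)[unfolded b_def]]
    have "real (voronoi_degree S v) \<le> real (\<kappa> * \<rho>' ^ CARD('d))" using deg(2) by (simp only: of_nat_le_iff)
    then have "f (real (voronoi_degree S v)) \<le> h \<rho>'"
      unfolding h_def using deg(1) by (intro weight_function_mono[OF f]) auto
    also have "h \<rho>' = h 1 + (\<Sum>\<rho>\<in>{1..<\<rho>'}. h (Suc \<rho>) - h \<rho>)" using \<rho>'(1) by (simp add: sum_Suc_diff')
    also have "(\<Sum>\<rho>\<in>{1..<\<rho>'}. h (Suc \<rho>) - h \<rho>) = (\<Sum>\<rho>\<in>{1..<\<rho>'}. if bad_site \<kappa> \<rho> ?X b then h (Suc \<rho>) - h \<rho> else 0)"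
      using bad by (intro sum.cong) auto
    also have "\<dots> \<le> (\<Sum>\<rho>\<in>{1..<T}. if bad_site \<kappa> \<rho> ?X b then h (Suc \<rho>) - h \<rho> else 0)"
      using \<open>\<rho>' \<le> T\<close> h_mono by (intro sum_mono2) auto
    finally show ?thesis by (simp add: b_def)
  qed
  have count: "(\<Sum>v\<in>P. if bad_site \<kappa> \<rho> ?X (idx s v) then 1 else 0 :: real)
      \<le> (\<Sum>b\<in>set w. if bad_site \<kappa> \<rho> ?X b then real (?X b) else 0)" for \<rho>
  proof -
    have "(\<Sum>v\<in>P. if bad_site \<kappa> \<rho> ?X (idx s v) then 1 else 0 :: real)
      = (\<Sum>b\<in>set w. \<Sum>v\<in>{v \<in> P. idx s v = b}. if bad_site \<kappa> \<rho> ?X (idx s v) then 1 else 0)"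
      by (rule sum.group[symmetric]) (use P' w in auto)
    also have "\<dots> \<le> (\<Sum>b\<in>set w. if bad_site \<kappa> \<rho> ?X b then real (?X b) else 0)"
    proof (rule sum_mono)
      fix b
      have "(\<Sum>v\<in>{v \<in> P. idx s v = b}. if bad_site \<kappa> \<rho> ?X (idx s v) then 1 else 0 :: real)
        = (\<Sum>v\<in>{v \<in> P. idx s v = b}. if bad_site \<kappa> \<rho> ?X b then 1 else 0)" by (intro sum.cong) auto
      also have "\<dots> = (if bad_site \<kappa> \<rho> ?X b then real (card {v \<in> P. idx s v = b}) else 0)" by simp
      also have "card {v \<in> P. idx s v = b} \<le> ?X b"
        unfolding cell_count_def using lf bounded_cell[OF s, of b] P'
        by (intro card_mono) (auto simp: locally_finite_set_def cell_def)
      then have "(if bad_site \<kappa> \<rho> ?X b then real (card {v \<in> P. idx s v = b}) else 0)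
        \<le> (if bad_site \<kappa> \<rho> ?X b then real (?X b) else 0)" by simp
      finally show "(\<Sum>v\<in>{v \<in> P. idx s v = b}. if bad_site \<kappa> \<rho> ?X (idx s v) then 1 else 0 :: real)
        \<le> (if bad_site \<kappa> \<rho> ?X b then real (?X b) else 0)" .
    qed
    finally show ?thesis .
  qed
  have "(\<Sum>v\<in>P. f (real (voronoi_degree S v)))
      \<le> (\<Sum>v\<in>P. h 1 + (\<Sum>\<rho>\<in>{1..<T}. if bad_site \<kappa> \<rho> ?X (idx s v) then h (Suc \<rho>) - h \<rho> else 0))"
    by (intro sum_mono pointwise)
  also have "\<dots> = real n * h 1 + (\<Sum>v\<in>P. \<Sum>\<rho>\<in>{1..<T}. (h (Suc \<rho>) - h \<rho>) * (if bad_site \<kappa> \<rho> ?X (idx s v) then 1 else 0))"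
    using P' by (simp add: sum.distrib if_distrib cong: if_cong)
  also have "(\<Sum>v\<in>P. \<Sum>\<rho>\<in>{1..<T}. (h (Suc \<rho>) - h \<rho>) * (if bad_site \<kappa> \<rho> ?X (idx s v) then 1 else 0))
      = (\<Sum>\<rho>\<in>{1..<T}. (h (Suc \<rho>) - h \<rho>) * (\<Sum>v\<in>P. if bad_site \<kappa> \<rho> ?X (idx s v) then 1 else 0))"
    by (subst sum.swap) (simp add: sum_distrib_left)
  also have "\<dots> \<le> (\<Sum>\<rho>\<in>{1..<T}. (h (Suc \<rho>) - h \<rho>) * (C3 * real (\<rho> ^ CARD('d)) *
              (4 * C2 * real m * exp (- real (\<rho> ^ CARD('d)) / (2 * real CARD('d))) + x)))"
  proof (intro sum_mono mult_left_mono)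
    fix \<rho> assume \<rho>: "\<rho> \<in> {1..<T}"
    have "(\<Sum>b\<in>set w. if bad_site \<kappa> \<rho> ?X b then real (?X b) else 0) < C3 * real (\<rho> ^ CARD('d)) *
              (4 * C2 * real m * exp (- real (\<rho> ^ CARD('d)) / (2 * real CARD('d))) + x)"
      using good \<rho> w unfolding good_def by blast
    then show "(\<Sum>v\<in>P. if bad_site \<kappa> \<rho> ?X (idx s v) then 1 else 0) \<le> C3 * real (\<rho> ^ CARD('d)) *
              (4 * C2 * real m * exp (- real (\<rho> ^ CARD('d)) / (2 * real CARD('d))) + x)"
      using count[of \<rho>] by linarith
    show "0 \<le> h (Suc \<rho>) - h \<rho>" using h_mono \<rho> by simp
  qed
  finally show ?thesis by (simp add: h_def)
qed

end

section \<open>Cell counts of a Poisson random set\<close>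

lemma cell_eq:
  assumes "0 < s"
  shows "cell s b = (\<Inter>i. {x. real_of_int (b i) * s \<le> x $ i} \<inter> {x. x $ i < (real_of_int (b i) + 1) * s})"
proof -
  have "\<lfloor>x $ i / s\<rfloor> = b i \<longleftrightarrow> real_of_int (b i) * s \<le> x $ i \<and> x $ i < (real_of_int (b i) + 1) * s" for x i
    unfolding floor_eq_iff using assms by (simp add: field_simps)
  then show ?thesis by (auto simp: cell_def idx_def fun_eq_iff)
qed

lemma cell_borel [measurable]: "0 < s \<Longrightarrow> cell s b \<in> sets borel"
  unfolding cell_eq
  by (intro sets.finite_INT sets.Int borel_closed borel_open closed_Collect_le open_Collect_less continuous_intros) auto

text \<open>The half-open cell lies between an open and a closed box of equal volume.\<close>

lemma emeasure_lebesgue_cell: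
  fixes b :: "'d::finite \<Rightarrow> int"
  assumes s: "0 < s"
  shows "emeasure lebesgue (cell s b) = ennreal (s ^ CARD('d))"
proof -
  define l u where "l = (\<chi> i. real_of_int (b i) * s)" and "u = (\<chi> i. (real_of_int (b i) + 1) * s)"
  have diff: "(u - l) \<bullet> i = s" "l \<bullet> i \<le> u \<bullet> i" if i: "i \<in> Basis" for i
  proof -
    obtain k where k: "i = axis k 1" using i by (auto simp: Basis_vec_def)
    show "(u - l) \<bullet> i = s" unfolding k by (simp add: inner_axis l_def u_def algebra_simps)
    show "l \<bullet> i \<le> u \<bullet> i" unfolding k using s by (simp add: inner_axis l_def u_def algebra_simps)
  qed
  have prod: "(\<Prod>i\<in>Basis. (u - l) \<bullet> i) = s ^ CARD('d)" using diff by simp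
  have meas: "cell s b \<in> sets lborel" using cell_borel[OF s] by simp
  have "box l u \<subseteq> cell s b" "cell s b \<subseteq> cbox l u"
    unfolding cell_eq[OF s] by (auto simp: mem_box_cart l_def u_def less_imp_le)
  then have "emeasure lborel (box l u) \<le> emeasure lborel (cell s b)"
    "emeasure lborel (cell s b) \<le> emeasure lborel (cbox l u)"
    using meas by (auto intro: emeasure_mono)
  moreover have "emeasure lborel (box l u) = ennreal (s ^ CARD('d))"
    "emeasure lborel (cbox l u) = ennreal (s ^ CARD('d))"
    using diff(2) by (simp_all add: emeasure_lborel_box emeasure_lborel_cbox prod)
  ultimately show ?thesis using meas by (simp add: emeasure_completion)
qed

lemma poisson_locally_finite:
  "poisson_random_set M N \<mu> \<Longrightarrow> \<omega> \<in> space M \<Longrightarrow> locally_finite_set (N \<omega>)"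
  by (simp add: poisson_random_set_def locally_finite_set_def)

lemma num_points_cell:
  assumes "locally_finite_set S" "1 \<le> s"
  shows "num_points S (cell s b) = of_nat (cell_count s S b)"
proof -
  have "finite (S \<inter> cell s b)" using assms bounded_cell[of s b] by (simp add: locally_finite_set_def)
  then show ?thesis by (simp add: num_points_def cell_count_def emeasure_count_space_finite)
qed

text \<open>\<open>poisson_random_set\<close> speaks of families indexed by natural numbers, whereas
  cells are indexed by lattice points; an injection on a finite set of cells transfers
  independence.\<close>

lemma (in prob_space) indep_sets_reindex:
  assumes h: "inj_on h B" and F: "indep_sets F (h ` B)"
  shows "indep_sets (\<lambda>b. F (h b)) B"
  unfolding indep_sets_def
proof (intro conjI ballI allI impI)
  fix b assume "b \<in> B"
  then show "F (h b) \<subseteq> events" using F by (auto simp: indep_sets_def)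
next
  fix J A assume J: "J \<subseteq> B" "J \<noteq> {}" "finite J" and A: "A \<in> (\<Pi> b\<in>J. F (h b))"
  define A' where "A' i = A (inv_into B h i)" for i
  have A': "A' (h j) = A j" if "j \<in> J" for j using that J h by (simp add: A'_def subset_iff)
  have inj: "inj_on h J" using h J(1) by (rule inj_on_subset)
  have "A' \<in> Pi (h ` J) F" using A A' by auto
  moreover have "h ` J \<subseteq> h ` B" "h ` J \<noteq> {}" "finite (h ` J)" using J by auto
  ultimately have "prob (\<Inter>i\<in>h ` J. A' i) = (\<Prod>i\<in>h ` J. prob (A' i))"
    using F unfolding indep_sets_def by blast
  moreover have "(\<Inter>i\<in>h ` J. A' i) = (\<Inter>j\<in>J. A j)" using A' by auto
  moreover have "(\<Prod>i\<in>h ` J. prob (A' i)) = (\<Prod>j\<in>J. prob (A j))"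
    using A' by (simp add: prod.reindex[OF inj])
  ultimately show "prob (\<Inter>j\<in>J. A j) = (\<Prod>j\<in>J. prob (A j))" by simp
qed

lemma poisson_indep_cells:
  fixes M :: "'w measure" and N :: "'w \<Rightarrow> (real ^ 'd) set"
  assumes M: "prob_space M" and N: "poisson_random_set M N \<mu>" and s: "1 \<le> s" and B: "finite B"
  shows "prob_space.indep_vars M (\<lambda>_. count_space UNIV) (\<lambda>b \<omega>. cell_count s (N \<omega>) b) B"
proof -
  interpret prob_space M by (rule M)
  obtain h :: "('d \<Rightarrow> int) \<Rightarrow> nat" where h: "inj_on h B"
    using finite_imp_inj_to_nat_seg[OF B] by blast
  define A where "A i = cell s (inv_into B h i)" for i
  have A: "A (h b) = cell s b" if "b \<in> B" for b using that h by (simp add: A_def)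
  have "disjoint_family_on A (h ` B)"
    unfolding disjoint_family_on_def using A by (auto simp: cell_def)
  moreover have "A i \<in> sets borel" for i unfolding A_def using s by (intro cell_borel) simp
  ultimately have "indep_vars (\<lambda>_. borel) (\<lambda>i \<omega>. num_points (N \<omega>) (A i)) (h ` B)"
    using N B unfolding poisson_random_set_def by blast
  \<comment> \<open>The map applied here inverts \<open>of_nat\<close>, so it recovers the cell
    counts.\<close>
  then have "indep_vars (\<lambda>_. count_space UNIV) (\<lambda>i \<omega>. nat \<lfloor>enn2real (num_points (N \<omega>) (A i))\<rfloor>) (h ` B)"
    by (rule indep_vars_compose2) measurable
  note ind = this[unfolded indep_vars_def2]
  have eq: "nat \<lfloor>enn2real (num_points (N \<omega>) (A (h b)))\<rfloor> = cell_count s (N \<omega>) b"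
    if "b \<in> B" "\<omega> \<in> space M" for b \<omega>
    using that A num_points_cell[OF poisson_locally_finite[OF N] s] by (simp add: ennreal_of_nat_eq_real_of_nat)
  show ?thesis
    unfolding indep_vars_def2
  proof
    show "\<forall>b\<in>B. (\<lambda>\<omega>. cell_count s (N \<omega>) b) \<in> measurable M (count_space UNIV)"
    proof
      fix b assume "b \<in> B"
      then have "(\<lambda>\<omega>. nat \<lfloor>enn2real (num_points (N \<omega>) (A (h b)))\<rfloor>) \<in> measurable M (count_space UNIV)"
        using ind by blast
      then show "(\<lambda>\<omega>. cell_count s (N \<omega>) b) \<in> measurable M (count_space UNIV)"
        by (rule measurable_cong[THEN iffD1, rotated]) (rule eq[OF \<open>b \<in> B\<close>])
    qed
    have 1: "indep_sets (\<lambda>b. {(\<lambda>\<omega>. nat \<lfloor>enn2real (num_points (N \<omega>) (A (h b)))\<rfloor>) -` C \<inter> space M |C. C \<in> sets (count_space UNIV)}) B"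
      by (rule indep_sets_reindex[OF h ind[THEN conjunct2]])
    have 2: "(\<lambda>\<omega>. nat \<lfloor>enn2real (num_points (N \<omega>) (A (h b)))\<rfloor>) -` C \<inter> space M
      = (\<lambda>\<omega>. cell_count s (N \<omega>) b) -` C \<inter> space M" if "b \<in> B" for b and C :: "nat set"
      using eq[OF that] by auto
    show "indep_sets (\<lambda>b. {(\<lambda>\<omega>. cell_count s (N \<omega>) b) -` C \<inter> space M |C. C \<in> sets (count_space UNIV)}) B"
      by (rule indep_sets_cong[THEN iffD1, OF refl _ 1]) (simp add: 2)
  qed
qed

lemma poisson_cell_prob:
  assumes N: "poisson_random_set M N \<mu>" and s: "1 \<le> s" and fin: "emeasure \<mu> (cell s b) < \<infinity>"
  shows "measure M {\<omega> \<in> space M. cell_count s (N \<omega>) b = k}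
    = measure \<mu> (cell s b) ^ k / fact k * exp (- measure \<mu> (cell s b))"
proof -
  have eq: "{\<omega> \<in> space M. num_points (N \<omega>) (cell s b) = of_nat k} = {\<omega> \<in> space M. cell_count s (N \<omega>) b = k}"
    using num_points_cell[OF poisson_locally_finite[OF N] s] by auto
  have "cell s b \<in> sets borel" using s by (intro cell_borel) simp
  then have "measure M {\<omega> \<in> space M. num_points (N \<omega>) (cell s b) = of_nat k}
    = measure \<mu> (cell s b) ^ k / fact k * exp (- measure \<mu> (cell s b))"
    using N fin unfolding poisson_random_set_def by blast
  then show ?thesis unfolding eq .
qed

text \<open>The exact value of the moment is exp(l * (e - 1)), and e <= 3.\<close>

lemma poisson_exp_moment:
  fixes X :: "'w \<Rightarrow> nat"
  assumes M: "prob_space M" and X: "X \<in> measurable M (count_space UNIV)" and "0 \<le> l"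
    and P: "\<And>k. measure M {\<omega> \<in> space M. X \<omega> = k} = l ^ k / fact k * exp (- l)"
  shows "(\<integral>\<^sup>+ \<omega>. ennreal (exp (real (X \<omega>))) \<partial>M) \<le> ennreal (exp (2 * l))"
proof -
  interpret prob_space M by (rule M)
  let ?A = "\<lambda>k. {\<omega> \<in> space M. X \<omega> = k}"
  have A: "?A k \<in> events" for k using X by measurable
  have "(\<integral>\<^sup>+ \<omega>. ennreal (exp (real (X \<omega>))) \<partial>M) = (\<integral>\<^sup>+ \<omega>. (\<Sum>k. ennreal (exp (real k)) * indicator (?A k) \<omega>) \<partial>M)"
  proof (rule nn_integral_cong)
    fix \<omega> assume "\<omega> \<in> space M"
    then have "\<omega> \<in> ?A (X \<omega>)" by simp
    moreover have "disjoint_family ?A" by (auto simp: disjoint_family_on_def)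
    ultimately show "ennreal (exp (real (X \<omega>))) = (\<Sum>k. ennreal (exp (real k)) * indicator (?A k) \<omega>)"
      by (intro suminf_cmult_indicator[symmetric])
  qed
  also have "\<dots> = (\<Sum>k. ennreal (exp (real k)) * ennreal (prob (?A k)))"
    using A by (subst nn_integral_suminf) (auto simp: nn_integral_cmult_indicator emeasure_eq_measure)
  also have "\<dots> = (\<Sum>k. ennreal ((l * exp 1) ^ k /\<^sub>R fact k * exp (- l)))"
  proof (intro suminf_cong)
    fix k
    have "exp (real k) = exp 1 ^ k" by (simp flip: exp_of_nat_mult)
    then show "ennreal (exp (real k)) * ennreal (prob (?A k)) = ennreal ((l * exp 1) ^ k /\<^sub>R fact k * exp (- l))"
      using \<open>0 \<le> l\<close> by (simp add: P power_mult_distrib field_simps flip: ennreal_mult)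
  qed
  also have "\<dots> = ennreal (exp (l * exp 1) * exp (- l))"
  proof -
    have "(\<lambda>k. (l * exp 1) ^ k /\<^sub>R fact k * exp (- l)) sums (exp (l * exp 1) * exp (- l))"
      by (intro sums_mult2 exp_converges)
    then show ?thesis using \<open>0 \<le> l\<close> by (subst suminf_ennreal2) (auto simp: sums_iff)
  qed
  also have "\<dots> \<le> ennreal (exp (2 * l))"
  proof -
    have "exp 1 \<le> (3 :: real)" by (rule exp_le)
    then have "l * exp 1 \<le> l * 3" using \<open>0 \<le> l\<close> by (intro mult_left_mono)
    then show ?thesis by (simp flip: exp_add)
  qed
  finally show ?thesis .
qed

lemma poisson_site_process:
  fixes M :: "'w measure" and N :: "'w \<Rightarrow> (real ^ 'd) set" and \<mu> :: "(real ^ 'd) measure"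
  assumes M: "prob_space M" and \<mu>: "comparable_to_lebesgue \<mu>" and N: "poisson_random_set M N \<mu>"
  obtains s \<tau> \<Lambda> where "1 \<le> s" "site_process M (\<lambda>b \<omega>. cell_count s (N \<omega>) b) \<tau> \<Lambda>"
proof -
  interpret prob_space M by (rule M)
  obtain c where c: "0 < c" "\<And>A. A \<in> sets lebesgue \<Longrightarrow> ennreal (1 / c) * emeasure lebesgue A \<le> emeasure \<mu> A"
    "\<And>A. A \<in> sets lebesgue \<Longrightarrow> emeasure \<mu> A \<le> ennreal c * emeasure lebesgue A"
    using \<mu> unfolding comparable_to_lebesgue_def by blast
  define \<tau> where "\<tau> = 2 * (2 * real CARD('d) * ln 3 + 2 * 5 ^ CARD('d) + 1)"
  \<comment> \<open>A cell has \<mu>-measure at least s^d / c >= s / c >= \<tau>, so it is empty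
    with probability at most exp(- \<tau>).\<close>
  define s where "s = max 1 (c * \<tau>)"
  define \<Lambda> where "\<Lambda> = 2 * (c * s ^ CARD('d))"
  have s: "1 \<le> s" by (simp add: s_def)
  have "c * \<tau> \<le> s" by (simp add: s_def)
  also have "s \<le> s ^ CARD('d)" using s by (intro self_le_power) auto
  finally have sd: "\<tau> \<le> s ^ CARD('d) / c" using c by (simp add: field_simps)
  define l where "l b = measure \<mu> (cell s b)" for b :: "'d \<Rightarrow> int"
  have cell: "emeasure \<mu> (cell s b) < \<infinity>" "s ^ CARD('d) / c \<le> l b" "l b \<le> c * s ^ CARD('d)" for b :: "'d \<Rightarrow> int"
  proof -
    have meas: "cell s b \<in> sets lebesgue"
      using cell_borel[of s b] s by (auto intro: sets_completionI_sets)
    have leb: "emeasure lebesgue (cell s b) = ennreal (s ^ CARD('d))"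
      using s by (intro emeasure_lebesgue_cell) simp
    have up: "emeasure \<mu> (cell s b) \<le> ennreal (c * s ^ CARD('d))"
      using c(3)[OF meas] s c(1) unfolding leb by (simp flip: ennreal_mult)
    then show fin: "emeasure \<mu> (cell s b) < \<infinity>" by (simp add: order_le_less_trans)
    then have em: "emeasure \<mu> (cell s b) = ennreal (l b)"
      unfolding l_def by (intro emeasure_eq_ennreal_measure) auto
    show "l b \<le> c * s ^ CARD('d)" using up c(1) s unfolding em by (simp add: ennreal_le_iff)
    have "ennreal (s ^ CARD('d) / c) \<le> ennreal (l b)"
      using c(2)[OF meas] s c(1) unfolding em leb by (simp flip: ennreal_mult)
    then show "s ^ CARD('d) / c \<le> l b" by (simp add: l_def)
  qed
  have P: "prob {\<omega> \<in> space M. cell_count s (N \<omega>) b = k} = l b ^ k / fact k * exp (- l b)" for b k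
    unfolding l_def by (rule poisson_cell_prob[OF N s cell(1)])
  have "site_process M (\<lambda>b \<omega>. cell_count s (N \<omega>) b) \<tau> \<Lambda>"
  proof unfold_locales
    fix B :: "('d \<Rightarrow> int) set" assume "finite B"
    then show "indep_vars (\<lambda>_. count_space UNIV) (\<lambda>b \<omega>. cell_count s (N \<omega>) b) B"
      by (rule poisson_indep_cells[OF M N s])
  next
    fix b :: "'d \<Rightarrow> int"
    have "\<tau> \<le> l b" using sd cell(2)[of b] by linarith
    then show "prob {\<omega> \<in> space M. cell_count s (N \<omega>) b = 0} \<le> exp (- \<tau>)" by (simp add: P)
    have "indep_vars (\<lambda>_. count_space UNIV) (\<lambda>b \<omega>. cell_count s (N \<omega>) b) {b}"
      by (rule poisson_indep_cells[OF M N s]) simp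
    then have "(\<lambda>\<omega>. cell_count s (N \<omega>) b) \<in> measurable M (count_space UNIV)" by (simp add: indep_vars_def)
    then have "(\<integral>\<^sup>+ \<omega>. ennreal (exp (real (cell_count s (N \<omega>) b))) \<partial>M) \<le> ennreal (exp (2 * l b))"
      by (rule poisson_exp_moment[OF M]) (auto simp: P l_def)
    also have "\<dots> \<le> ennreal (exp \<Lambda>)" using cell(3)[of b] by (intro ennreal_leI) (simp add: \<Lambda>_def)
    finally show "(\<integral>\<^sup>+ \<omega>. ennreal (exp (real (cell_count s (N \<omega>) b))) \<partial>M) \<le> ennreal (exp \<Lambda>)" .
  next
    show "2 * (2 * real CARD('d) * ln 3 + 2 * 5 ^ CARD('d) + 1) \<le> \<tau>" by (simp add: \<tau>_def)
    show "0 \<le> \<Lambda>" using c s by (simp add: \<Lambda>_def)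
  qed
  with s show thesis by (rule that)
qed

section \<open>The deviation estimate\<close>

locale voronoi_process = site_process M "\<lambda>b \<omega>. cell_count s (N \<omega>) b" \<tau> \<Lambda>
  for M :: "'w measure" and N :: "'w \<Rightarrow> (real ^ 'd) set" and s \<tau> \<Lambda> +
  fixes \<kappa> :: nat
  assumes s: "1 \<le> s" and lf: "\<And>\<omega>. \<omega> \<in> space M \<Longrightarrow> locally_finite_set (N \<omega>)"
    and \<kappa>: "\<Lambda> * real ((3 * Q) ^ CARD('d)) + 1 \<le> real \<kappa>" and dim: "2 \<le> CARD('d)"
begin

text \<open>Comparison of consecutive scales: \<kappa> * (\<rho> + 1)^d <= \<kappa> * (2\<rho>)^d =
  a * \<rho>^d.\<close>

definition a :: real where "a = real \<kappa> * 2 ^ CARD('d)"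

text \<open>Under \<open>c1\<close>-niceness, x = \<open>f_star f u\<close> satisfies (u / 16)^d <=
  exp(x / (8a)) for large u, and the values of f met at scale \<rho> are at most K * exp(\<rho>^d /
  (16d)).\<close>

definition c1 :: real where "c1 = 32 * real CARD('d) * a"

text \<open>Half of the rate 1 / (2a) common to the three error terms of
  \<open>exceptional_prob_le\<close>; the other half absorbs their constants.\<close>

definition c2 :: real where "c2 = 1 / (4 * a)"

text \<open>The last factor is the sum of the geometric series that dominates the scales in
  \<open>layer_sum_le\<close>.\<close>

definition C4 :: real where
  "C4 = 4 * C2 * C3 * (8 * real CARD('d)) * (1 / (1 - exp (- 1 / (8 * real CARD('d)))))"

lemma \<kappa>_ge_1: "1 \<le> \<kappa>"
proof -
  have "0 \<le> \<Lambda> * real ((3 * Q) ^ CARD('d))" using \<Lambda>_nonneg by simp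
  then have "real 1 \<le> real \<kappa>" using \<kappa> by simp
  then show ?thesis by (simp only: of_nat_le_iff)
qed

lemma a_ge_1: "1 \<le> a"
proof -
  have "1 * 1 \<le> real \<kappa> * 2 ^ CARD('d)" using \<kappa>_ge_1 by (intro mult_mono) auto
  then show ?thesis by (simp add: a_def)
qed

lemma c1_pos: "0 < c1" and c2_pos: "0 < c2"
  using a_ge_1 by (simp_all add: c1_def c2_def)

lemma C4_nonneg: "0 \<le> C4"
  using constants_ge_1 by (simp add: C4_def)

text \<open>T is the last scale whose degree bound \<kappa> * T^d stays below x, and it is at least
  1 because x > \<kappa>. The next scale already reaches x, which gives x <= \<kappa> * (T + 1)^d <=
  a * T^d.\<close>

lemma ex_level:
  assumes "real \<kappa> < x"
  obtains T where "1 \<le> T" "real (\<kappa> * T ^ CARD('d)) < x" "x \<le> a * real (T ^ CARD('d))"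
proof -
  define T' where "T' = (LEAST n. x \<le> real (\<kappa> * n ^ CARD('d)))"
  have "x \<le> real (nat \<lceil>x\<rceil>)" by linarith
  also have "nat \<lceil>x\<rceil> \<le> nat \<lceil>x\<rceil> ^ CARD('d)"
  proof (rule self_le_power)
    have "real 0 < x" using assms by (intro le_less_trans[OF _ assms]) simp
    then show "1 \<le> nat \<lceil>x\<rceil>" by linarith
  qed simp
  also have "\<dots> \<le> \<kappa> * nat \<lceil>x\<rceil> ^ CARD('d)" using \<kappa>_ge_1 by simp
  finally have ex: "x \<le> real (\<kappa> * nat \<lceil>x\<rceil> ^ CARD('d))" by simp
  have T': "x \<le> real (\<kappa> * T' ^ CARD('d))" unfolding T'_def by (rule LeastI[of "\<lambda>n. x \<le> real (\<kappa> * n ^ CARD('d))", OF ex])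
  have "T' \<noteq> 0" using T' assms by (cases "T' = 0") (auto simp: power_0_left)
  moreover have "T' \<noteq> 1" using T' assms by auto
  ultimately obtain T where T: "T' = Suc T" "1 \<le> T" by (cases T') auto
  have "\<not> x \<le> real (\<kappa> * T ^ CARD('d))" using not_less_Least[of T "\<lambda>n. x \<le> real (\<kappa> * n ^ CARD('d))"] T by (simp add: T'_def)
  moreover have "\<kappa> * Suc T ^ CARD('d) \<le> \<kappa> * (2 * T) ^ CARD('d)" using T by (intro mult_left_mono power_mono) auto
  then have "real (\<kappa> * Suc T ^ CARD('d)) \<le> real (\<kappa> * (2 * T) ^ CARD('d))" by (simp only: of_nat_le_iff)
  then have "x \<le> a * real (T ^ CARD('d))" using T' by (simp add: T a_def power_mult_distrib mult.assoc)
  ultimately show thesis using T(2) that by simp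
qed

text \<open>The sum splits into a part proportional to m and a part proportional to x. In the first,
  the decay exp(- \<rho>^d / (2d)) outweighs the increments of f, leaving a geometric series. In the
  second, \<rho>^d is replaced by T^d and the increments telescope to at most x * T^d * f(\<kappa> *
  T^d); as x <= a * T^d, this is at most a multiple of (\<kappa> * T^d)^2 * f(\<kappa> * T^d), hence
  of u.\<close>

lemma layer_sum_le:
  assumes f: "weight_function f" and K: "1 \<le> K" "\<And>y. 1 \<le> y \<Longrightarrow> f y \<le> K * exp (2 * y / c1)"
    and T: "1 \<le> T" "x \<le> a * real (T ^ CARD('d))" "(real (\<kappa> * T ^ CARD('d)))\<^sup>2 * f (real (\<kappa> * T ^ CARD('d))) \<le> u"
    and x: "0 \<le> x"
  shows "(\<Sum>\<rho>\<in>{1..<T}. (f (real (\<kappa> * Suc \<rho> ^ CARD('d))) - f (real (\<kappa> * \<rho> ^ CARD('d)))) *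
        (C3 * real (\<rho> ^ CARD('d)) *
              (4 * C2 * real m * exp (- real (\<rho> ^ CARD('d)) / (2 * real CARD('d))) + x)))
    \<le> K * C4 * real m + C3 * 2 ^ CARD('d) * u"
proof -
  define D where "D = real CARD('d)"
  define l where "l \<rho> = real (\<rho> ^ CARD('d))" for \<rho> :: nat
  define h where "h \<rho> = f (real (\<kappa> * \<rho> ^ CARD('d)))" for \<rho>
  define w where "w = exp (- 1 / (8 * D))"
  have D: "1 \<le> D" using dim by (simp add: D_def)
  have w: "0 < w" "w < 1" using D by (simp_all add: w_def)
  have ge1: "1 \<le> real (\<kappa> * \<rho> ^ CARD('d))" if "1 \<le> \<rho>" for \<rho>
  proof -
    have "1 * 1 \<le> \<kappa> * \<rho> ^ CARD('d)" using \<kappa>_ge_1 that by (intro mult_mono) auto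
    then have "real 1 \<le> real (\<kappa> * \<rho> ^ CARD('d))" by (simp only: of_nat_le_iff)
    then show ?thesis by simp
  qed
  have h1: "1 \<le> h \<rho>" if "1 \<le> \<rho>" for \<rho> unfolding h_def by (rule weight_function_ge_1[OF f ge1[OF that]])
  have h_mono: "h \<rho> \<le> h (Suc \<rho>)" if "1 \<le> \<rho>" for \<rho>
  proof -
    have "\<kappa> * \<rho> ^ CARD('d) \<le> \<kappa> * Suc \<rho> ^ CARD('d)" by (intro mult_left_mono power_mono) auto
    then have "real (\<kappa> * \<rho> ^ CARD('d)) \<le> real (\<kappa> * Suc \<rho> ^ CARD('d))" by (simp only: of_nat_le_iff)
    then show ?thesis unfolding h_def by (intro weight_function_mono[OF f ge1[OF that]])
  qed
  have l: "real \<rho> \<le> l \<rho>" "l \<rho> \<le> l T" if "1 \<le> \<rho>" "\<rho> \<le> T" for \<rho>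
  proof -
    have "\<rho> \<le> \<rho> ^ CARD('d)" using that by (intro self_le_power) auto
    then show "real \<rho> \<le> l \<rho>" unfolding l_def by (simp only: of_nat_le_iff)
    have "\<rho> ^ CARD('d) \<le> T ^ CARD('d)" using that by (intro power_mono) auto
    then show "l \<rho> \<le> l T" unfolding l_def by (simp only: of_nat_le_iff)
  qed
  have l0: "0 \<le> l \<rho>" for \<rho> by (simp add: l_def)
  have level: "(h (Suc \<rho>) - h \<rho>) * (l \<rho> * exp (- l \<rho> / (2 * D))) \<le> K * (8 * D) * w ^ \<rho>"
    if \<rho>: "1 \<le> \<rho>" "\<rho> \<le> T" for \<rho>
  proof -
    have "\<kappa> * Suc \<rho> ^ CARD('d) \<le> \<kappa> * (2 * \<rho>) ^ CARD('d)" using \<rho> by (intro mult_left_mono power_mono) auto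
    then have "real (\<kappa> * Suc \<rho> ^ CARD('d)) \<le> real (\<kappa> * (2 * \<rho>) ^ CARD('d))" by (simp only: of_nat_le_iff)
    then have le: "real (\<kappa> * Suc \<rho> ^ CARD('d)) \<le> a * l \<rho>" by (simp add: a_def l_def power_mult_distrib mult.assoc)
    have "h (Suc \<rho>) \<le> K * exp (2 * real (\<kappa> * Suc \<rho> ^ CARD('d)) / c1)"
      unfolding h_def by (rule K(2)[OF ge1]) simp
    also have "\<dots> \<le> K * exp (l \<rho> / (4 * D))"
    proof -
      have "2 * real (\<kappa> * Suc \<rho> ^ CARD('d)) / c1 \<le> 2 * (a * l \<rho>) / c1"
        using le c1_pos by (intro divide_right_mono mult_left_mono) auto
      also have "\<dots> = l \<rho> / (16 * D)" using a_ge_1 D by (simp add: c1_def D_def field_simps)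
      also have "\<dots> \<le> l \<rho> / (4 * D)" using D l0[of \<rho>] by (intro divide_left_mono) auto
      finally show ?thesis using K(1) by (intro mult_left_mono) auto
    qed
    finally have hS: "h (Suc \<rho>) - h \<rho> \<le> K * exp (l \<rho> / (4 * D))" using h1[OF \<rho>(1)] by linarith
    have "l \<rho> / (8 * D) \<le> exp (l \<rho> / (8 * D))" using exp_ge_add_one_self[of "l \<rho> / (8 * D)"] by linarith
    then have lle: "l \<rho> \<le> 8 * D * exp (l \<rho> / (8 * D))" using D by (simp add: field_simps)
    have "(h (Suc \<rho>) - h \<rho>) * (l \<rho> * exp (- l \<rho> / (2 * D)))
      \<le> (K * exp (l \<rho> / (4 * D))) * (8 * D * exp (l \<rho> / (8 * D)) * exp (- l \<rho> / (2 * D)))"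
      using hS lle l0[of \<rho>] K(1) D by (intro mult_mono mult_right_mono) auto
    also have "\<dots> = K * (8 * D) * (exp (l \<rho> / (4 * D)) * exp (l \<rho> / (8 * D)) * exp (- l \<rho> / (2 * D)))"
      by (simp only: mult_ac)
    \<comment> \<open>In units of l / D: 1/4 is granted to the growth of f and 1/8 to the factor
      \<open>l \<rho>\<close>; subtracting the decay 1/2 leaves - 1/8.\<close>
    also have "exp (l \<rho> / (4 * D)) * exp (l \<rho> / (8 * D)) * exp (- l \<rho> / (2 * D)) = exp (- (l \<rho> / (8 * D)))"
      using D by (simp add: field_simps flip: exp_add)
    also have "\<dots> \<le> exp (- (real \<rho> / (8 * D)))"
      using l(1)[OF \<rho>] D by (simp add: divide_right_mono)
    also have "exp (- (real \<rho> / (8 * D))) = w ^ \<rho>" unfolding w_def by (simp flip: exp_of_nat_mult)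
    finally show ?thesis using K(1) D by (simp add: mult_left_mono)
  qed
  have geom: "(\<Sum>\<rho>\<in>{1..<T}. w ^ \<rho>) \<le> 1 / (1 - w)"
  proof -
    have "(\<Sum>\<rho>\<in>{1..<T}. w ^ \<rho>) \<le> (\<Sum>\<rho><T. w ^ \<rho>)" using w by (intro sum_mono2) auto
    also have "\<dots> = (1 - w ^ T) / (1 - w)" using w by (simp add: sum_gp_strict)
    also have "\<dots> \<le> 1 / (1 - w)" using w by (intro divide_right_mono) auto
    finally show ?thesis .
  qed
  have "(\<Sum>\<rho>\<in>{1..<T}. (h (Suc \<rho>) - h \<rho>) * (C3 * l \<rho> * (4 * C2 * real m * exp (- l \<rho> / (2 * D)) + x)))
    = 4 * C2 * C3 * real m * (\<Sum>\<rho>\<in>{1..<T}. (h (Suc \<rho>) - h \<rho>) * (l \<rho> * exp (- l \<rho> / (2 * D))))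
      + C3 * x * (\<Sum>\<rho>\<in>{1..<T}. (h (Suc \<rho>) - h \<rho>) * l \<rho>)"
    by (simp add: sum_distrib_left sum.distrib[symmetric] algebra_simps)
  also have "\<dots> \<le> 4 * C2 * C3 * real m * (K * (8 * D) * (1 / (1 - w))) + C3 * 2 ^ CARD('d) * u"
  proof (rule add_mono)
    have "(\<Sum>\<rho>\<in>{1..<T}. (h (Suc \<rho>) - h \<rho>) * (l \<rho> * exp (- l \<rho> / (2 * D)))) \<le> (\<Sum>\<rho>\<in>{1..<T}. K * (8 * D) * w ^ \<rho>)"
      by (intro sum_mono level) auto
    also have "\<dots> \<le> K * (8 * D) * (1 / (1 - w))"
      unfolding sum_distrib_left[symmetric] using geom K(1) D by (intro mult_left_mono) auto
    finally show "4 * C2 * C3 * real m * (\<Sum>\<rho>\<in>{1..<T}. (h (Suc \<rho>) - h \<rho>) * (l \<rho> * exp (- l \<rho> / (2 * D))))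
      \<le> 4 * C2 * C3 * real m * (K * (8 * D) * (1 / (1 - w)))"
      using constants_ge_1 by (intro mult_left_mono) auto
    have "(\<Sum>\<rho>\<in>{1..<T}. (h (Suc \<rho>) - h \<rho>) * l \<rho>) \<le> (\<Sum>\<rho>\<in>{1..<T}. (h (Suc \<rho>) - h \<rho>) * l T)"
      using h_mono l by (intro sum_mono mult_left_mono) auto
    also have "\<dots> = (h T - h 1) * l T" using T(1) by (simp add: sum_distrib_right[symmetric] sum_Suc_diff')
    also have "\<dots> \<le> h T * l T" using h1[of 1] l0[of T] by (intro mult_right_mono) auto
    finally have "C3 * x * (\<Sum>\<rho>\<in>{1..<T}. (h (Suc \<rho>) - h \<rho>) * l \<rho>) \<le> C3 * x * (h T * l T)"
      using constants_ge_1 x by (intro mult_left_mono) auto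
    also have "\<dots> \<le> C3 * (a * l T) * (h T * l T)"
      using constants_ge_1 T(2) h1[OF T(1)] l0[of T] by (intro mult_right_mono mult_left_mono) (auto simp: l_def)
    also have "\<dots> = C3 * 2 ^ CARD('d) * (real \<kappa> * l T * l T * h T)" by (simp add: a_def)
    also have "\<dots> \<le> C3 * 2 ^ CARD('d) * u"
    proof (rule mult_left_mono)
      have "real \<kappa> * 1 \<le> real \<kappa> * real \<kappa>" using \<kappa>_ge_1 by (intro mult_left_mono) auto
      then have "real \<kappa> * (l T * l T * h T) \<le> real \<kappa> * real \<kappa> * (l T * l T * h T)"
        using l0[of T] h1[OF T(1)] by (intro mult_right_mono) auto
      also have "\<dots> = (real (\<kappa> * T ^ CARD('d)))\<^sup>2 * h T" by (simp add: l_def power2_eq_square)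
      also have "\<dots> \<le> u" using T(3) by (simp add: h_def)
      finally show "real \<kappa> * l T * l T * h T \<le> u" by (simp add: mult.assoc)
    qed (use constants_ge_1 in auto)
    finally show "C3 * x * (\<Sum>\<rho>\<in>{1..<T}. (h (Suc \<rho>) - h \<rho>) * l \<rho>) \<le> C3 * 2 ^ CARD('d) * u" .
  qed
  also have "4 * C2 * C3 * real m * (K * (8 * D) * (1 / (1 - w))) = K * C4 * real m"
    by (simp add: C4_def D_def w_def)
  finally show ?thesis unfolding h_def l_def D_def .
qed

lemma good_degree_ge_3:
  assumes \<omega>: "locally_finite_set S" and "1 \<le> m" "1 \<le> T"
    and good: "good \<kappa> m T x (cell_count s S)"
    and P: "P \<in> polyominoes n S" and n: "2 * real (n * (2 * CARD('d) + 1) ^ CARD('d)) \<le> real m"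
    and v: "v \<in> P"
  shows "3 \<le> voronoi_degree S v"
proof -
  obtain w where w: "walk w" "length w \<le> 2 * m" "idx s ` P \<subseteq> set w"
    using good_polyomino_walk[OF \<omega> s assms(2) good P n] by blast
  have "set w \<subseteq> cube (\<lambda>_. 0) (2 * m)" using walk_subset_cube[OF w(1)] w(2) by simp
  then have "idx s v \<in> cube (\<lambda>_. 0) (2 * m)" using w(3) v by blast
  then have nb: "\<not> bad_site \<kappa> T (cell_count s S) (idx s v)" using good unfolding good_def by blast
  have "v \<in> S" using P v by (auto simp: polyominoes_def)
  then show ?thesis by (rule not_bad_site_degree(1)[OF \<omega> s assms(3) _ dim nb])
qed

text \<open>Each term is at most a constant times exp(- x / (2a)): the first because x <= sqrt u <=
  m, the second because T <= x, the third because T^d >= x / a while m^d is at most a multiple of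
  exp(x / (8a)). By \<open>large\<close>, exp(x / (4a)) absorbs the constants.\<close>

lemma exceptional_prob_le:
  assumes u: "1 \<le> u" and x: "0 \<le> x" "x \<le> sqrt u" "c1 / 4 * ln (u / 16) \<le> x"
    and T: "real T \<le> x" "x \<le> a * real (T ^ CARD('d))"
    and large: "4 * a * ln (1 + 2 * exp C2 + C0 * 160 ^ CARD('d)) \<le> x"
    and m: "u \<le> real m" "real m \<le> 2 * u"
  shows "exp (- real m) + real T * exp (C2 - x) + C0 * (5 * real m) ^ CARD('d) * exp (- real (T ^ CARD('d)))
    \<le> exp (- c2 * x)"
proof -
  define B where "B = 1 + 2 * exp C2 + C0 * 160 ^ CARD('d)"
  have B: "1 \<le> B" using constants_ge_1 by (simp add: B_def)
  define e where "e = exp (- (x / (2 * a)))"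
  have xa: "x / (2 * a) \<le> x / 2" using a_ge_1 x(1) by (intro divide_left_mono) auto
  have "1 * u \<le> u * u" using u by (intro mult_right_mono) auto
  then have "sqrt u \<le> u" using u by (intro real_le_lsqrt) (auto simp: power2_eq_square)
  then have "x \<le> real m" using x m by linarith
  then have 1: "exp (- real m) \<le> e" using xa x(1) by (simp add: e_def)
  have "x / 2 \<le> exp (x / 2)" using exp_ge_add_one_self[of "x / 2"] by linarith
  then have "real T \<le> 2 * exp (x / 2)" using T(1) by linarith
  then have "real T * exp (C2 - x) \<le> 2 * exp (x / 2) * exp (C2 - x)" by (intro mult_right_mono) auto
  also have "\<dots> = 2 * exp C2 * exp (- (x / 2))" by (simp add: mult.assoc flip: exp_add)
  also have "\<dots> \<le> 2 * exp C2 * e" using xa by (intro mult_left_mono) (auto simp: e_def)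
  finally have 2: "real T * exp (C2 - x) \<le> 2 * exp C2 * e" .
  have "ln (u / 16) \<le> 4 * x / c1" using x(3) c1_pos by (simp add: field_simps)
  then have "u / 16 \<le> exp (4 * x / c1)" using u by (subst ln_le_cancel_iff[symmetric]) auto
  then have "(u / 16) ^ CARD('d) \<le> exp (4 * x / c1) ^ CARD('d)" using u by (intro power_mono) auto
  also have "\<dots> = exp (real CARD('d) * (4 * x / c1))" by (rule exp_of_nat_mult[symmetric])
  also have "real CARD('d) * (4 * x / c1) = x / (8 * a)" using a_ge_1 by (simp add: c1_def field_simps)
  finally have ud: "(u / 16) ^ CARD('d) \<le> exp (x / (8 * a))" .
  \<comment> \<open>From m <= 2u, as 5 * 2 * 16 = 160.\<close>
  have "(5 * real m) ^ CARD('d) \<le> (160 * (u / 16)) ^ CARD('d)" using m by (intro power_mono) auto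
  also have "\<dots> = 160 ^ CARD('d) * (u / 16) ^ CARD('d)" by (rule power_mult_distrib)
  also have "\<dots> \<le> 160 ^ CARD('d) * exp (x / (8 * a))" using ud by (intro mult_left_mono) auto
  finally have md: "(5 * real m) ^ CARD('d) \<le> 160 ^ CARD('d) * exp (x / (8 * a))" .
  have "x / a \<le> real (T ^ CARD('d))" using T(2) a_ge_1 by (simp add: field_simps)
  then have "C0 * (5 * real m) ^ CARD('d) * exp (- real (T ^ CARD('d)))
    \<le> C0 * (160 ^ CARD('d) * exp (x / (8 * a))) * exp (- (x / a))"
    using md constants_ge_1 by (intro mult_mono mult_left_mono) auto
  also have "\<dots> = C0 * 160 ^ CARD('d) * exp (x / (8 * a) - x / a)" by (simp add: mult.assoc flip: exp_add)
  also have "\<dots> \<le> C0 * 160 ^ CARD('d) * e"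
  proof -
    have "x / (8 * a) - x / a \<le> - (x / (2 * a))" using a_ge_1 x(1) by (simp add: field_simps)
    then show ?thesis unfolding e_def using constants_ge_1 by (intro mult_left_mono) auto
  qed
  finally have 3: "C0 * (5 * real m) ^ CARD('d) * exp (- real (T ^ CARD('d))) \<le> C0 * 160 ^ CARD('d) * e" .
  have "exp (- real m) + real T * exp (C2 - x) + C0 * (5 * real m) ^ CARD('d) * exp (- real (T ^ CARD('d))) \<le> B * e"
    using 1 2 3 unfolding B_def by (simp only: distrib_right)
  also have "B * e \<le> exp (x / (4 * a)) * e"
  proof (rule mult_right_mono)
    have "ln B \<le> x / (4 * a)" using large a_ge_1 by (simp add: B_def field_simps)
    then show "B \<le> exp (x / (4 * a))" using B by (subst ln_le_cancel_iff[symmetric]) auto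
  qed (simp add: e_def)
  also have "\<dots> = exp (- c2 * x)" using a_ge_1 by (simp add: e_def c2_def field_simps flip: exp_add)
  finally show ?thesis .
qed

text \<open>The conclusions on c3 * z1 and on the growth of \<open>f_star\<close> are recorded for
  \<open>greedy_weight_mean_le\<close>, where they make the deviation bounds summable.\<close>

lemma greedy_weight_deviation:
  assumes f: "weight_function f" and nice: "nice c1 f"
  obtains z1 c3 where "0 < z1" "0 < c3" "16 \<le> c3 * z1"
    "\<And>u. c3 * z1 \<le> u \<Longrightarrow> c1 / 4 * ln (u / 16) \<le> f_star f u"
    "\<And>n z. 1 \<le> n \<Longrightarrow> z1 \<le> z \<Longrightarrow> \<exists>E\<in>events. prob E \<le> exp (- c2 * f_star f (c3 * real n * z)) \<and>
      (\<forall>\<omega>\<in>space M - E. greedy_weight n f (N \<omega>) \<le> ennreal (real n * z))"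
proof -
  obtain K where K: "1 \<le> K" "\<And>x. 1 \<le> x \<Longrightarrow> f x \<le> K * exp (2 * x / c1)"
    using nice_imp_exp_bound[OF f nice c1_pos] by blast
  obtain U where U: "1 < U" "\<And>u. U \<le> u \<Longrightarrow> c1 / 4 * ln (u / 16) \<le> f_star f u"
    using nice_imp_f_star_ge[OF f nice c1_pos] by blast
  define x0 where "x0 = max (real \<kappa> + 1) (4 * a * ln (1 + 2 * exp C2 + C0 * 160 ^ CARD('d)))"
  \<comment> \<open>Solves c1 / 4 * ln (U' / 16) = x0, so that \<open>f_star f u\<close> is at least
    x0 once u reaches both U and U'.\<close>
  define U' where "U' = 16 * exp (4 * x0 / c1)"
  define W where "W = 2 * K * C4 + C3 * 2 ^ CARD('d)"
  \<comment> \<open>With u = c3 * n * z, the bad layers contribute at most W * u = n * z / 2; the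
    other half of n * z pays for n * f(\<kappa>).\<close>
  define c3 where "c3 = 1 / (2 * W)"
  define V where "V = real ((2 * CARD('d) + 1) ^ CARD('d))"
  \<comment> \<open>The entries ensure, in order: f(\<kappa>) <= z / 2; m is at least twice the
    bound n * V for the nonempty cells met by a polyomino; the logarithmic lower bound for
    \<open>f_star\<close> applies; \<open>f_star f u\<close> is at least x0.\<close>
  define z1 where "z1 = max (2 * f (real \<kappa>)) (max (2 * V / c3) (max (U / c3) (U' / c3)))"
  have x0: "1 \<le> x0" by (simp add: x0_def)
  have "1 \<le> C3 * 2 ^ CARD('d)" using mult_mono[of 1 C3 1 "2 ^ CARD('d)"] constants_ge_1 by simp
  moreover have "0 \<le> 2 * K * C4" using K(1) C4_nonneg by simp
  ultimately have W: "1 \<le> W" by (simp add: W_def)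
  then have c3: "0 < c3" by (simp add: c3_def)
  have k1: "1 \<le> real \<kappa>" using \<kappa>_ge_1 by simp
  have "1 \<le> f (real \<kappa>)" by (rule weight_function_ge_1[OF f k1])
  then have z1: "0 < z1" "2 * f (real \<kappa>) \<le> z1" by (auto simp: z1_def)
  have z1c: "2 * V \<le> c3 * z1" "U \<le> c3 * z1" "U' \<le> c3 * z1"
    using c3 by (simp_all add: z1_def max_mult_distrib_left)
  have U'16: "16 \<le> U'" using x0 c1_pos by (simp add: U'_def)
  have fstar_large: "x0 \<le> f_star f u" if "c3 * z1 \<le> u" for u
  proof -
    have "U' \<le> u" "U \<le> u" using that z1c by linarith+
    then have "exp (4 * x0 / c1) \<le> u / 16" by (simp add: U'_def)
    then have "4 * x0 / c1 \<le> ln (u / 16)" by (subst ln_ge_iff) (use \<open>U \<le> u\<close> U in auto)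
    then have "c1 / 4 * (4 * x0 / c1) \<le> c1 / 4 * ln (u / 16)" using c1_pos by (intro mult_left_mono) auto
    also have "\<dots> \<le> f_star f u" by (rule U(2)[OF \<open>U \<le> u\<close>])
    finally show ?thesis using c1_pos by simp
  qed
  show thesis
  proof (rule that[OF z1(1) c3])
    show "16 \<le> c3 * z1" using U'16 z1c by linarith
    show "c1 / 4 * ln (u / 16) \<le> f_star f u" if "c3 * z1 \<le> u" for u using U(2) that z1c by simp
  next
    fix n :: nat and z :: real assume n: "1 \<le> n" and z: "z1 \<le> z"
    define u where "u = c3 * real n * z"
    define x where "x = f_star f u"
    define m where "m = nat \<lceil>u\<rceil>"
    have "c3 * z1 \<le> c3 * z" using c3 z by (intro mult_left_mono) auto
    then have cz: "2 * V \<le> c3 * z" using z1c by linarith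
    have "1 * (c3 * z1) \<le> real n * (c3 * z)"
      using n \<open>c3 * z1 \<le> c3 * z\<close> c3 z1 by (intro mult_mono) auto
    then have uz: "c3 * z1 \<le> u" by (simp add: u_def mult_ac)
    then have u1: "1 < u" using z1c U by linarith
    have x: "x0 \<le> x" unfolding x_def by (rule fstar_large[OF uz])
    have "real \<kappa> < x" using x by (simp add: x0_def)
    then obtain T where T: "1 \<le> T" "real (\<kappa> * T ^ CARD('d)) < x" "x \<le> a * real (T ^ CARD('d))"
      by (rule ex_level)
    have m: "u \<le> real m" "real m \<le> 2 * u" "1 \<le> m" using u1 unfolding m_def by linarith+
    have "2 * V * real n \<le> c3 * z * real n" using cz by (intro mult_right_mono) auto
    then have nm: "2 * real (n * (2 * CARD('d) + 1) ^ CARD('d)) \<le> real m"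
      using m(1) by (simp add: V_def u_def mult_ac)
    have "T \<le> T ^ CARD('d)" using T(1) by (intro self_le_power) auto
    also have "\<dots> \<le> \<kappa> * T ^ CARD('d)" using \<kappa>_ge_1 by simp
    finally have "real T \<le> real (\<kappa> * T ^ CARD('d))" by (simp only: of_nat_le_iff)
    then have Tx: "real T \<le> x" using T(2) by linarith
    have kT: "1 \<le> real (\<kappa> * T ^ CARD('d))"
    proof -
      have "real 1 \<le> real T" using T(1) by (simp only: of_nat_le_iff)
      then show ?thesis using \<open>real T \<le> real (\<kappa> * T ^ CARD('d))\<close> by simp
    qed
    have sq: "(real (\<kappa> * T ^ CARD('d)))\<^sup>2 * f (real (\<kappa> * T ^ CARD('d))) \<le> u"
      by (rule less_f_starD[OF f u1 kT T(2)[unfolded x_def]])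
    have x0': "0 \<le> x" using x x0 by linarith
    obtain E where E: "E \<in> events" "prob E \<le> exp (- real m) + real T * exp (C2 - x)
      + C0 * (5 * real m) ^ CARD('d) * exp (- real (T ^ CARD('d)))"
      "\<And>\<omega>. \<omega> \<in> space M - E \<Longrightarrow> good \<kappa> m T x (\<lambda>b. cell_count s (N \<omega>) b)"
      using prob_good[OF \<kappa> m(3) T(1) x0'] by blast
    have "prob E \<le> exp (- c2 * x)"
    proof (rule order_trans[OF E(2)], rule exceptional_prob_le[of u])
      show "x \<le> sqrt u" unfolding x_def by (rule f_star_le_sqrt[OF f u1])
      show "c1 / 4 * ln (u / 16) \<le> x" unfolding x_def using U(2) uz z1c by simp
      show "4 * a * ln (1 + 2 * exp C2 + C0 * 160 ^ CARD('d)) \<le> x" using x by (simp add: x0_def)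
    qed (use u1 x0' Tx T m in auto)
    moreover have "greedy_weight n f (N \<omega>) \<le> ennreal (real n * z)" if \<omega>: "\<omega> \<in> space M - E" for \<omega>
      unfolding greedy_weight_def
    proof (rule SUP_least)
      fix P assume P: "P \<in> polyominoes n (N \<omega>)"
      have lf': "locally_finite_set (N \<omega>)" using lf \<omega> by blast
      have good: "good \<kappa> m T x (cell_count s (N \<omega>))" using E(3)[OF \<omega>] by simp
      have deg: "1 \<le> real (voronoi_degree (N \<omega>) v)" if "v \<in> P" for v
        using good_degree_ge_3[OF lf' m(3) T(1) good P nm that] by simp
      have "(\<Sum>v\<in>P. f (real (voronoi_degree (N \<omega>) v))) \<le> real n * f (real \<kappa>) + (K * C4 * real m + C3 * 2 ^ CARD('d) * u)"
        using good_sum_le[OF lf' s dim m(3) T(1) \<kappa>_ge_1 f good P nm]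
          layer_sum_le[OF f K T(1) T(3) sq x0', of m] by linarith
      also have "\<dots> \<le> real n * (z / 2) + W * u"
      proof (rule add_mono)
        show "real n * f (real \<kappa>) \<le> real n * (z / 2)" using z1(2) z by (intro mult_left_mono) auto
        have "K * C4 * real m \<le> K * C4 * (2 * u)" using m(2) K(1) C4_nonneg by (intro mult_left_mono) auto
        then show "K * C4 * real m + C3 * 2 ^ CARD('d) * u \<le> W * u" by (simp add: W_def algebra_simps)
      qed
      also have "W * u = real n * (z / 2)" using W by (simp add: u_def c3_def)
      also have "real n * (z / 2) + real n * (z / 2) = real n * z" by (simp add: field_simps)
      finally have "(\<Sum>v\<in>P. f (real (voronoi_degree (N \<omega>) v))) \<le> real n * z" .
      moreover have "(\<Sum>v\<in>P. ennreal (f (real (voronoi_degree (N \<omega>) v)))) = ennreal (\<Sum>v\<in>P. f (real (voronoi_degree (N \<omega>) v)))"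
        using weight_function_ge_1[OF f deg] by (intro sum_ennreal) force
      ultimately show "(\<Sum>v\<in>P. ennreal (f (real (voronoi_degree (N \<omega>) v)))) \<le> ennreal (real n * z)"
        by (simp add: ennreal_leI)
    qed
    ultimately show "\<exists>E\<in>events. prob E \<le> exp (- c2 * f_star f (c3 * real n * z)) \<and>
      (\<forall>\<omega>\<in>space M - E. greedy_weight n f (N \<omega>) \<le> ennreal (real n * z))"
      using E(1) unfolding x_def u_def by blast
  qed
qed

text \<open>Deviations at the dyadic thresholds 2^k * z1. Since c2 * c1 / 4 = 2d, the event E k has
  probability at most 4^(-k), while its contribution to the majorant is 2 * 2^k * z1; these sum to 4
  * z1. The majorant \<open>ennreal z1 + ?S \<omega>\<close> is measurable and can be integrated
  term by term.\<close>

lemma greedy_weight_mean_le: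
  assumes f: "weight_function f" and nice: "nice c1 f"
  obtains C where "0 < C" "\<And>n. 1 \<le> n \<Longrightarrow> (\<integral>\<^sup>+ \<omega>. greedy_weight n f (N \<omega>) / of_nat n \<partial>M) \<le> ennreal C"
proof -
  obtain z1 c3 where z1: "0 < z1" "0 < c3" "16 \<le> c3 * z1"
    and low: "\<And>u. c3 * z1 \<le> u \<Longrightarrow> c1 / 4 * ln (u / 16) \<le> f_star f u"
    and dev: "\<And>n z. 1 \<le> n \<Longrightarrow> z1 \<le> z \<Longrightarrow> \<exists>E\<in>events. prob E \<le> exp (- c2 * f_star f (c3 * real n * z)) \<and>
      (\<forall>\<omega>\<in>space M - E. greedy_weight n f (N \<omega>) \<le> ennreal (real n * z))"
    using greedy_weight_deviation[OF f nice] by blast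
  show thesis
  proof (rule that[of "5 * z1"])
    fix n :: nat assume n: "1 \<le> n"
    let ?z = "\<lambda>k. 2 ^ k * z1"
    have zk: "z1 \<le> ?z k" for k using z1 by simp
    have "\<exists>E. \<forall>k. E k \<in> events \<and> prob (E k) \<le> exp (- c2 * f_star f (c3 * real n * ?z k)) \<and>
      (\<forall>\<omega>\<in>space M - E k. greedy_weight n f (N \<omega>) \<le> ennreal (real n * ?z k))"
      using dev[OF n zk] by (intro choice allI) (simp only: Bex_def)
    then obtain E where E: "\<And>k. E k \<in> events" "\<And>k. prob (E k) \<le> exp (- c2 * f_star f (c3 * real n * ?z k))"
      "\<And>k \<omega>. \<omega> \<in> space M - E k \<Longrightarrow> greedy_weight n f (N \<omega>) \<le> ennreal (real n * ?z k)"
      by blast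
    have PE: "prob (E k) \<le> (1 / 4) ^ k" for k
    proof -
      define u where "u = c3 * real n * ?z k"
      have "c3 * z1 * 2 ^ k * 1 \<le> c3 * z1 * 2 ^ k * real n" using z1 n by (intro mult_left_mono) auto
      then have le: "c3 * z1 * 2 ^ k \<le> u" by (simp add: u_def mult_ac)
      have "16 * 2 ^ k \<le> c3 * z1 * 2 ^ k" using z1 by (intro mult_right_mono) auto
      then have u16: "2 ^ k \<le> u / 16" using le by linarith
      have "c3 * z1 * 1 \<le> c3 * z1 * 2 ^ k" using z1 by (intro mult_left_mono) auto
      then have "c1 / 4 * ln (u / 16) \<le> f_star f u" using low le by simp
      then have "c2 * (c1 / 4 * ln (u / 16)) \<le> c2 * f_star f u" using c2_pos by (intro mult_left_mono) auto
      moreover have "c2 * (c1 / 4 * ln (u / 16)) = 2 * real CARD('d) * ln (u / 16)"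
        using a_ge_1 by (simp add: c1_def c2_def field_simps)
      moreover have "(1::real) \<le> 2 ^ k" by simp
      then have "1 \<le> u / 16" using u16 by linarith
      then have "2 * ln (u / 16) \<le> 2 * real CARD('d) * ln (u / 16)" by (intro mult_right_mono) (auto simp: Suc_le_eq)
      moreover have "ln (2 ^ k) \<le> ln (u / 16)" using u16 by (intro ln_mono) auto
      ultimately have "- c2 * f_star f u \<le> - (2 * ln (2 ^ k))" by linarith
      then have "exp (- c2 * f_star f u) \<le> exp (- (2 * ln (2 ^ k)))" by (simp only: exp_le_cancel_iff)
      also have "\<dots> = (1 / 4) ^ k"
      proof -
        have "exp (2 * ln (2 ^ k)) = (2 ^ k :: real) ^ 2" by (simp add: exp_double)
        also have "\<dots> = (2 ^ 2) ^ k" unfolding power_mult[symmetric] by (simp only: mult.commute)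
        also have "\<dots> = 4 ^ k" by simp
        finally show ?thesis by (simp add: exp_minus power_one_over inverse_eq_divide)
      qed
      finally show ?thesis using E(2)[of k] by (simp add: u_def)
    qed
    let ?S = "\<lambda>\<omega>. \<Sum>k. ennreal (2 * ?z k) * indicator (E k) \<omega>"
    have bound: "greedy_weight n f (N \<omega>) / of_nat n \<le> ennreal z1 + ?S \<omega>" if \<omega>: "\<omega> \<in> space M" for \<omega>
    proof -
      have div: "greedy_weight n f (N \<omega>) / of_nat n \<le> ennreal (?z k)" if "\<omega> \<notin> E k" for k
      proof -
        have "greedy_weight n f (N \<omega>) / of_nat n \<le> ennreal (real n * ?z k) / of_nat n"
          using E(3) \<omega> that by (intro divide_right_mono_ennreal) auto
        also have "\<dots> = ennreal (real n * ?z k / real n)"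
          unfolding ennreal_of_nat_eq_real_of_nat using n z1 by (intro divide_ennreal) auto
        also have "\<dots> = ennreal (?z k)" using n by simp
        finally show ?thesis .
      qed
      have tail: "ennreal (2 * ?z k) \<le> ?S \<omega>" if "\<omega> \<in> E k" for k
      proof -
        have "(\<Sum>k\<in>{k}. ennreal (2 * ?z k) * indicator (E k) \<omega>) \<le> ?S \<omega>" by (rule sum_le_suminf) auto
        then show ?thesis using that by simp
      qed
      show ?thesis
      proof (cases "\<exists>k. \<omega> \<notin> E k")
        case True
        \<comment> \<open>For the least such k = j + 1, the point lies in E j, whose term 2 * 2^j *
          z1 is exactly the bound 2^k * z1 valid outside E k.\<close>
        define k where "k = (LEAST k. \<omega> \<notin> E k)"
        have k: "\<omega> \<notin> E k" unfolding k_def using True by (rule LeastI_ex)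
        show ?thesis
        proof (cases k)
          case 0
          then show ?thesis using div[OF k] by (simp add: add_increasing2)
        next
          case (Suc j)
          then have "\<omega> \<in> E j" using not_less_Least[of j "\<lambda>k. \<omega> \<notin> E k"] by (auto simp: k_def)
          then have "ennreal (?z k) \<le> ?S \<omega>" using tail[of j] Suc by (simp add: mult.assoc)
          then show ?thesis using div[OF k] by (meson add_increasing zero_le order_trans)
        qed
      next
        case False
        have "?S \<omega> = top"
        proof (rule ccontr)
          assume "?S \<omega> \<noteq> top"
          then obtain r where r: "0 \<le> r" "?S \<omega> = ennreal r" by (cases "?S \<omega>") auto
          obtain k where "r / z1 < 2 ^ k" using real_arch_pow[of 2 "r / z1"] by auto
          then have "r < ?z k" using z1 by (simp add: field_simps)
          moreover have "ennreal (2 * ?z k) \<le> ennreal r" using tail[of k] False r by simp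
          then have "2 * ?z k \<le> r" using r by simp
          ultimately show False using zk[of k] z1 by linarith
        qed
        then show ?thesis by simp
      qed
    qed
    have "(\<integral>\<^sup>+ \<omega>. greedy_weight n f (N \<omega>) / of_nat n \<partial>M) \<le> (\<integral>\<^sup>+ \<omega>. ennreal z1 + ?S \<omega> \<partial>M)"
      by (intro nn_integral_mono bound)
    also have "\<dots> = ennreal z1 + (\<Sum>k. ennreal (2 * ?z k) * ennreal (prob (E k)))"
      using E(1) by (simp add: nn_integral_add nn_integral_suminf nn_integral_cmult_indicator emeasure_eq_measure prob_space)
    also have "(\<Sum>k. ennreal (2 * ?z k) * ennreal (prob (E k))) \<le> (\<Sum>k. ennreal (2 * z1 * (1 / 2) ^ k))"
    proof (intro suminf_le allI)
      fix k
      have "2 * ?z k * prob (E k) \<le> 2 * ?z k * (1 / 4) ^ k" using PE z1 by (intro mult_left_mono) auto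
      also have "\<dots> = 2 * z1 * (2 * (1 / 4)) ^ k" by (simp only: power_mult_distrib mult_ac)
      finally have "2 * ?z k * prob (E k) \<le> 2 * z1 * (1 / 2) ^ k" by simp
      then show "ennreal (2 * ?z k) * ennreal (prob (E k)) \<le> ennreal (2 * z1 * (1 / 2) ^ k)"
        using z1 by (simp flip: ennreal_mult add: ennreal_leI)
    qed auto
    also have "(\<Sum>k. ennreal (2 * z1 * (1 / 2) ^ k)) = ennreal (2 * z1 * 2)"
    proof -
      have "(\<lambda>k. 2 * z1 * (1 / 2) ^ k) sums (2 * z1 * 2)"
        using geometric_sums[of "1 / 2 :: real"] by (intro sums_mult) simp
      then show ?thesis using z1 by (subst suminf_ennreal2) (auto simp: sums_iff)
    qed
    also have "ennreal z1 + ennreal (2 * z1 * 2) = ennreal (5 * z1)" using z1 by (simp flip: ennreal_plus)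
    finally show "(\<integral>\<^sup>+ \<omega>. greedy_weight n f (N \<omega>) / of_nat n \<partial>M) \<le> ennreal (5 * z1)"
      by (simp add: add_left_mono)
  qed (use z1 in simp)
qed

text \<open>Almost surely there is a polyomino of size n, and its tiles are bounded polytopes in
  dimension at least 2, so each has at least three facets.\<close>

lemma greedy_weight_mean_ge:
  assumes f: "weight_function f" and n: "1 \<le> n"
  shows "ennreal (f 3) \<le> (\<integral>\<^sup>+ \<omega>. greedy_weight n f (N \<omega>) / of_nat n \<partial>M)"
proof -
  have "AE \<omega> in M. ennreal (f 3) \<le> greedy_weight n f (N \<omega>) / of_nat n"
    using AE_not_bad_site[OF \<kappa>] AE_space
  proof eventually_elim
    case (elim \<omega>)
    let ?S = "N \<omega>"
    have lf': "locally_finite_set ?S" using lf elim by blast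
    have nb: "\<exists>\<rho>\<ge>1. \<not> bad_site \<kappa> \<rho> (cell_count s ?S) b" for b using elim(1) by simp
    have "?S \<noteq> {}"
    proof
      assume "?S = {}"
      moreover obtain \<rho> where "\<not> bad_site \<kappa> \<rho> (cell_count s ?S) (\<lambda>_. 0)" using nb by blast
      moreover have "(\<lambda>_. 0) \<in> cube (\<lambda>_ :: 'd. 0) (CARD('d) + 1)" by simp
      ultimately show False unfolding bad_site_def by (auto simp: cell_count_def)
    qed
    have bdd: "bounded (voronoi_tile ?S v)" if "v \<in> ?S" for v
      using nb[of "idx s v"] not_bad_site_tile_subset[OF lf' s] bounded_subset[OF bounded_ball] by blast
    obtain P where P: "P \<in> polyominoes n ?S" using ex_polyomino[OF lf' \<open>?S \<noteq> {}\<close> bdd n] by blast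
    then have P': "P \<subseteq> ?S" "card P = n" by (auto simp: polyominoes_def)
    have deg: "3 \<le> voronoi_degree ?S v" if "v \<in> P" for v
    proof -
      obtain \<rho> where "1 \<le> \<rho>" "\<not> bad_site \<kappa> \<rho> (cell_count s ?S) (idx s v)" using nb by blast
      then show ?thesis using P' that by (intro not_bad_site_degree(1)[OF lf' s _ _ dim]) auto
    qed
    have "of_nat n * ennreal (f 3) = (\<Sum>v\<in>P. ennreal (f 3))" using P' by simp
    also have "\<dots> \<le> (\<Sum>v\<in>P. ennreal (f (real (voronoi_degree ?S v))))"
      using deg by (intro sum_mono ennreal_leI weight_function_mono[OF f]) auto
    also have "\<dots> \<le> greedy_weight n f ?S" unfolding greedy_weight_def by (rule SUP_upper[OF P])
    finally have "ennreal (f 3) * of_nat n / of_nat n \<le> greedy_weight n f ?S / of_nat n"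
      by (intro divide_right_mono_ennreal) (simp add: mult.commute)
    then show ?case using n by (simp add: mult_divide_eq_ennreal)
  qed
  then have "(\<integral>\<^sup>+ \<omega>. ennreal (f 3) \<partial>M) \<le> (\<integral>\<^sup>+ \<omega>. greedy_weight n f (N \<omega>) / of_nat n \<partial>M)"
    by (rule nn_integral_mono_AE)
  then show ?thesis by (simp add: emeasure_eq_measure prob_space)
qed

end

theorem theorem2p2:
  fixes M :: "'w measure" and N :: "'w \<Rightarrow> (real ^ 'd) set" and \<mu> :: "(real ^ 'd) measure"
  assumes "CARD('d) \<ge> 2"
    and "prob_space M"
    and "comparable_to_lebesgue \<mu>"
    and "poisson_random_set M N \<mu>"
  shows "\<exists>c1>0. \<forall>f. weight_function f \<longrightarrow> nice c1 f \<longrightarrow>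
    (\<exists>z1>0. \<exists>c2>0. \<exists>c3>0. \<forall>z\<ge>z1. \<forall>n\<ge>1.
       measure M {\<omega> \<in> space M. greedy_weight n f (N \<omega>) > ennreal (real n * z)}
         \<le> exp (- c2 * f_star f (c3 * real n * z))) \<and>
    (\<exists>c4>0.
       0 \<le> f 3 \<and>
       ennreal (f 3) \<le> liminf (\<lambda>n. \<integral>\<^sup>+ \<omega>. greedy_weight n f (N \<omega>) / of_nat n \<partial>M) \<and>
       liminf (\<lambda>n. \<integral>\<^sup>+ \<omega>. greedy_weight n f (N \<omega>) / of_nat n \<partial>M)
         \<le> limsup (\<lambda>n. \<integral>\<^sup>+ \<omega>. greedy_weight n f (N \<omega>) / of_nat n \<partial>M) \<and>
       limsup (\<lambda>n. \<integral>\<^sup>+ \<omega>. greedy_weight n f (N \<omega>) / of_nat n \<partial>M) < ennreal c4)"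
proof -
  obtain s \<tau> \<Lambda> where s: "1 \<le> s" and proc: "site_process M (\<lambda>b \<omega>. cell_count s (N \<omega>) b) \<tau> \<Lambda>"
    using poisson_site_process[OF assms(2-4)] .
  interpret site_process M "\<lambda>b \<omega>. cell_count s (N \<omega>) b" \<tau> \<Lambda> by (rule proc)
  define \<kappa> where "\<kappa> = nat \<lceil>\<Lambda> * real ((3 * Q) ^ CARD('d)) + 1\<rceil>"
  interpret voronoi_process M N s \<tau> \<Lambda> \<kappa>
  proof unfold_locales
    show "\<Lambda> * real ((3 * Q) ^ CARD('d)) + 1 \<le> real \<kappa>" unfolding \<kappa>_def by linarith
  qed (use s assms poisson_locally_finite in auto)
  show ?thesis
  proof (rule exI[of _ c1], intro conjI allI impI)
    show "0 < c1" by (rule c1_pos)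
  next
    fix f assume f: "weight_function f" "nice c1 f"
    obtain z1 c3 where z1: "0 < z1" "0 < c3" "16 \<le> c3 * z1"
      and "\<And>u. c3 * z1 \<le> u \<Longrightarrow> c1 / 4 * ln (u / 16) \<le> f_star f u"
      and dev: "\<And>n z. 1 \<le> n \<Longrightarrow> z1 \<le> z \<Longrightarrow> \<exists>E\<in>events. prob E \<le> exp (- c2 * f_star f (c3 * real n * z)) \<and>
        (\<forall>\<omega>\<in>space M - E. greedy_weight n f (N \<omega>) \<le> ennreal (real n * z))"
      using greedy_weight_deviation[OF f] by blast
    have "measure M {\<omega> \<in> space M. greedy_weight n f (N \<omega>) > ennreal (real n * z)}
         \<le> exp (- c2 * f_star f (c3 * real n * z))" if zn: "z1 \<le> z" "1 \<le> n" for z n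
    proof -
      obtain E where E: "E \<in> events" "prob E \<le> exp (- c2 * f_star f (c3 * real n * z))"
        "\<And>\<omega>. \<omega> \<in> space M - E \<Longrightarrow> greedy_weight n f (N \<omega>) \<le> ennreal (real n * z)"
        using dev[OF zn(2,1)] by blast
      have "{\<omega> \<in> space M. greedy_weight n f (N \<omega>) > ennreal (real n * z)} \<subseteq> E"
      proof
        fix \<omega> assume "\<omega> \<in> {\<omega> \<in> space M. greedy_weight n f (N \<omega>) > ennreal (real n * z)}"
        then show "\<omega> \<in> E" using E(3)[of \<omega>] by (cases "\<omega> \<in> E") (auto dest: leD)
      qed
      \<comment> \<open>Monotonicity only asks for measurability of the larger set E.\<close>
      then have "prob {\<omega> \<in> space M. greedy_weight n f (N \<omega>) > ennreal (real n * z)} \<le> prob E"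
        using E(1) by (rule finite_measure_mono)
      then show ?thesis using E(2) by linarith
    qed
    then show "\<exists>z1>0. \<exists>c2>0. \<exists>c3>0. \<forall>z\<ge>z1. \<forall>n\<ge>1.
       measure M {\<omega> \<in> space M. greedy_weight n f (N \<omega>) > ennreal (real n * z)}
         \<le> exp (- c2 * f_star f (c3 * real n * z))"
      using z1 c2_pos by blast
  next
    fix f assume f: "weight_function f" "nice c1 f"
    let ?F = "\<lambda>n. \<integral>\<^sup>+ \<omega>. greedy_weight n f (N \<omega>) / of_nat n \<partial>M"
    obtain C where C: "0 < C" "\<And>n. 1 \<le> n \<Longrightarrow> ?F n \<le> ennreal C"
      using greedy_weight_mean_le[OF f] by blast
    show "\<exists>c4>0. 0 \<le> f 3 \<and> ennreal (f 3) \<le> liminf ?F \<and> liminf ?F \<le> limsup ?F \<and> limsup ?F < ennreal c4"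
    proof (intro exI[of _ "C + 1"] conjI)
      show "0 < C + 1" using C by simp
      show "0 \<le> f 3" using weight_function_ge_1[OF f(1), of 3] by simp
      show "ennreal (f 3) \<le> liminf ?F"
        by (intro Liminf_bounded eventually_sequentiallyI[of 1] greedy_weight_mean_ge f)
      show "liminf ?F \<le> limsup ?F" by (rule Liminf_le_Limsup) simp
      have "limsup ?F \<le> ennreal C"
        by (intro Limsup_bounded eventually_sequentiallyI[of 1] C)
      also have "ennreal C < ennreal (C + 1)" using C by (simp add: ennreal_less_iff)
      finally show "limsup ?F < ennreal (C + 1)" .
    qed
  qed
qed

end
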